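(* Let $L,\ell>0$ and let $f\colon \mathbb{T}\to\mathbb{C}$ be a centrally symmetric $(L,\ell)$-bi-Lipschitz embedding. Then $f$ can be extended to a centrally symmetric $(L',\ell')$-bi-Lipschitz automorphism $F\colon\mathbb{C}\to\mathbb{C}$ (that is, $F|_{\mathbb{T}}=f$) with $L'=10^{27}L$ and $\ell'=10^{-23}\ell$.
   Context: $\mathbb{T}=\{z\in\mathbb{C}:|z|=1\}$ is the unit circle. For a subset $X\subset\mathbb{C}$ and constants $L,\ell>0$, a map $f\colon X\to\mathbb{C}$ is an $(L,\ell)$-bi-Lipschitz embedding if $\ell|a-b|\le|f(a)-f(b)|\le L|a-b|$ for all $a,b\in X$. An $(L',\ell')$-bi-Lipschitz automorphism of $\mathbb{C}$ is a bijection $F\colon\mathbb{C}\to\mathbb{C}$ that is $(L',\ell')$-bi-Lipschitz. A map $f$ is centrally symmetric if $f(-z)=-f(z)$ for all $z$ in the domain of $f$. *)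

theory Defs
  imports "HOL-Analysis.Analysis"
begin

text \<open>Maps with domain \<open>X\<close> are total functions considered on \<open>X\<close> only.\<close>

definition bilipschitz_embedding_on ::
    "real \<Rightarrow> real \<Rightarrow> complex set \<Rightarrow> (complex \<Rightarrow> complex) \<Rightarrow> bool" where
  "bilipschitz_embedding_on L l X f \<longleftrightarrow>
     (\<forall>a\<in>X. \<forall>b\<in>X. l * norm (a - b) \<le> norm (f a - f b) \<and> norm (f a - f b) \<le> L * norm (a - b))"

definition bilipschitz_automorphism :: "real \<Rightarrow> real \<Rightarrow> (complex \<Rightarrow> complex) \<Rightarrow> bool" where
  "bilipschitz_automorphism L l F \<longleftrightarrow> bij F \<and> bilipschitz_embedding_on L l UNIV F"

text \<open>The domain itself is required to be symmetric about the origin, so that \<open>f (- z)\<close> is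
  always a value of \<open>f\<close> on its domain.\<close>

definition centrally_symmetric_on :: "complex set \<Rightarrow> (complex \<Rightarrow> complex) \<Rightarrow> bool" where
  "centrally_symmetric_on X f \<longleftrightarrow> (\<forall>z\<in>X. - z \<in> X \<and> f (- z) = - f z)"

end

theory Submission
  imports Defs "HOL-Complex_Analysis.Complex_Analysis"
begin

text \<open>The inverse \<open>G\<close> of the extension is built separately on the two sides of the Jordan curve
  \<open>\<Gamma>\<close>, the image of the unit circle under \<open>f\<close>. The origin lies inside \<open>\<Gamma>\<close>, for otherwise the inside
  would carry a square root \<open>s\<close> of the identity, and \<open>s (- w) / s w\<close> would be a constant square root
  of \<open>-1\<close> that equals its own reciprocal. Hence the inside has an odd Riemann map \<open>\<Phi>\<close>, which extends to the closed disc by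
  Caratheodory's theorem. Its lift \<open>\<Theta> \<zeta> = \<Phi> (exp (\<i> * \<zeta>))\<close> to the upper half plane has boundary
  values \<open>f (cis (g u))\<close> for an increasing \<open>g\<close> that commutes with the translation by \<open>pi\<close>, after
  replacing \<open>f z\<close> by \<open>f (cnj z)\<close> if necessary. Extending \<open>g\<close> to the half plane by
  one-sided means in the manner of Beurling and Ahlfors gives \<open>\<Psi>\<close>, and \<open>G (\<Theta> \<zeta>) = exp (\<i> * \<Psi> \<zeta>)\<close>.

  The distance of \<open>\<Theta> (u + \<i> * v)\<close> to \<open>\<Gamma>\<close> is comparable with \<open>v * norm (deriv \<Theta> (u + \<i> * v))\<close> by
  Schwarz-Pick and Koebe, and with the size of the arc of \<open>\<Gamma>\<close> that corresponds to the
  interval of radius \<open>v\<close> about \<open>u\<close> by a harmonic measure estimate. Since \<open>f\<close> is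
  bi-Lipschitz, the size of this arc is comparable with an increment of \<open>g\<close>, which controls the
  derivative of \<open>\<Psi>\<close>. So the derivative of \<open>G\<close> is bounded above and below by explicit constants.

  The outside is treated in the same way with the curve \<open>1 / f\<close>. The two maps fit together to a
  homeomorphism with the required derivative bounds off \<open>\<Gamma>\<close> and \<open>0\<close>, and such bounds integrate to
  Lipschitz bounds along segments.\<close>

section \<open>Univalent functions and harmonic measure\<close>

lemma sqrt_comparison_function:
  fixes h :: "complex \<Rightarrow> complex"
  assumes S: "open S" "convex S" and hol: "h holomorphic_on S" and inj: "inj_on h S"
    and z: "z \<in> S" and y: "y \<notin> h ` S"
    and sub: "ball (h z) (norm (h z - y)) \<subseteq> h ` S"
  obtains k where "k holomorphic_on S" "\<And>x. x \<in> S \<Longrightarrow> norm (k x) \<le> 5/2" "k z = 1/2"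
    "\<And>x. x \<in> S \<Longrightarrow> norm (h x - y) * (norm (k x))\<^sup>2 \<le> (1 + norm (k x))\<^sup>2 * norm (h z - y)"
    "norm (deriv h z) = 8 * norm (h z - y) * norm (deriv k z)"
proof -
  have "(\<lambda>x. h x - y) holomorphic_on S"
    by (intro holomorphic_intros hol)
  moreover have nz: "\<And>x. x \<in> S \<Longrightarrow> h x - y \<noteq> 0" using y by auto
  moreover have "contractible S" using S(2) by (rule convex_imp_contractible)
  ultimately obtain s where s: "s holomorphic_on S" and s2: "\<And>x. x \<in> S \<Longrightarrow> h x - y = (s x)\<^sup>2"
    using contractible_imp_holomorphic_sqrt[of "\<lambda>x. h x - y" S] by blast
  define T where "T x = s x / s z" for x
  have sz: "s z \<noteq> 0" using nz[OF z] s2[OF z] by auto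
  have T: "T holomorphic_on S" unfolding T_def using sz by (intro holomorphic_intros s) auto
  have Tz: "T z = 1" using sz by (simp add: T_def)
  have \<eta>: "norm (h z - y) = (norm (s z))\<^sup>2" using s2[OF z] by (simp add: norm_power)
  have \<eta>0: "norm (h z - y) > 0" using nz[OF z] by simp
  have T2: "h x - y = (h z - y) * (T x)\<^sup>2" if "x \<in> S" for x
    using s2[OF that] s2[OF z] sz by (simp add: T_def power_divide)
  have close: "norm ((T x)\<^sup>2 - 1) < 1 \<longleftrightarrow> h x \<in> ball (h z) (norm (h z - y))" if "x \<in> S" for x
  proof -
    have "h x - h z = (h z - y) * ((T x)\<^sup>2 - 1)" using T2[OF that] by (simp add: algebra_simps)
    hence "dist (h z) (h x) = norm (h z - y) * norm ((T x)\<^sup>2 - 1)"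
      by (simp add: dist_norm norm_minus_commute norm_mult)
    thus ?thesis using \<eta>0 by simp
  qed
  define V where "V = {x \<in> S. h x \<in> ball (h z) (norm (h z - y))}"
  obtain hi where hi: "hi holomorphic_on h ` S" and inv: "\<And>x. x \<in> S \<Longrightarrow> hi (h x) = x"
    using holomorphic_has_inverse[OF hol S(1) inj] by metis
  have "V = hi ` ball (h z) (norm (h z - y))"
  proof
    show "V \<subseteq> hi ` ball (h z) (norm (h z - y))" unfolding V_def using inv by force
    show "hi ` ball (h z) (norm (h z - y)) \<subseteq> V"
    proof clarify
      fix w assume w: "w \<in> ball (h z) (norm (h z - y))"
      then obtain x where "x \<in> S" "w = h x" using sub by auto
      thus "hi w \<in> V" using w inv by (auto simp: V_def)
    qed
  qed
  moreover have "continuous_on (ball (h z) (norm (h z - y))) hi"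
    using hi sub holomorphic_on_imp_continuous_on continuous_on_subset by blast
  ultimately have conV: "connected V"
    using connected_continuous_image connected_ball by metis
  have VS: "V \<subseteq> S" by (auto simp: V_def)
  have zV: "z \<in> V" using z \<eta>0 by (simp add: V_def)
  have contRe: "continuous_on V (\<lambda>x. Re (T x))"
    using T VS by (intro continuous_intros) (meson continuous_on_subset holomorphic_on_imp_continuous_on)
  have conR: "connected ((\<lambda>x. Re (T x)) ` V)" by (rule connected_continuous_image[OF contRe conV])
  have Re0: "Re (T x) \<noteq> 0" if "x \<in> V" for x
  proof
    assume "Re (T x) = 0"
    hence "(T x)\<^sup>2 = - of_real ((Im (T x))\<^sup>2)" by (simp add: complex_eq_iff power2_eq_square)
    hence "(T x)\<^sup>2 - 1 = of_real (- (Im (T x))\<^sup>2 - 1)" by simp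
    hence "norm ((T x)\<^sup>2 - 1) = \<bar>- (Im (T x))\<^sup>2 - 1\<bar>" by (metis norm_of_real)
    moreover have "norm ((T x)\<^sup>2 - 1) < 1" using close that by (auto simp: V_def)
    ultimately show False by (smt (verit) zero_le_power2)
  qed
  have Repos: "Re (T x) > 0" if "x \<in> V" for x
  proof (rule ccontr)
    assume "\<not> Re (T x) > 0"
    hence "Re (T x) \<le> 0" "0 \<le> Re (T z)" using Tz by auto
    hence "0 \<in> (\<lambda>x. Re (T x)) ` V"
      using conR that zV by (meson connected_contains_Icc imageI atLeastAtMost_iff subsetD)
    thus False using Re0 by auto
  qed
  have low: "norm (T x + 1) \<ge> 2/5" if "x \<in> S" for x
  proof (rule ccontr)
    assume "\<not> norm (T x + 1) \<ge> 2/5"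
    hence a: "norm (T x + 1) < 2/5" by simp
    have "norm (T x - 1) \<le> norm (T x + 1) + norm (2::complex)"
      using norm_triangle_ineq4[of "T x + 1" 2] by (simp add: algebra_simps)
    hence b: "norm (T x - 1) < 12/5" using a by simp
    have "(T x)\<^sup>2 - 1 = (T x + 1) * (T x - 1)" by (simp add: power2_eq_square algebra_simps)
    hence "norm ((T x)\<^sup>2 - 1) = norm (T x + 1) * norm (T x - 1)" by (simp add: norm_mult)
    also have "\<dots> \<le> 2/5 * (12/5)" using a b by (intro mult_mono) auto
    also have "\<dots> < 1" by simp
    finally have "x \<in> V" using close that by (simp add: V_def)
    hence "Re (T x + 1) > 1" using Repos by simp
    thus False using a abs_Re_le_cmod[of "T x + 1"] by linarith
  qed
  define k where "k x = 1 / (1 + T x)" for x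
  have nz1: "1 + T x \<noteq> 0" if "x \<in> S" for x using low[OF that] by (auto simp: add.commute)
  show thesis
  proof
    show hk: "k holomorphic_on S" unfolding k_def using nz1 by (intro holomorphic_intros T) auto
    show "norm (k x) \<le> 5/2" if "x \<in> S" for x
    proof -
      have "norm (k x) = 1 / norm (T x + 1)" by (simp add: k_def norm_divide add.commute)
      also have "\<dots> \<le> 1 / (2/5)" using low[OF that] by (intro divide_left_mono) auto
      finally show ?thesis by simp
    qed
    show "k z = 1/2" by (simp add: k_def Tz)
    show "norm (h x - y) * (norm (k x))\<^sup>2 \<le> (1 + norm (k x))\<^sup>2 * norm (h z - y)" if "x \<in> S" for x
    proof -
      have "T x * k x = 1 - k x" using nz1[OF that] by (simp add: k_def field_simps)
      hence "norm (T x * k x) \<le> 1 + norm (k x)" using norm_triangle_ineq4[of 1 "k x"] by simp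
      hence "(norm (T x) * norm (k x))\<^sup>2 \<le> (1 + norm (k x))\<^sup>2"
        by (intro power_mono) (auto simp: norm_mult)
      hence "norm (h z - y) * (norm (T x) * norm (k x))\<^sup>2 \<le> norm (h z - y) * (1 + norm (k x))\<^sup>2"
        by (intro mult_left_mono) auto
      moreover have "norm (h x - y) = norm (h z - y) * (norm (T x))\<^sup>2"
        using T2[OF that] by (simp add: norm_mult norm_power)
      ultimately show ?thesis by (simp add: power_mult_distrib mult_ac)
    qed
    have "(T has_field_derivative deriv T z) (at z)"
      using holomorphic_derivI[OF T S(1) z] .
    hence "(k has_field_derivative - deriv T z / 4) (at z)" unfolding k_def
      by (auto intro!: derivative_eq_intros simp: Tz)
    hence dk: "deriv k z = - deriv T z / 4" by (rule DERIV_imp_deriv)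
    have d1: "((\<lambda>x. y + (h z - y) * (T x)\<^sup>2) has_field_derivative (h z - y) * (2 * deriv T z)) (at z)"
      using \<open>(T has_field_derivative deriv T z) (at z)\<close> by (auto intro!: derivative_eq_intros simp: Tz)
    have heq: "y + (h z - y) * (T x)\<^sup>2 = h x" if "x \<in> S" for x using T2[OF that] by (simp add: algebra_simps)
    have "(h has_field_derivative (h z - y) * (2 * deriv T z)) (at z)"
      by (rule has_field_derivative_transform_within_open[OF d1 S(1) z heq])
    hence "deriv h z = (h z - y) * (2 * deriv T z)" by (rule DERIV_imp_deriv)
    thus "norm (deriv h z) = 8 * norm (h z - y) * norm (deriv k z)"
      by (simp add: dk norm_mult norm_divide)
  qed
qed

lemma nearest_omitted_value:
  fixes A :: "complex set"
  assumes "open A" "y \<notin> A"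
  obtains y' where "y' \<notin> A" "norm (w - y') \<le> norm (w - y)" "ball w (norm (w - y')) \<subseteq> A"
proof -
  have "closed (- A)" "- A \<noteq> {}" using assms by auto
  then obtain y' where y': "y' \<in> - A" "\<And>x. x \<in> - A \<Longrightarrow> dist w y' \<le> dist w x"
    using distance_attains_inf by blast
  show thesis
  proof
    show "y' \<notin> A" "norm (w - y') \<le> norm (w - y)" using y' assms(2) by (auto simp: dist_norm)
    show "ball w (norm (w - y')) \<subseteq> A" using y'(2) by (force simp: dist_norm)
  qed
qed

lemma weak_Koebe:
  fixes h :: "complex \<Rightarrow> complex"
  assumes \<rho>: "\<rho> > 0" and hol: "h holomorphic_on ball c \<rho>" and inj: "inj_on h (ball c \<rho>)"
    and y: "y \<notin> h ` ball c \<rho>"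
  shows "norm (deriv h c) * \<rho> \<le> 20 * norm (h c - y)"
proof -
  have "open (h ` ball c \<rho>)" using open_mapping_thm3[OF hol _ inj] by simp
  then obtain y' where y': "y' \<notin> h ` ball c \<rho>" "norm (h c - y') \<le> norm (h c - y)"
      "ball (h c) (norm (h c - y')) \<subseteq> h ` ball c \<rho>"
    using nearest_omitted_value[OF _ y] by blast
  obtain k where k: "k holomorphic_on ball c \<rho>" "\<And>x. x \<in> ball c \<rho> \<Longrightarrow> norm (k x) \<le> 5/2"
    "norm (deriv h c) = 8 * norm (h c - y') * norm (deriv k c)"
    using sqrt_comparison_function[OF _ _ hol inj _ y'(1,3)] \<rho> by (metis centre_in_ball convex_ball open_ball)
  have "norm (deriv k c) * r \<le> 5/2" if r: "0 < r" "r < \<rho>" for r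
  proof -
    have "norm ((deriv ^^ 1) k c) \<le> fact 1 * (5/2) / r ^ 1"
    proof (rule Cauchy_inequality)
      show "k holomorphic_on ball c r" using holomorphic_on_subset[OF k(1), of "ball c r"] r by (simp add: subset_ball)
      have "cball c r \<subseteq> ball c \<rho>" using r by auto
      thus "continuous_on (cball c r) k" using holomorphic_on_imp_continuous_on[OF k(1)] continuous_on_subset by blast
      show "norm (k x) \<le> 5/2" if "norm (c - x) = r" for x
        using k(2) that r by (auto simp: dist_norm)
    qed (use r in auto)
    thus ?thesis using r by (simp add: field_simps)
  qed
  hence "norm (deriv k c) * \<rho> \<le> 5/2"
  proof -
    assume a: "\<And>r. 0 < r \<Longrightarrow> r < \<rho> \<Longrightarrow> norm (deriv k c) * r \<le> 5/2"
    have "((\<lambda>r. norm (deriv k c) * r) \<longlongrightarrow> norm (deriv k c) * \<rho>) (at_left \<rho>)" by (intro tendsto_intros)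
    moreover have "eventually (\<lambda>r. norm (deriv k c) * r \<le> 5/2) (at_left \<rho>)"
      using eventually_at_left_real[OF \<rho>] by eventually_elim (use a in auto)
    ultimately show ?thesis by (rule tendsto_upperbound) simp
  qed
  hence "8 * norm (h c - y') * (norm (deriv k c) * \<rho>) \<le> 8 * norm (h c - y') * (5/2)"
    by (intro mult_left_mono) auto
  thus ?thesis using k(3) y'(2) by (simp add: algebra_simps)
qed

lemma weak_Koebe_covering:
  fixes h :: "complex \<Rightarrow> complex"
  assumes "\<rho> > 0" "h holomorphic_on ball c \<rho>" "inj_on h (ball c \<rho>)"
  shows "ball (h c) (norm (deriv h c) * \<rho> / 20) \<subseteq> h ` ball c \<rho>"
  using weak_Koebe[OF assms] by (force simp: dist_norm)

lemma rotation_into_arc: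
  fixes n :: nat and \<theta> \<phi> :: real
  assumes n: "n > 0"
  obtains j \<psi> where "j < n" "\<theta> \<le> \<psi>" "\<psi> \<le> \<theta> + 2 * pi / n" "cis \<phi> * cis (2 * pi * j / n) = cis \<psi>"
proof -
  define m where "m = \<lfloor>(\<phi> - \<theta>) * n / (2 * pi)\<rfloor>"
  define \<psi> where "\<psi> = \<phi> - 2 * pi * m / n"
  define j where "j = nat ((- m) mod int n)"
  have m: "real_of_int m \<le> (\<phi> - \<theta>) * n / (2 * pi)" "(\<phi> - \<theta>) * n / (2 * pi) < m + 1"
    unfolding m_def by linarith+
  have j: "j < n" using n by (simp add: j_def nat_less_iff)
  have "int j = - m - int n * ((- m) div int n)" using n by (simp add: j_def minus_mult_div_eq_mod)
  hence "real j = - real_of_int m - real n * real_of_int ((- m) div int n)"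
    by (metis of_int_diff of_int_minus of_int_mult of_int_of_nat_eq)
  hence e: "\<phi> + 2 * pi * j / n = \<psi> + 2 * pi * real_of_int (- ((- m) div int n))"
    using n unfolding \<psi>_def \<open>real j = _\<close> by (simp add: field_simps)
  have "cis \<phi> * cis (2 * pi * j / n) = cis (\<psi> + 2 * pi * real_of_int (- ((- m) div int n)))"
    unfolding cis_mult e ..
  also have "\<dots> = cis \<psi> * cis (2 * pi * real_of_int (- ((- m) div int n)))" by (simp only: cis_mult)
  also have "cis (2 * pi * real_of_int (- ((- m) div int n))) = 1"
    by (metis cis_multiple_2pi Ints_of_int)
  finally have c: "cis \<phi> * cis (2 * pi * j / n) = cis \<psi>" by simp
  have "\<theta> \<le> \<psi>" using m(1) n by (simp add: \<psi>_def field_simps)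
  moreover have "\<psi> \<le> \<theta> + 2 * pi / n"
  proof -
    have "(\<phi> - \<theta>) * n \<le> (m + 1) * (2 * pi)" using m(2) by (simp add: field_simps)
    hence "\<phi> - \<theta> \<le> (m + 1) * (2 * pi) / n" using n by (simp add: pos_le_divide_eq)
    thus ?thesis by (simp add: \<psi>_def add_divide_distrib algebra_simps)
  qed
  ultimately show thesis using that j c by blast
qed

lemma arc_value_disc:
  fixes h :: "complex \<Rightarrow> complex" and n :: nat and r B \<theta> :: real
  assumes h: "h holomorphic_on ball 0 1" and B: "\<And>z. norm z < 1 \<Longrightarrow> norm (h z) \<le> B"
    and n: "n > 0" and r: "0 < r" "r < 1"
  obtains \<psi> where "\<theta> \<le> \<psi>" "\<psi> \<le> \<theta> + 2 * pi / n" "norm (h 0) ^ n \<le> norm (h (r * cis \<psi>)) * B ^ (n - 1)"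
proof (rule ccontr)
  assume "\<not> thesis"
  hence neg: "\<And>\<psi>. \<theta> \<le> \<psi> \<Longrightarrow> \<psi> \<le> \<theta> + 2 * pi / n \<Longrightarrow> norm (h (r * cis \<psi>)) * B ^ (n - 1) < norm (h 0) ^ n"
    using that by force
  define P where "P z = (\<Prod>j<n. h (z * cis (2 * pi * j / n)))" for z
  have P: "P holomorphic_on ball 0 1" unfolding P_def
  proof (intro holomorphic_on_prod)
    fix j
    have "(\<lambda>z. h (z * cis (2 * pi * real j / real n))) = h \<circ> (\<lambda>z. z * cis (2 * pi * real j / real n))" by auto
    moreover have "h \<circ> (\<lambda>z. z * cis (2 * pi * real j / real n)) holomorphic_on ball 0 1"
      by (rule holomorphic_on_compose_gen[OF _ h]) (auto intro!: holomorphic_intros simp: norm_mult)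
    ultimately show "(\<lambda>z. h (z * cis (2 * pi * real j / real n))) holomorphic_on ball 0 1" by simp
  qed
  have P0: "P 0 = h 0 ^ n" by (simp add: P_def)
  have lt: "norm (P z) < norm (h 0) ^ n" if z: "norm z = r" for z
  proof -
    have zz: "z = r * cis (Arg z)" using z by (metis rcis_cmod_Arg rcis_def)
    obtain j \<psi> where j: "j < n" "\<theta> \<le> \<psi>" "\<psi> \<le> \<theta> + 2 * pi / n" "cis (Arg z) * cis (2 * pi * j / n) = cis \<psi>"
      using rotation_into_arc[OF n] by blast
    have "norm (P z) = (\<Prod>i<n. norm (h (z * cis (2 * pi * i / n))))" by (simp add: P_def prod_norm)
    also have "\<dots> = norm (h (z * cis (2 * pi * j / n))) * (\<Prod>i\<in>{..<n} - {j}. norm (h (z * cis (2 * pi * i / n))))"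
      using j(1) by (intro prod.remove) auto
    also have "(\<Prod>i\<in>{..<n} - {j}. norm (h (z * cis (2 * pi * i / n)))) \<le> (\<Prod>i\<in>{..<n} - {j}. B)"
      using z r by (intro prod_mono) (auto intro!: B simp: norm_mult)
    also have "(\<Prod>i\<in>{..<n} - {j}. B) = B ^ (n - 1)" using j(1) by simp
    also have "z * cis (2 * pi * j / n) = r * cis \<psi>" using j(4) by (subst zz) (simp only: mult.assoc)
    finally have "norm (P z) \<le> norm (h (r * cis \<psi>)) * B ^ (n - 1)" by (simp add: mult_left_mono)
    also have "\<dots> < norm (h 0) ^ n" using neg j by blast
    finally show ?thesis .
  qed
  have cont: "continuous_on (cball 0 r) P"
  proof -
    have "cball 0 r \<subseteq> ball (0::complex) 1" using r by auto
    thus ?thesis using holomorphic_on_imp_continuous_on[OF P] continuous_on_subset by blast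
  qed
  have "continuous_on (sphere 0 r) (\<lambda>z. norm (P z))"
    by (intro continuous_intros continuous_on_subset[OF cont]) auto
  moreover have "sphere (0::complex) r \<noteq> {}" using r by simp
  ultimately obtain z0 where z0: "z0 \<in> sphere 0 r" "\<And>z. z \<in> sphere 0 r \<Longrightarrow> norm (P z) \<le> norm (P z0)"
    using continuous_attains_sup[of "sphere (0::complex) r" "\<lambda>z. norm (P z)"] by auto
  have "norm (P 0) \<le> norm (P z0)"
  proof (rule maximum_modulus_frontier[where S = "ball 0 r" and f = P and \<xi> = 0])
    have "ball 0 r \<subseteq> ball (0::complex) 1" using r by auto
    thus "P holomorphic_on interior (ball 0 r)" using holomorphic_on_subset[OF P] by simp
    show "continuous_on (closure (ball 0 r)) P" using cont r by simp
    show "norm (P z) \<le> norm (P z0)" if "z \<in> frontier (ball 0 r)" for z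
      using z0(2) that r by simp
  qed (use r in auto)
  also have "\<dots> < norm (h 0) ^ n" using lt z0(1) by simp
  finally show False by (simp add: P0 norm_power)
qed

lemma Cayley_disc_to_half_plane:
  assumes "norm \<xi> < 1" shows "Im (\<i> * (1 - \<xi>) / (1 + \<xi>)) > 0" "1 + \<xi> \<noteq> 0"
proof -
  show nz: "1 + \<xi> \<noteq> 0" using assms by (metis add.inverse_unique norm_minus_cancel norm_one order_less_irrefl)
  have "cnj (1 + \<xi>) \<noteq> 0" using nz by (metis complex_cnj_zero_iff)
  hence "\<i> * (1 - \<xi>) / (1 + \<xi>) = (\<i> * (1 - \<xi>)) * cnj (1 + \<xi>) / ((1 + \<xi>) * cnj (1 + \<xi>))"
    by (rule mult_divide_mult_cancel_right[symmetric])
  hence "\<i> * (1 - \<xi>) / (1 + \<xi>) = \<i> * ((1 - \<xi>) * cnj (1 + \<xi>)) / (of_real ((norm (1 + \<xi>))\<^sup>2))"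
    unfolding complex_norm_square by (simp only: mult.assoc)
  hence "Im (\<i> * (1 - \<xi>) / (1 + \<xi>)) = Im (\<i> * ((1 - \<xi>) * cnj (1 + \<xi>))) / (norm (1 + \<xi>))\<^sup>2"
    using Im_divide_of_real by metis
  moreover have "Im (\<i> * ((1 - \<xi>) * cnj (1 + \<xi>))) = 1 - (norm \<xi>)\<^sup>2"
    by (simp only: cmod_power2) (simp add: algebra_simps power2_eq_square)
  moreover have "(norm \<xi>)\<^sup>2 < 1" using assms by (simp add: power_less_one_iff)
  ultimately show "Im (\<i> * (1 - \<xi>) / (1 + \<xi>)) > 0" using nz by simp
qed

lemma Cayley_circle:
  assumes "cos (\<theta> / 2) \<noteq> 0"
  shows "\<i> * (1 - cis \<theta>) / (1 + cis \<theta>) = of_real (tan (\<theta> / 2))" "1 + cis \<theta> \<noteq> 0"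
proof -
  have c: "cis \<theta> = cis (\<theta>/2) * cis (\<theta>/2)" by (simp add: cis_mult)
  have i: "cis (-(\<theta>/2)) * cis (\<theta>/2) = 1" by (simp add: cis_mult)
  have p: "1 + cis \<theta> = cis (\<theta>/2) * of_real (2 * cos (\<theta>/2))"
  proof -
    have "1 + cis \<theta> = cis (\<theta>/2) * (cis (-(\<theta>/2)) + cis (\<theta>/2))"
      using i by (simp add: c algebra_simps)
    also have "cis (-(\<theta>/2)) + cis (\<theta>/2) = of_real (2 * cos (\<theta>/2))" by (simp add: complex_eq_iff)
    finally show ?thesis .
  qed
  have m: "1 - cis \<theta> = cis (\<theta>/2) * (- \<i> * of_real (2 * sin (\<theta>/2)))"
  proof -
    have "1 - cis \<theta> = cis (\<theta>/2) * (cis (-(\<theta>/2)) - cis (\<theta>/2))"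
      using i by (simp add: c algebra_simps)
    also have "cis (-(\<theta>/2)) - cis (\<theta>/2) = - \<i> * of_real (2 * sin (\<theta>/2))" by (simp add: complex_eq_iff)
    finally show ?thesis .
  qed
  show "1 + cis \<theta> \<noteq> 0" using assms by (simp add: p)
  show "\<i> * (1 - cis \<theta>) / (1 + cis \<theta>) = of_real (tan (\<theta> / 2))"
    using assms by (simp add: p m tan_def field_simps)
qed

text \<open>A quantitative two-constants theorem: the product of the \<open>n\<close> rotates of \<open>K\<close> in the disc
  model is small on a whole circle as soon as \<open>K\<close> is small on an arc of angle \<open>2 * pi / n\<close>.\<close>

lemma large_value_near_interval:
  fixes K :: "complex \<Rightarrow> complex" and n :: nat and u v a b B :: real
  assumes K: "K holomorphic_on {z. Im z > 0}" and B: "\<And>z. Im z > 0 \<Longrightarrow> norm (K z) \<le> B"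
    and n: "n > 0" and v: "v > 0" and ab: "arctan b - arctan a \<ge> pi / n"
  obtains t X where "u + a * v \<le> t" "t \<le> u + b * v" "\<And>m. Im (X m) > 0" "X \<longlonglongrightarrow> complex_of_real t"
    "\<And>m. norm (K (Complex u v)) ^ n \<le> norm (K (X m)) * B ^ (n - 1)"
proof -
  define c where "c \<xi> = of_real u + of_real v * (\<i> * (1 - \<xi>) / (1 + \<xi>))" for \<xi> :: complex
  have cH: "Im (c \<xi>) > 0" if "norm \<xi> < 1" for \<xi>
  proof -
    have "Im (c \<xi>) = v * Im (\<i> * (1 - \<xi>) / (1 + \<xi>))"
      unfolding c_def by (simp only: plus_complex.sel Im_complex_of_real times_complex.sel Re_complex_of_real)
    thus ?thesis using Cayley_disc_to_half_plane(1)[OF that] v by simp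
  qed
  have ch: "c holomorphic_on ball 0 1" unfolding c_def
    using Cayley_disc_to_half_plane(2) by (intro holomorphic_intros) auto
  have h: "K \<circ> c holomorphic_on ball 0 1"
    using ch K by (rule holomorphic_on_compose_gen) (use cH in auto)
  have hB: "norm ((K \<circ> c) z) \<le> B" if "norm z < 1" for z using B cH[OF that] by simp
  have c0: "c 0 = Complex u v" by (simp add: c_def complex_eq_iff)
  define \<theta> where "\<theta> = 2 * arctan a"
  have t2: "\<theta> + 2 * pi / n \<le> 2 * arctan b" 
  proof -
    have "2 * pi / n = 2 * (pi / n)" by simp
    thus ?thesis using ab unfolding \<theta>_def by linarith
  qed
  define r where "r m = 1 - 1 / (real m + 2)" for m
  have r: "0 < r m" "r m < 1" for m by (auto simp: r_def field_simps)
  have "\<exists>\<psi>. \<theta> \<le> \<psi> \<and> \<psi> \<le> \<theta> + 2 * pi / n \<and> norm ((K \<circ> c) 0) ^ n \<le> norm ((K \<circ> c) (r m * cis \<psi>)) * B ^ (n - 1)" for m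
    using arc_value_disc[OF h hB n r, where \<theta> = \<theta>] by metis
  then obtain \<psi> where \<psi>: "\<And>m. \<psi> m \<in> {\<theta>..\<theta> + 2 * pi / n}"
      "\<And>m. norm ((K \<circ> c) 0) ^ n \<le> norm ((K \<circ> c) (r m * cis (\<psi> m))) * B ^ (n - 1)"
    by (metis atLeastAtMost_iff)
  obtain \<phi> s where \<phi>: "\<phi> \<in> {\<theta>..\<theta> + 2 * pi / n}" "strict_mono (s :: nat \<Rightarrow> nat)" "(\<psi> \<circ> s) \<longlonglongrightarrow> \<phi>"
    using \<psi>(1) compact_Icc[of \<theta> "\<theta> + 2 * pi / n"] unfolding compact_def by metis
  have bnd: "\<phi>/2 \<ge> arctan a" "\<phi>/2 \<le> arctan b" using \<phi>(1) t2 by (auto simp: \<theta>_def)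
  hence bnd': "- (pi/2) < \<phi>/2" "\<phi>/2 < pi/2" using arctan_lbound[of a] arctan_ubound[of b] by linarith+
  hence cos: "cos (\<phi>/2) > 0" by (intro cos_gt_zero_pi) auto
  have tan: "a \<le> tan (\<phi>/2)" "tan (\<phi>/2) \<le> b"
    using bnd bnd' by (metis arctan_le_iff arctan_tan minus_divide_left)+
  have rl: "(\<lambda>m. r (s m)) \<longlonglongrightarrow> 1"
  proof -
    have "r \<longlonglongrightarrow> 1 - 0" unfolding r_def
      by (intro tendsto_diff tendsto_const real_tendsto_divide_at_top[OF tendsto_const])
         (auto intro!: filterlim_tendsto_add_at_top filterlim_real_sequentially simp: add.commute[of _ 2])
    hence "(r \<circ> s) \<longlonglongrightarrow> 1" using \<phi>(2) by (simp add: LIMSEQ_subseq_LIMSEQ)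
    thus ?thesis by (simp add: o_def)
  qed
  have cl: "(\<lambda>m. c (r (s m) * cis (\<psi> (s m)))) \<longlonglongrightarrow> c (of_real 1 * cis \<phi>)"
    unfolding c_def using Cayley_circle(2)[of \<phi>] cos \<phi>(3) rl
    by (intro tendsto_intros) (auto simp: o_def intro!: tendsto_intros)
  have "c (of_real 1 * cis \<phi>) = of_real (u + v * tan (\<phi>/2))"
    using Cayley_circle(1)[of \<phi>] cos by (simp add: c_def)
  with cl have lim: "(\<lambda>m. c (r (s m) * cis (\<psi> (s m)))) \<longlonglongrightarrow> of_real (u + v * tan (\<phi>/2))" by simp
  show thesis
  proof (rule that[OF _ _ _ lim])
    show "u + a * v \<le> u + v * tan (\<phi>/2)" "u + v * tan (\<phi>/2) \<le> u + b * v"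
      using tan v by (simp_all add: mult.commute)
    show "Im (c (r (s m) * cis (\<psi> (s m)))) > 0" for m
      by (rule cH) (use r[of "s m"] in \<open>simp add: norm_mult\<close>)
    show "norm (K (Complex u v)) ^ n \<le> norm (K (c (r (s m) * cis (\<psi> (s m))))) * B ^ (n - 1)" for m
      using \<psi>(2)[of "s m"] c0 by simp
  qed
qed

section \<open>The length-area method\<close>

lemma disjoint_balls_radii:
  fixes c :: "'i \<Rightarrow> complex"
  assumes fin: "finite I" and r: "\<And>i. i \<in> I \<Longrightarrow> r i \<ge> 0"
    and disj: "disjoint_family_on (\<lambda>i. ball (c i) (r i)) I"
    and sub: "\<And>i. i \<in> I \<Longrightarrow> ball (c i) (r i) \<subseteq> cball 0 L" and L: "L \<ge> 0"
  shows "(\<Sum>i\<in>I. (r i)\<^sup>2) \<le> L\<^sup>2"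
proof -
  have fm: "ball (c i) (r i) \<in> lmeasurable" for i by simp
  have "(\<Sum>i\<in>I. measure lebesgue (ball (c i) (r i))) = measure lebesgue (\<Union>i\<in>I. ball (c i) (r i))"
    by (intro measure_finite_Union[symmetric] fin disj)
       (use fmeasurableD2[OF fm] in \<open>auto simp: image_subset_iff\<close>)
  also have "\<dots> \<le> measure lebesgue (cball (0::complex) L)"
    using sub fin by (intro measure_mono_fmeasurable) (auto intro: sets.finite_UN)
  also have "\<dots> = unit_ball_vol 2 * L\<^sup>2" using L content_cball[of L "0::complex"] by simp
  also have "(\<Sum>i\<in>I. measure lebesgue (ball (c i) (r i))) = (\<Sum>i\<in>I. unit_ball_vol 2 * (r i)\<^sup>2)"
    using r by (intro sum.cong) (simp_all add: content_ball)
  finally have "unit_ball_vol 2 * (\<Sum>i\<in>I. (r i)\<^sup>2) \<le> unit_ball_vol 2 * L\<^sup>2"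
    by (simp add: sum_distrib_left)
  thus ?thesis by (simp add: mult_le_cancel_left)
qed

text \<open>A discrete form of the length-area inequality: \<open>weak_Koebe\<close> places disjoint balls in the images
  of the cells of a grid, and the column with the smallest contribution to the area is short.\<close>

lemma grid_derivative_sum:
  fixes h :: "complex \<Rightarrow> complex" and N m :: nat and a b s L :: real
  assumes S: "open S" and hol: "h holomorphic_on S" and inj: "inj_on h S" and L: "\<And>x. x \<in> S \<Longrightarrow> norm (h x) \<le> L"
    and s: "s > 0" and N: "N > 0" and m: "m > 0" and L0: "L \<ge> 0"
    and sub: "\<And>x. a < Re x \<Longrightarrow> Re x < a + m * N * s \<Longrightarrow> b < Im x \<Longrightarrow> Im x < b + N * s \<Longrightarrow> x \<in> S"
  obtains j where "j < m * N"
    "(\<Sum>k<N. norm (deriv h (Complex (a + (real j + 1/2) * s) (b + (real k + 1/2) * s))) * s) \<le> 40 * L / sqrt m"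
proof -
  define c where "c j k = Complex (a + (real j + 1/2) * s) (b + (real k + 1/2) * s)" for j k
  define r where "r j k = norm (deriv h (c j k)) * (s/2) / 20" for j k
  let ?I = "{..<m * N} \<times> {..<N}"
  have cell: "a + real j * s < Re x \<and> Re x < a + (real j + 1) * s \<and> b + real k * s < Im x \<and> Im x < b + (real k + 1) * s"
    if "x \<in> ball (c j k) (s/2)" for x j k
  proof -
    have "norm (x - c j k) < s/2" using that by (simp add: dist_norm norm_minus_commute)
    hence "\<bar>Re (x - c j k)\<bar> < s/2" "\<bar>Im (x - c j k)\<bar> < s/2"
      using abs_Re_le_cmod abs_Im_le_cmod by (meson le_less_trans)+
    moreover have rw: "Re (x - c j k) = Re x - a - real j * s - s/2" "Im (x - c j k) = Im x - b - real k * s - s/2"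
      by (simp_all add: c_def algebra_simps)
    moreover have "(real j + 1) * s = real j * s + s" "(real k + 1) * s = real k * s + s" by (simp_all add: algebra_simps)
    ultimately have "\<bar>Re x - a - real j * s - s/2\<bar> < s/2" "\<bar>Im x - b - real k * s - s/2\<bar> < s/2"
      "(real j + 1) * s = real j * s + s" "(real k + 1) * s = real k * s + s" unfolding rw by blast+
    moreover have "a + J < X \<and> X < a + (J + s)" if "\<bar>X - a - J - s/2\<bar> < s/2" for X J a :: real
    proof -
      have "X - a - J - s/2 < s/2" "- (X - a - J - s/2) < s/2" using that unfolding abs_less_iff by blast+
      thus ?thesis by simp
    qed
    ultimately show ?thesis by metis
  qed
  have inS: "ball (c j k) (s/2) \<subseteq> S" if "j < m * N" "k < N" for j k
  proof
    fix x assume x: "x \<in> ball (c j k) (s/2)"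
    have "real j + 1 \<le> real m * real N" using that(1) by (metis Suc_eq_plus1 Suc_leI of_nat_Suc of_nat_le_iff of_nat_mult add.commute)
    hence "(real j + 1) * s \<le> real m * real N * s" using s by (intro mult_right_mono) auto
    moreover have "(real k + 1) * s \<le> real N * s" using s that(2) by (intro mult_right_mono) auto
    moreover have "real j * s \<ge> 0" "real k * s \<ge> 0" using s by auto
    ultimately show "x \<in> S" using cell[OF x] by (intro sub) auto
  qed
  have cov: "ball (h (c j k)) (r j k) \<subseteq> h ` ball (c j k) (s/2)" if "j < m * N" "k < N" for j k
    unfolding r_def using s inS[OF that] hol inj
    by (intro weak_Koebe_covering) (auto intro: holomorphic_on_subset inj_on_subset)
  have uniq: "j = j'" if "a + real j * s < t" "t < a + (real j + 1) * s" "a + real j' * s < t" "t < a + (real j' + 1) * s" for j j' a t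
  proof -
    have "real j * s < (real j' + 1) * s" "real j' * s < (real j + 1) * s" using that by linarith+
    hence "real j < real j' + 1" "real j' < real j + 1" using s by (auto simp: mult_less_cancel_right)
    thus ?thesis by linarith
  qed
  have "(\<Sum>p\<in>?I. (r (fst p) (snd p))\<^sup>2) \<le> L\<^sup>2"
  proof (rule disjoint_balls_radii[where c = "\<lambda>p. h (c (fst p) (snd p))"])
    show "disjoint_family_on (\<lambda>p. ball (h (c (fst p) (snd p))) (r (fst p) (snd p))) ?I"
      unfolding disjoint_family_on_def
    proof (intro ballI impI)
      fix p q assume p: "p \<in> ?I" and q: "q \<in> ?I" and ne: "p \<noteq> q"
      obtain j k j' k' where pq: "p = (j, k)" "q = (j', k')" by force
      show "ball (h (c (fst p) (snd p))) (r (fst p) (snd p)) \<inter> ball (h (c (fst q) (snd q))) (r (fst q) (snd q)) = {}"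
      proof (rule ccontr)
        assume "\<not> ?thesis"
        then obtain w where w: "w \<in> ball (h (c j k)) (r j k)" "w \<in> ball (h (c j' k')) (r j' k')"
          by (auto simp: pq)
        obtain x y where x: "x \<in> ball (c j k) (s/2)" "w = h x" and y: "y \<in> ball (c j' k') (s/2)" "w = h y"
        proof -
          have "w \<in> h ` ball (c j k) (s/2)" "w \<in> h ` ball (c j' k') (s/2)"
            using w cov[of j k] cov[of j' k'] p q by (auto simp: pq simp del: mem_ball)
          thus thesis using that by blast
        qed
        have "x \<in> S" "y \<in> S" using x y inS[of j k] inS[of j' k'] p q by (auto simp: pq)
        hence "x = y" using x y inj by (metis inj_onD)
        hence "j = j'" "k = k'" using uniq[of a j "Re x" j'] uniq[of b k "Im x" k'] cell[OF x(1)] cell[OF y(1)] by auto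
        thus False using ne pq by simp
      qed
    qed
    show "ball (h (c (fst p) (snd p))) (r (fst p) (snd p)) \<subseteq> cball 0 L" if "p \<in> ?I" for p
      using cov[of "fst p" "snd p"] inS[of "fst p" "snd p"] that L by fastforce
  qed (use s L0 in \<open>auto simp: r_def\<close>)
  hence tot: "(\<Sum>j<m*N. \<Sum>k<N. (r j k)\<^sup>2) \<le> L\<^sup>2"
    by (simp add: sum.cartesian_product case_prod_beta)
  have "\<exists>j<m*N. (\<Sum>k<N. (r j k)\<^sup>2) \<le> L\<^sup>2 / (m * N)"
  proof (rule ccontr)
    assume "\<not> ?thesis"
    hence "\<And>j. j < m*N \<Longrightarrow> L\<^sup>2 / (m * N) < (\<Sum>k<N. (r j k)\<^sup>2)" by force
    hence "(\<Sum>j<m*N. L\<^sup>2 / (m * N)) < (\<Sum>j<m*N. \<Sum>k<N. (r j k)\<^sup>2)"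
      using m N by (intro sum_strict_mono) (auto simp: lessThan_empty_iff)
    thus False using tot m N by simp
  qed
  then obtain j where j: "j < m * N" "(\<Sum>k<N. (r j k)\<^sup>2) \<le> L\<^sup>2 / (m * N)" by blast
  have "(\<Sum>k<N. r j k)\<^sup>2 \<le> real N * (\<Sum>k<N. (r j k)\<^sup>2)"
    using sum_squared_le_sum_of_squares[of "r j" "{..<N}"] by (simp add: mult.commute)
  also have "\<dots> \<le> real N * (L\<^sup>2 / (m * N))" using j(2) by (intro mult_left_mono) auto
  also have "\<dots> = (L / sqrt m)\<^sup>2" using N m by (simp add: power_divide)
  finally have "(\<Sum>k<N. r j k) \<le> L / sqrt m" using L0 by (elim power2_le_imp_le) simp
  moreover have "(\<Sum>k<N. norm (deriv h (c j k)) * s) = 40 * (\<Sum>k<N. r j k)"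
    by (simp add: r_def sum_distrib_left)
  ultimately have "(\<Sum>k<N. norm (deriv h (c j k)) * s) \<le> 40 * L / sqrt m" by simp
  thus thesis using that[OF j(1)] by (simp add: c_def)
qed

lemma vertical_oscillation:
  fixes h :: "complex \<Rightarrow> complex" and N :: nat and t b s e :: real
  assumes S: "open S" and hol: "h holomorphic_on S" and s: "s > 0" and e: "e \<ge> 0"
    and sub: "\<And>y. b \<le> y \<Longrightarrow> y \<le> b + N * s \<Longrightarrow> Complex t y \<in> S"
    and osc: "\<And>y y'. b \<le> y \<Longrightarrow> y \<le> b + N * s \<Longrightarrow> b \<le> y' \<Longrightarrow> y' \<le> b + N * s \<Longrightarrow> \<bar>y - y'\<bar> \<le> s \<Longrightarrow>
       norm (deriv h (Complex t y) - deriv h (Complex t y')) \<le> e"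
    and n: "n \<le> N" and y: "b \<le> y" "y \<le> b + n * s"
  shows "norm (h (Complex t y) - h (Complex t b)) \<le> (\<Sum>k<n. (norm (deriv h (Complex t (b + (real k + 1/2) * s))) + e) * s)"
  using n y
proof (induction n arbitrary: y)
  case 0
  thus ?case by (auto dest: antisym)
next
  case (Suc n)
  define D where "D k = norm (deriv h (Complex t (b + (real k + 1/2) * s))) + e" for k
  have D: "D k \<ge> 0" for k using e by (simp add: D_def)
  have le: "real (Suc n) * s \<le> real N * s" using Suc.prems(1) s by (intro mult_right_mono) auto
  have IH: "norm (h (Complex t x) - h (Complex t b)) \<le> (\<Sum>k<n. D k * s)" if "b \<le> x" "x \<le> b + n * s" for x
    using Suc.IH[of x] Suc.prems(1) that by (simp add: D_def)
  show ?case
  proof (cases "y \<le> b + n * s")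
    case True
    have "(\<Sum>k<n. D k * s) \<le> (\<Sum>k<Suc n. D k * s)" using D s by simp
    thus ?thesis using IH[OF Suc.prems(2) True] by (simp add: D_def)
  next
    case False
    let ?x = "b + n * s"
    let ?C = "closed_segment (Complex t ?x) (Complex t (?x + s))"
    have seg: "\<exists>y. w = Complex t y \<and> ?x \<le> y \<and> y \<le> ?x + s" if "w \<in> ?C" for w
    proof -
      have "\<exists>q. 0 \<le> q \<and> q \<le> 1 \<and> w = (1 - q) *\<^sub>R Complex t ?x + q *\<^sub>R Complex t (?x + s)"
        using that by (simp only: in_segment)
      then obtain q where q: "0 \<le> q" "q \<le> 1" "w = (1 - q) *\<^sub>R Complex t ?x + q *\<^sub>R Complex t (?x + s)"
        by (elim exE conjE)
      hence "w = Complex t (?x + q * s)" by (simp add: complex_eq_iff algebra_simps)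
      moreover have "q * s \<le> s" "q * s \<ge> 0" using q s by (auto simp: mult_left_le_one_le)
      ultimately show ?thesis by (intro exI[of _ "?x + q * s"]) auto
    qed
    have ns: "real n * s \<ge> 0" "real (Suc n) * s = real n * s + s" using s by (auto simp: algebra_simps)
    have mid: "(real n + 1/2) * s = real n * s + s / 2" by (simp add: algebra_simps)
    have "norm (h (Complex t y) - h (Complex t ?x)) \<le> D n * norm (Complex t y - Complex t ?x)"
    proof (rule field_differentiable_bound[where S = ?C and f' = "deriv h"])
      fix w assume "w \<in> ?C"
      then obtain q where q: "w = Complex t q" "?x \<le> q" "q \<le> ?x + s" using seg by blast
      have "w \<in> S" unfolding q(1) by (intro sub; use q ns le in linarith)
      thus "(h has_field_derivative deriv h w) (at w within ?C)"
        using holomorphic_derivI[OF hol S] has_field_derivative_at_within by blast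
      have "norm (deriv h (Complex t q) - deriv h (Complex t (b + (real n + 1/2) * s))) \<le> e"
        unfolding mid by (intro osc; use q ns le s in linarith)
      thus "norm (deriv h w) \<le> D n" unfolding D_def q(1)
        using norm_triangle_sub[of "deriv h (Complex t q)" "deriv h (Complex t (b + (real n + 1/2) * s))"] by linarith
    next
      have "Complex t y = (1 - (y - ?x) / s) *\<^sub>R Complex t ?x + ((y - ?x) / s) *\<^sub>R Complex t (?x + s)"
        using s by (simp add: complex_eq_iff field_simps)
      moreover have "0 \<le> (y - ?x) / s" "(y - ?x) / s \<le> 1" using False s Suc.prems(3) ns by (auto simp: field_simps)
      ultimately show "Complex t y \<in> ?C" unfolding in_segment by blast
    qed auto
    also have "norm (Complex t y - Complex t ?x) = y - ?x" using False by (simp add: cmod_def)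
    also have "D n * (y - ?x) \<le> D n * s" using Suc.prems(3) ns D by (intro mult_left_mono) auto
    finally have "norm (h (Complex t y) - h (Complex t ?x)) \<le> D n * s" .
    moreover have "norm (h (Complex t ?x) - h (Complex t b)) \<le> (\<Sum>k<n. D k * s)" using ns by (intro IH) auto
    ultimately have "norm (h (Complex t y) - h (Complex t b)) \<le> (\<Sum>k<Suc n. D k * s)"
      using norm_triangle_ineq[of "h (Complex t y) - h (Complex t ?x)" "h (Complex t ?x) - h (Complex t b)"] by simp
    thus ?thesis by (simp add: D_def)
  qed
qed

lemma short_image_of_vertical_segment:
  fixes h :: "complex \<Rightarrow> complex" and c \<epsilon> L :: real
  defines "S \<equiv> {x. Re x < c \<and> 0 < Im x \<and> Im x < pi}"
  assumes hol: "h holomorphic_on S" and inj: "inj_on h S" and L: "\<And>x. x \<in> S \<Longrightarrow> norm (h x) \<le> L" and \<epsilon>: "\<epsilon> > 0"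
  obtains t where "t < c" "\<And>y y'. 0 < y \<Longrightarrow> y < pi \<Longrightarrow> 0 < y' \<Longrightarrow> y' < pi \<Longrightarrow>
    norm (h (Complex t y) - h (Complex t y')) \<le> \<epsilon>"
proof -
  have S: "open S" unfolding S_def
    by (intro open_Collect_conj open_halfspace_Re_lt open_halfspace_Im_lt open_halfspace_Im_gt)
  have "Complex (c - 1) 1 \<in> S" using pi_gt3 by (simp add: S_def)
  hence L0: "L \<ge> 0" using L norm_ge_zero order_trans by blast
  obtain m :: nat where m: "m > 0" "80 * L / sqrt m \<le> \<epsilon> / 2"
  proof -
    obtain m :: nat where "real m > (160 * L / \<epsilon>)\<^sup>2" using reals_Archimedean2 by blast
    moreover from this have "m > 0" by (metis of_nat_0 not_gr_zero not_less zero_le_power2)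
    moreover from calculation have "160 * L / \<epsilon> \<le> sqrt m" using real_le_rsqrt less_imp_le by blast
    ultimately show thesis using \<epsilon> that[of m] by (simp add: field_simps)
  qed
  define e where "e = \<epsilon> / (4 * pi)"
  have e: "e > 0" using \<epsilon> by (simp add: e_def)
  have step: "\<exists>t \<in> {c - 1 - m * pi..c - 1}. \<forall>y y'. \<eta> \<le> y \<longrightarrow> y \<le> pi - \<eta> \<longrightarrow> \<eta> \<le> y' \<longrightarrow> y' \<le> pi - \<eta> \<longrightarrow>
      norm (h (Complex t y) - h (Complex t y')) \<le> \<epsilon>" if \<eta>: "0 < \<eta>" "\<eta> \<le> 1" for \<eta>
  proof -
    define w where "w = pi - 2 * \<eta>"
    have w: "w > 0" "w \<le> pi" using \<eta> pi_gt3 by (auto simp: w_def)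
    define R where "R = cbox (Complex (c - 1 - m * pi) \<eta>) (Complex (c - 1) (pi - \<eta>))"
    have RS: "R \<subseteq> S" using \<eta> by (auto simp: R_def S_def in_cbox_complex_iff)
    have "continuous_on R (deriv h)"
      using holomorphic_on_imp_continuous_on[OF holomorphic_deriv[OF hol S]] RS continuous_on_subset by blast
    hence "uniformly_continuous_on R (deriv h)" by (intro compact_uniformly_continuous) (auto simp: R_def)
    then obtain d where d: "d > 0" "\<And>x x'. x \<in> R \<Longrightarrow> x' \<in> R \<Longrightarrow> dist x' x < d \<Longrightarrow> dist (deriv h x') (deriv h x) < e"
      unfolding uniformly_continuous_on_def using e by metis
    obtain N :: nat where N: "N > 0" "w / d < real N"
      by (metis reals_Archimedean2 gr0I less_trans of_nat_0 not_less_iff_gr_or_eq w(1) d(1) divide_pos_pos)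
    define s where "s = w / N"
    have s: "s > 0" "s < d" "N * s = w" using N w d(1) by (auto simp: s_def field_simps)
    define a where "a = c - 1 - m * w"
    have mw: "m * w \<le> m * pi" using w by (intro mult_left_mono) auto
    obtain j where j: "j < m * N"
        "(\<Sum>k<N. norm (deriv h (Complex (a + (real j + 1/2) * s) (\<eta> + (real k + 1/2) * s))) * s) \<le> 40 * L / sqrt m"
    proof (rule grid_derivative_sum[OF S hol inj L s(1) N(1) m(1) L0, of a \<eta>])
      show "x \<in> S" if "a < Re x" "Re x < a + real (m * N) * s" "\<eta> < Im x" "Im x < \<eta> + real N * s" for x
      proof -
        have "real (m * N) * s = m * w" using s(3) by simp
        hence "Re x < c" using that(2) unfolding a_def by linarith
        thus ?thesis using that s(3) \<eta> by (auto simp: S_def w_def)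
      qed
    qed
    define t where "t = a + (real j + 1/2) * s"
    have "real j + 1 \<le> real m * real N" using j(1) by (metis Suc_eq_plus1 Suc_leI of_nat_Suc of_nat_le_iff of_nat_mult add.commute)
    hence "(real j + 1) * s \<le> real m * real N * s" using s by (intro mult_right_mono) auto
    moreover have "(real j + 1) * s = (real j + 1/2) * s + s/2" by (simp add: algebra_simps)
    moreover have "real m * real N * s = m * w" using s(3) by simp
    moreover have "(real j + 1/2) * s \<ge> 0" using s by simp
    ultimately have t: "t \<in> {c - 1 - m * pi..c - 1}" using mw s(1)
      unfolding atLeastAtMost_iff t_def a_def by (intro conjI; linarith)
    have inR: "Complex t y \<in> R" if "\<eta> \<le> y" "y \<le> \<eta> + N * s" for y
      using that t s(3) by (auto simp: R_def in_cbox_complex_iff w_def)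
    have half: "norm (h (Complex t y) - h (Complex t \<eta>)) \<le> \<epsilon> / 2" if y: "\<eta> \<le> y" "y \<le> pi - \<eta>" for y
    proof -
      have "norm (h (Complex t y) - h (Complex t \<eta>)) \<le> (\<Sum>k<N. (norm (deriv h (Complex t (\<eta> + (real k + 1/2) * s))) + e) * s)"
      proof (rule vertical_oscillation[OF S hol s(1), where N = N])
        show "Complex t y \<in> S" if "\<eta> \<le> y" "y \<le> \<eta> + N * s" for y using inR[OF that] RS by auto
        show "norm (deriv h (Complex t y) - deriv h (Complex t y')) \<le> e"
          if "\<eta> \<le> y" "y \<le> \<eta> + N * s" "\<eta> \<le> y'" "y' \<le> \<eta> + N * s" "\<bar>y - y'\<bar> \<le> s" for y y'
        proof -
          have "dist (Complex t y) (Complex t y') = \<bar>y - y'\<bar>" by (simp add: dist_norm cmod_def)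
          hence "dist (Complex t y) (Complex t y') < d" using that s by simp
          hence "dist (deriv h (Complex t y)) (deriv h (Complex t y')) < e" using d(2) inR that by blast
          thus ?thesis by (simp add: dist_norm)
        qed
      qed (use e y s(3) in \<open>auto simp: w_def\<close>)
      also have "\<dots> = (\<Sum>k<N. norm (deriv h (Complex t (\<eta> + (real k + 1/2) * s))) * s) + N * s * e"
        by (simp add: distrib_right sum.distrib)
      also have "\<dots> \<le> 40 * L / sqrt m + w * e" using j(2) s(3) by (simp add: t_def)
      also have "\<dots> \<le> \<epsilon> / 4 + pi * e"
      proof -
        have "w * e \<le> pi * e" using w(2) e by (intro mult_right_mono) auto
        moreover have "40 * L / sqrt m = (80 * L / sqrt m) / 2" by simp
        ultimately show ?thesis using m(2) by linarith
      qed
      also have "\<dots> = \<epsilon> / 2" by (simp add: e_def)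
      finally show ?thesis .
    qed
    show ?thesis
    proof (intro bexI[OF _ t] allI impI)
      fix y y' assume "\<eta> \<le> y" "y \<le> pi - \<eta>" "\<eta> \<le> y'" "y' \<le> pi - \<eta>"
      thus "norm (h (Complex t y) - h (Complex t y')) \<le> \<epsilon>"
        using half[of y] half[of y'] norm_triangle_ineq4[of "h (Complex t y) - h (Complex t \<eta>)" "h (Complex t y') - h (Complex t \<eta>)"]
        by simp
    qed
  qed
  define \<eta> where "\<eta> n = 1 / (real n + 1)" for n
  have \<eta>: "0 < \<eta> n" "\<eta> n \<le> 1" for n by (auto simp: \<eta>_def)
  obtain t where t: "\<And>n. t n \<in> {c - 1 - m * pi..c - 1}"
     "\<And>n y y'. \<eta> n \<le> y \<Longrightarrow> y \<le> pi - \<eta> n \<Longrightarrow> \<eta> n \<le> y' \<Longrightarrow> y' \<le> pi - \<eta> n \<Longrightarrow> norm (h (Complex (t n) y) - h (Complex (t n) y')) \<le> \<epsilon>"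
    using step[OF \<eta>] by metis
  obtain l q where l: "l \<in> {c - 1 - m * pi..c - 1}" "strict_mono (q :: nat \<Rightarrow> nat)" "(t \<circ> q) \<longlonglongrightarrow> l"
    using t(1) compact_Icc[of "c - 1 - m * pi" "c - 1"] unfolding compact_def by metis
  have lim: "(\<lambda>n. h (Complex (t (q n)) y)) \<longlonglongrightarrow> h (Complex l y)" if "0 < y" "y < pi" for y
  proof -
    have "Complex l y \<in> S" using that l(1) by (auto simp: S_def)
    hence "isCont h (Complex l y)" 
      using holomorphic_on_imp_continuous_on[OF hol] S continuous_on_eq_continuous_at by blast
    moreover have "(\<lambda>n. Complex (t (q n)) y) \<longlonglongrightarrow> Complex l y"
      using l(3) by (intro tendsto_Complex) (auto simp: o_def)
    ultimately show ?thesis by (rule isCont_tendsto_compose)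
  qed
  have \<eta>0: "\<eta> \<longlonglongrightarrow> 0" unfolding \<eta>_def using LIMSEQ_inverse_real_of_nat by (simp add: inverse_eq_divide add.commute)
  hence \<eta>0: "(\<lambda>n. \<eta> (q n)) \<longlonglongrightarrow> 0" using LIMSEQ_subseq_LIMSEQ[OF _ l(2)] by (simp add: o_def)
  show thesis
  proof (rule that[of l])
    show "l < c" using l(1) by auto
    fix y y' assume y: "0 < y" "y < pi" "0 < y'" "y' < pi"
    define r where "r = min (min y y') (min (pi - y) (pi - y'))"
    have "eventually (\<lambda>n. \<eta> (q n) < r) sequentially"
      using y \<eta>0 by (intro order_tendstoD) (auto simp: r_def)
    hence "eventually (\<lambda>n. norm (h (Complex (t (q n)) y) - h (Complex (t (q n)) y')) \<le> \<epsilon>) sequentially"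
      by eventually_elim (auto intro!: t(2) simp: r_def)
    moreover have "(\<lambda>n. norm (h (Complex (t (q n)) y) - h (Complex (t (q n)) y'))) \<longlonglongrightarrow> norm (h (Complex l y) - h (Complex l y'))"
      using y by (intro tendsto_intros lim)
    ultimately show "norm (h (Complex l y) - h (Complex l y')) \<le> \<epsilon>"
      by (intro tendsto_upperbound) auto
  qed
qed

section \<open>Boundary values of the Riemann map\<close>

abbreviation upper_half_plane :: "complex set" ("\<H>") where "\<H> \<equiv> {z. 0 < Im z}"

lemma open_upper_half_plane: "open \<H>" by (rule open_halfspace_Im_gt)

lemma sin_ge_chord:
  assumes "0 \<le> x" "x \<le> pi / 2" shows "2 / pi * x \<le> sin x"
proof -
  have "convex_on {0..pi/2} (\<lambda>x. - sin x)"
  proof (rule f''_ge0_imp_convex)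
    show "((\<lambda>x. - sin x) has_real_derivative - cos x) (at x)" for x :: real
      by (auto intro!: derivative_eq_intros)
    show "((\<lambda>x. - cos x) has_real_derivative sin x) (at x)" for x :: real
      by (auto intro!: derivative_eq_intros)
    show "0 \<le> sin x" if "x \<in> {0..pi/2}" for x :: real
      using that by (intro sin_ge_zero) auto
  qed auto
  from convex_onD[OF this, of "2 / pi * x" 0 "pi/2"] show ?thesis
    using assms by (simp add: field_simps)
qed

lemma norm_cis_diff: "norm (cis x - cis y) = 2 * \<bar>sin ((x - y) / 2)\<bar>"
proof -
  have "cis x - cis y = cis y * (exp (\<i> * of_real (x - y)) - 1)"
    by (simp add: cis_conv_exp algebra_simps exp_diff)
  thus ?thesis by (simp only: norm_mult norm_cis dist_exp_i_1)
qed

lemma norm_cis_diff_le: "norm (cis x - cis y) \<le> \<bar>x - y\<bar>"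
  using abs_sin_x_le_abs_x[of "(x - y) / 2"] by (simp add: norm_cis_diff)

lemma norm_cis_diff_ge: assumes "\<bar>x - y\<bar> \<le> pi" shows "norm (cis x - cis y) \<ge> 2 / pi * \<bar>x - y\<bar>"
proof -
  have "2 / pi * (\<bar>x - y\<bar> / 2) \<le> sin (\<bar>x - y\<bar> / 2)" using assms by (intro sin_ge_chord) auto
  also have "\<dots> \<le> \<bar>sin (\<bar>x - y\<bar> / 2)\<bar>" by simp
  also have "\<dots> = \<bar>sin ((x - y) / 2)\<bar>"
  proof -
    have "sin ((x - y) / 2) = - sin ((y - x) / 2)" by (metis minus_diff_eq minus_divide_left sin_minus)
    thus ?thesis by (auto simp: abs_if[of "x - y"])
  qed
  finally show ?thesis by (simp add: norm_cis_diff)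
qed

lemma cis_in_window:
  assumes "norm z = 1" obtains x where "z = cis x" "a \<le> x" "x < a + 2 * pi"
proof -
  define k where "k = \<lfloor>(Arg z - a) / (2 * pi)\<rfloor>"
  have k: "real_of_int k \<le> (Arg z - a) / (2 * pi)" "(Arg z - a) / (2 * pi) < k + 1" unfolding k_def by linarith+
  have "z = cis (Arg z)" using assms by (metis rcis_cmod_Arg rcis_def mult_1 of_real_1)
  also have "\<dots> = cis (Arg z - 2 * pi * k)"
    by (simp add: cis_divide[symmetric] cis_multiple_2pi)
  finally show thesis using k by (intro that[of "Arg z - 2 * pi * k"]) (auto simp: field_simps)
qed

lemma sphere_eq_cis: "sphere 0 1 = range cis"
proof
  show "sphere 0 1 \<subseteq> range cis" using cis_in_window[of _ 0] by (metis mem_sphere_0 rangeI subsetI)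
qed auto

locale circle_embedding =
  fixes f :: "complex \<Rightarrow> complex" and L l :: real
  assumes l_pos: "l > 0" and L_pos: "L > 0"
    and lower: "\<And>a b. norm a = 1 \<Longrightarrow> norm b = 1 \<Longrightarrow> l * norm (a - b) \<le> norm (f a - f b)"
    and upper: "\<And>a b. norm a = 1 \<Longrightarrow> norm b = 1 \<Longrightarrow> norm (f a - f b) \<le> L * norm (a - b)"
begin

definition curve :: "complex set" ("\<Gamma>") where "\<Gamma> = f ` sphere 0 1"

lemma inj: "inj_on f (sphere 0 1)"
  using lower l_pos by (intro inj_onI) (smt (verit) eq_iff_diff_eq_0 mem_sphere_0 mult_eq_0_iff norm_eq_zero norm_ge_zero mult_pos_pos norm_zero zero_less_norm_iff)

lemma continuous: "continuous_on (sphere 0 1) f"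
proof (rule lipschitz_on_continuous_on)
  show "L-lipschitz_on (sphere 0 1) f"
    using upper L_pos by (intro lipschitz_onI) (auto simp: dist_norm)
qed

lemma curve_cis: "p \<in> \<Gamma> \<longleftrightarrow> (\<exists>t. p = f (cis t))"
  unfolding curve_def sphere_eq_cis by auto

lemma simple_loop:
  defines "c \<equiv> \<lambda>t. f (cis (2 * pi * t))"
  shows "simple_path c" "pathfinish c = pathstart c" "path_image c = \<Gamma>"
proof -
  have pi: "path_image c = f ` (\<lambda>t. cis (2 * pi * t)) ` {0..1}" by (auto simp: c_def path_image_def)
  show "pathfinish c = pathstart c" by (simp add: pathfinish_def pathstart_def c_def)
  have "continuous_on {0..1} c" unfolding c_def
    by (rule continuous_on_compose2[OF continuous]) (auto intro!: continuous_intros)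
  hence "path c" by (simp add: path_def)
  thus "simple_path c"
  proof (rule simple_pathI)
    fix x y :: real assume xy: "0 \<le> x" "x < y" "y \<le> 1" "c x = c y"
    have "f (cis (2 * pi * x)) = f (cis (2 * pi * y))" using xy(4) by (simp only: c_def)
    hence "cis (2 * pi * x) = cis (2 * pi * y)" by (rule inj_onD[OF inj]) simp_all
    hence "norm (cis (2 * pi * y) - cis (2 * pi * x)) = 0" unfolding norm_eq_zero right_minus_eq by (rule sym)
    moreover have "(2 * pi * y - 2 * pi * x) / 2 = pi * (y - x)" by (simp add: field_simps)
    ultimately have "sin (pi * (y - x)) = 0" unfolding norm_cis_diff by simp
    moreover have "sin (pi * (y - x)) > 0" if "y - x < 1"
    proof (rule sin_gt_zero)
      show "0 < pi * (y - x)" using xy by simp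
      have "pi * (y - x) < pi * 1" using that by (intro mult_strict_left_mono) auto
      thus "pi * (y - x) < pi" by simp
    qed
    ultimately show "x = 0 \<and> y = 1" using xy by fastforce
  qed
  show "path_image c = \<Gamma>" unfolding pi curve_def
  proof (intro arg_cong[where f = "image f"] equalityI subsetI)
    fix z :: complex assume "z \<in> sphere 0 1"
    then obtain x where "z = cis x" "0 \<le> x" "x < 0 + 2 * pi" using cis_in_window[of z 0] by auto
    hence "z = cis (2 * pi * (x / (2 * pi)))" "x / (2 * pi) \<in> {0..1}" by auto
    thus "z \<in> (\<lambda>t. cis (2 * pi * t)) ` {0..1}" by blast
  qed auto
qed

lemma jordan:
  "open (inside \<Gamma>)" "connected (inside \<Gamma>)" "bounded (inside \<Gamma>)" "inside \<Gamma> \<noteq> {}"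
  "open (outside \<Gamma>)" "connected (outside \<Gamma>)" "\<not> bounded (outside \<Gamma>)"
  "inside \<Gamma> \<inter> outside \<Gamma> = {}" "inside \<Gamma> \<union> outside \<Gamma> = - \<Gamma>" "frontier (inside \<Gamma>) = \<Gamma>"
  "frontier (outside \<Gamma>) = \<Gamma>" "simply_connected (inside \<Gamma>)"
  using Jordan_inside_outside[OF simple_loop(1,2)] simply_connected_inside_simple_path[OF simple_loop(1)]
  unfolding simple_loop(3) by auto

lemma closed_curve: "closed \<Gamma>" and curve_nonempty: "\<Gamma> \<noteq> {}"
  unfolding curve_def using compact_continuous_image[OF continuous] by (auto intro: compact_imp_closed)

lemma inside_not_in_curve: "w \<in> inside \<Gamma> \<Longrightarrow> w \<notin> \<Gamma>"
  using inside_no_overlap[of \<Gamma>] by blast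

lemma closure_inside: "closure (inside \<Gamma>) = inside \<Gamma> \<union> \<Gamma>"
  using closure_Un_frontier jordan(10) by metis

lemma arc_neighbourhood:
  assumes "e > 0"
  obtains d where "d > 0" "\<And>p. p \<in> \<Gamma> \<Longrightarrow> \<exists>\<sigma>. compact \<sigma> \<and> connected \<sigma> \<and> \<sigma> \<subseteq> \<Gamma> \<and> \<Gamma> \<inter> cball p d \<subseteq> \<sigma> \<and> \<sigma> \<subseteq> cball p e"
proof (rule that[of "2 * l * e / (L * pi)"])
  show "2 * l * e / (L * pi) > 0" using assms l_pos L_pos by simp
  fix p assume "p \<in> \<Gamma>"
  then obtain t where t: "p = f (cis t)" unfolding curve_cis by blast
  define \<sigma> where "\<sigma> = (\<lambda>x. f (cis x)) ` {t - e / L..t + e / L}"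
  have "continuous_on {t - e / L..t + e / L} (\<lambda>x. f (cis x))"
    by (rule continuous_on_compose2[OF continuous]) (auto intro!: continuous_intros)
  hence "connected \<sigma>" "compact \<sigma>" unfolding \<sigma>_def
    by (auto intro!: connected_continuous_image compact_continuous_image)
  moreover have "\<sigma> \<subseteq> \<Gamma>" using curve_cis by (auto simp: \<sigma>_def)
  moreover have "\<sigma> \<subseteq> cball p e"
  proof
    fix q assume "q \<in> \<sigma>"
    then obtain x where x: "q = f (cis x)" "\<bar>t - x\<bar> \<le> e / L" by (auto simp: \<sigma>_def abs_le_iff)
    have "norm (f (cis t) - f (cis x)) \<le> L * norm (cis t - cis x)" by (rule upper) auto
    also have "\<dots> \<le> L * (e / L)" using L_pos norm_cis_diff_le[of t x] x(2) by (intro mult_left_mono) auto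
    finally show "q \<in> cball p e" using L_pos by (simp add: x t dist_norm)
  qed
  moreover have "\<Gamma> \<inter> cball p (2 * l * e / (L * pi)) \<subseteq> \<sigma>"
  proof
    fix q assume q: "q \<in> \<Gamma> \<inter> cball p (2 * l * e / (L * pi))"
    then obtain z where z: "norm z = 1" "q = f z" by (auto simp: curve_def)
    obtain x where x: "z = cis x" "t - pi \<le> x" "x < t - pi + 2 * pi" using cis_in_window[OF z(1)] by metis
    have "l * (2 / pi * \<bar>t - x\<bar>) \<le> l * norm (cis t - cis x)"
      using x l_pos by (intro mult_left_mono norm_cis_diff_ge) auto
    also have "\<dots> \<le> norm (f (cis t) - f (cis x))" by (rule lower) auto
    also have "\<dots> \<le> 2 * l * e / (L * pi)" using q by (simp add: t z x dist_norm)
    finally have "\<bar>t - x\<bar> \<le> e / L" using l_pos L_pos by (simp add: field_simps)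
    thus "q \<in> \<sigma>" unfolding \<sigma>_def z x by (intro imageI) (auto simp: abs_le_iff)
  qed
  ultimately show "\<exists>\<sigma>. compact \<sigma> \<and> connected \<sigma> \<and> \<sigma> \<subseteq> \<Gamma> \<and> \<Gamma> \<inter> cball p (2 * l * e / (L * pi)) \<subseteq> \<sigma> \<and> \<sigma> \<subseteq> cball p e" by blast
qed

lemma connected_curve_minus_point: assumes "p \<in> \<Gamma>" shows "connected (\<Gamma> - {p})"
proof -
  obtain t where t: "p = f (cis t)" using assms curve_cis by blast
  have "\<Gamma> - {p} = (\<lambda>x. f (cis x)) ` {t<..<t + 2 * pi}"
  proof (intro equalityI subsetI)
    fix q assume q: "q \<in> \<Gamma> - {p}"
    then obtain z where z: "norm z = 1" "q = f z" by (auto simp: curve_def)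
    obtain x where x: "z = cis x" "t \<le> x" "x < t + 2 * pi" using cis_in_window[OF z(1)] by metis
    moreover have "x \<noteq> t" using q x z t by auto
    ultimately show "q \<in> (\<lambda>x. f (cis x)) ` {t<..<t + 2 * pi}" using z by auto
  next
    fix q assume "q \<in> (\<lambda>x. f (cis x)) ` {t<..<t + 2 * pi}"
    then obtain x where x: "q = f (cis x)" "t < x" "x < t + 2 * pi" by auto
    have "sin ((x - t) / 2) > 0" using x by (intro sin_gt_zero) auto
    hence "cis x \<noteq> cis t" using norm_cis_diff[of x t] by auto
    hence "q \<noteq> p" using inj x t by (metis inj_onD mem_sphere_0 norm_cis)
    thus "q \<in> \<Gamma> - {p}" using x curve_cis by auto
  qed
  moreover have "continuous_on {t<..<t + 2 * pi} (\<lambda>x. f (cis x))"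
    by (rule continuous_on_compose2[OF continuous]) (auto intro!: continuous_intros)
  ultimately show ?thesis by (metis connected_Ioo connected_continuous_image)
qed

end

lemma norm_exp_i: "norm (exp (\<i> * z)) = exp (- Im z)" by (simp add: norm_exp_eq_Re)

lemma exp_i_in_ball: "exp (\<i> * z) \<in> ball 0 1 \<longleftrightarrow> 0 < Im z" by (simp add: norm_exp_i)

locale conformal_curve = circle_embedding +
  fixes \<Phi> :: "complex \<Rightarrow> complex"
  assumes holomorphic: "\<Phi> holomorphic_on ball 0 1" and injective: "inj_on \<Phi> (ball 0 1)"
    and image: "\<Phi> ` ball 0 1 = inside \<Gamma>"
begin

definition lift :: "complex \<Rightarrow> complex" ("\<Theta>") where "\<Theta> \<zeta> = \<Phi> (exp (\<i> * \<zeta>))"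

definition inverse_map :: "complex \<Rightarrow> complex" where "inverse_map = inv_into (ball 0 1) \<Phi>"

lemma inverse_map [simp]: "norm z < 1 \<Longrightarrow> inverse_map (\<Phi> z) = z"
  unfolding inverse_map_def using injective by (simp add: inv_into_f_f)

lemma map_in_inside: "norm z < 1 \<Longrightarrow> \<Phi> z \<in> inside \<Gamma>" using image by auto

lemma inverse_map_in_ball: "w \<in> inside \<Gamma> \<Longrightarrow> norm (inverse_map w) < 1 \<and> \<Phi> (inverse_map w) = w"
  using image inverse_map by (metis imageE mem_ball_0)

lemma inverse_map_holomorphic: "inverse_map holomorphic_on inside \<Gamma>"
proof -
  obtain g where g: "g holomorphic_on \<Phi> ` ball 0 1" "\<And>z. z \<in> ball 0 1 \<Longrightarrow> g (\<Phi> z) = z"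
    using holomorphic_has_inverse[OF holomorphic open_ball injective] by metis
  show ?thesis unfolding image[symmetric] using g(1) by (rule holomorphic_transform) (use g(2) in auto)
qed

lemma continuous_inverse_map: "continuous_on (inside \<Gamma>) inverse_map"
  by (rule holomorphic_on_imp_continuous_on[OF inverse_map_holomorphic])

lemma not_separated_curve: "norm z1 < 1 \<Longrightarrow> norm z2 < 1 \<Longrightarrow> connected_component (- \<Gamma>) (\<Phi> z1) (\<Phi> z2)"
  unfolding connected_component_def
  using jordan(2) inside_not_in_curve map_in_inside by (intro exI[of _ "inside \<Gamma>"]) auto

text \<open>Janiszewski's theorem, applied to \<open>A\<close> and \<open>\<Gamma>\<close>, takes the place of the usual theory of crosscuts.\<close>

lemma separated:
  assumes A: "compact A" "connected (A \<inter> \<Gamma>)" and z: "norm z1 < 1" "norm z2 < 1"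
    and E: "open E1" "open E2" "E1 \<inter> E2 = {}" "z1 \<in> E1" "z2 \<in> E2"
    and cov: "\<And>z. norm z < 1 \<Longrightarrow> \<Phi> z \<notin> A \<Longrightarrow> z \<in> E1 \<union> E2"
  shows "\<not> connected_component (- A) (\<Phi> z1) (\<Phi> z2)"
proof
  assume "connected_component (- A) (\<Phi> z1) (\<Phi> z2)"
  hence "connected_component (- (A \<union> \<Gamma>)) (\<Phi> z1) (\<Phi> z2)"
    using Janiszewski[OF A(1) closed_curve A(2)] not_separated_curve[OF z] by blast
  then obtain C where C: "connected C" "C \<subseteq> - (A \<union> \<Gamma>)" "\<Phi> z1 \<in> C" "\<Phi> z2 \<in> C"
    unfolding connected_component_def by blast
  have CU: "C \<subseteq> inside \<Gamma>"
  proof (rule ccontr)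
    assume "\<not> C \<subseteq> inside \<Gamma>"
    hence "C \<inter> frontier (inside \<Gamma>) \<noteq> {}"
      using C(1,3) map_in_inside[OF z(1)] by (intro connected_Int_frontier) auto
    thus False using C(2) jordan(10) by auto
  qed
  define D where "D = inverse_map ` C"
  have "connected D" unfolding D_def
    using CU by (intro connected_continuous_image[OF continuous_on_subset[OF continuous_inverse_map]] C(1))
  moreover have "D \<subseteq> E1 \<union> E2"
  proof
    fix z assume "z \<in> D"
    then obtain w where "w \<in> C" "z = inverse_map w" by (auto simp: D_def)
    hence "norm z < 1" "\<Phi> z = w" using CU inverse_map_in_ball by auto
    thus "z \<in> E1 \<union> E2" using \<open>w \<in> C\<close> C(2) by (intro cov) auto
  qed
  moreover have "z1 \<in> D" "z2 \<in> D" using C z unfolding D_def by (metis imageI inverse_map)+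
  ultimately show False using E unfolding connected_def by blast
qed

lemma bounded_image: obtains B where "B > 0" "\<And>z. norm z < 1 \<Longrightarrow> norm (\<Phi> z) \<le> B"
proof -
  obtain B where "B > 0" "\<And>w. w \<in> inside \<Gamma> \<Longrightarrow> norm w \<le> B" using jordan(3) bounded_pos by blast
  thus thesis using that map_in_inside by blast
qed

lemma lift_holomorphic: "\<Theta> holomorphic_on \<H>"
proof -
  have "\<Phi> \<circ> (\<lambda>\<zeta>. exp (\<i> * \<zeta>)) holomorphic_on \<H>"
    by (rule holomorphic_on_compose_gen[OF _ holomorphic]) (auto intro!: holomorphic_intros simp: norm_exp_i)
  thus ?thesis by (simp add: o_def lift_def[abs_def])
qed

lemma lift_continuous: "continuous_on \<H> \<Theta>"
  by (rule holomorphic_on_imp_continuous_on[OF lift_holomorphic])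

lemma small_crosscut:
  assumes "\<delta> > 0" "\<rho>0 > 0"
  obtains \<rho> where "0 < \<rho>" "\<rho> < \<rho>0" "\<And>x y. x \<in> \<H> \<Longrightarrow> y \<in> \<H> \<Longrightarrow> norm (x - of_real u) = \<rho> \<Longrightarrow> norm (y - of_real u) = \<rho>
    \<Longrightarrow> norm (\<Theta> x - \<Theta> y) \<le> \<delta>"
proof -
  define c where "c = ln (min \<rho>0 3)"
  define S where "S = {x. Re x < c \<and> 0 < Im x \<and> Im x < pi}"
  have expS: "0 < Im (exp x)" "norm (exp x) < min \<rho>0 3" if "x \<in> S" for x
  proof -
    show "0 < Im (exp x)" using that by (simp add: S_def Im_exp sin_gt_zero)
    have "exp (Re x) < exp c" using that by (simp add: S_def)
    also have "exp c = min \<rho>0 3" using assms by (simp add: c_def)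
    finally show "norm (exp x) < min \<rho>0 3" by (simp add: norm_exp_eq_Re)
  qed
  have "\<Theta> \<circ> (\<lambda>x. of_real u + exp x) holomorphic_on S"
    by (rule holomorphic_on_compose_gen[OF _ lift_holomorphic]) (auto intro!: holomorphic_intros simp: expS)
  hence hol: "(\<lambda>x. \<Theta> (of_real u + exp x)) holomorphic_on S" by (simp add: o_def)
  have inj: "inj_on (\<lambda>x. \<Theta> (of_real u + exp x)) S"
  proof (rule inj_onI)
    fix x y assume x: "x \<in> S" and y: "y \<in> S" and eq: "\<Theta> (of_real u + exp x) = \<Theta> (of_real u + exp y)"
    have "exp (\<i> * (of_real u + exp x)) = exp (\<i> * (of_real u + exp y))"
      using injective expS[OF x] expS[OF y] eq unfolding lift_def inj_on_def exp_i_in_ball[symmetric]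
      by (auto simp: norm_exp_i)
    then obtain n :: int where "\<i> * (of_real u + exp x) = \<i> * (of_real u + exp y) + of_real (2 * of_int n * pi) * \<i>"
      unfolding exp_eq by auto
    hence "\<i> * (of_real u + exp x) = \<i> * (of_real u + exp y + of_real (2 * of_int n * pi))" by (simp only: distrib_left mult_ac)
    hence n: "exp x = exp y + of_real (2 * of_int n * pi)" by (simp only: mult_cancel_left) simp
    hence "norm (exp x - exp y) = norm (of_real (2 * of_int n * pi) :: complex)" by (simp only: add_diff_cancel_left')
    also have "\<dots> = \<bar>real_of_int n\<bar> * (2 * pi)" unfolding norm_of_real by (simp add: abs_mult)
    finally have "\<bar>real_of_int n\<bar> * (2 * pi) = norm (exp x - exp y)" ..
    also have "\<dots> < 3 + 3" using expS(2)[OF x] expS(2)[OF y] norm_triangle_ineq4[of "exp x" "exp y"] by linarith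
    finally have "\<bar>real_of_int n\<bar> * (2 * pi) < 6" by simp
    moreover have "\<bar>real_of_int n\<bar> * 6 \<le> \<bar>real_of_int n\<bar> * (2 * pi)" using pi_gt3 by (intro mult_left_mono) auto
    ultimately have "\<bar>real_of_int n\<bar> < 1" by linarith
    hence "n = 0" by linarith
    hence "exp x = exp y" using n by simp
    then obtain k :: int where k: "x = y + of_real (2 * of_int k * pi) * \<i>" unfolding exp_eq by auto
    hence "Im x = Im y + 2 * k * pi" by simp
    moreover have "\<bar>Im x - Im y\<bar> < pi" using x y by (auto simp: S_def)
    ultimately have "\<bar>2 * real_of_int k\<bar> * pi < 1 * pi" by (simp add: abs_mult)
    hence "\<bar>2 * real_of_int k\<bar> < 1" by (simp only: mult_less_cancel_right) auto
    hence "k = 0" by linarith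
    thus "x = y" using k by simp
  qed
  obtain B where B: "B > 0" "\<And>z. norm z < 1 \<Longrightarrow> norm (\<Phi> z) \<le> B" using bounded_image by blast
  have bd: "norm (\<Theta> (of_real u + exp x)) \<le> B" if "x \<in> S" for x
    unfolding lift_def using expS[OF that] by (intro B) (simp add: norm_exp_i)
  obtain t where t: "t < c" "\<And>y y'. 0 < y \<Longrightarrow> y < pi \<Longrightarrow> 0 < y' \<Longrightarrow> y' < pi \<Longrightarrow>
      norm (\<Theta> (of_real u + exp (Complex t y)) - \<Theta> (of_real u + exp (Complex t y'))) \<le> \<delta>"
    using short_image_of_vertical_segment[OF hol[unfolded S_def] inj[unfolded S_def] bd[unfolded S_def] assms(1)] by blast
  have polar: "\<exists>y. 0 < y \<and> y < pi \<and> x = of_real u + exp (Complex t y)" if "x \<in> \<H>" "norm (x - of_real u) = exp t" for x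
  proof -
    have nz: "x - of_real u \<noteq> 0" using that by auto
    have "Re (Ln (x - of_real u)) = t" using nz that(2) by simp
    moreover have "0 < Im (Ln (x - of_real u)) \<and> Im (Ln (x - of_real u)) < pi"
      using Im_Ln_pos_lt[OF nz] that(1) by simp
    moreover have "exp (Ln (x - of_real u)) = x - of_real u" using nz by simp
    ultimately show ?thesis by (intro exI[of _ "Im (Ln (x - of_real u))"]) (metis add.commute complex_surj diff_add_cancel)
  qed
  have "exp t < exp c" using t(1) by simp
  hence "exp t < min \<rho>0 3" using assms by (simp add: c_def)
  thus thesis using polar t(2) by (intro that[of "exp t"]) (simp, simp, metis)
qed

lemma lift_Cauchy_at_boundary:
  assumes \<epsilon>: "\<epsilon> > 0"
  obtains \<rho> where "\<rho> > 0" "\<And>x y. x \<in> \<H> \<Longrightarrow> y \<in> \<H> \<Longrightarrow> norm (x - of_real u) < \<rho> \<Longrightarrow> norm (y - of_real u) < \<rho>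
    \<Longrightarrow> norm (\<Theta> x - \<Theta> y) \<le> \<epsilon>"
proof -
  obtain d0 where d0: "d0 > 0" "cball (\<Phi> 0) d0 \<subseteq> inside \<Gamma>"
    using jordan(1) map_in_inside[of 0] open_contains_cball by (metis norm_zero zero_less_one)
  define e where "e = min \<epsilon> d0 / 4"
  have e: "e > 0" "4 * e \<le> \<epsilon>" "4 * e \<le> d0" using \<epsilon> d0 by (auto simp: e_def)
  obtain d where d: "d > 0" "\<And>p. p \<in> \<Gamma> \<Longrightarrow> \<exists>\<sigma>. compact \<sigma> \<and> connected \<sigma> \<and> \<sigma> \<subseteq> \<Gamma> \<and> \<Gamma> \<inter> cball p d \<subseteq> \<sigma> \<and> \<sigma> \<subseteq> cball p e"
    using arc_neighbourhood[OF e(1)] by blast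
  have "compact (inverse_map ` cball (\<Phi> 0) d0)"
    using d0(2) by (intro compact_continuous_image continuous_on_subset[OF continuous_inverse_map]) auto
  moreover have "inverse_map ` cball (\<Phi> 0) d0 \<subseteq> ball 0 1" using d0(2) inverse_map_in_ball by auto
  moreover have "inverse_map ` cball (\<Phi> 0) d0 \<noteq> {}" using d0(1) by simp
  ultimately obtain z0 where z0: "z0 \<in> inverse_map ` cball (\<Phi> 0) d0"
      "\<And>z. z \<in> inverse_map ` cball (\<Phi> 0) d0 \<Longrightarrow> norm z \<le> norm z0"
    using continuous_attains_sup[of "inverse_map ` cball (\<Phi> 0) d0" norm] continuous_on_norm_id by blast
  have z01: "norm z0 < 1" using z0(1) \<open>inverse_map ` cball (\<Phi> 0) d0 \<subseteq> ball 0 1\<close> by auto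
  define r where "r = max (norm z0) (1/2)"
  have r: "0 < r" "r < 1" using z01 by (auto simp: r_def)
  have far: "dist (\<Phi> 0) (\<Phi> z) > d0" if "norm z < 1" "norm z > r" for z
  proof (rule ccontr)
    assume "\<not> ?thesis"
    hence "inverse_map (\<Phi> z) \<in> inverse_map ` cball (\<Phi> 0) d0" by (intro imageI) simp
    thus False using z0(2)[of z] that by (simp add: r_def)
  qed
  have "min d e > 0" "- ln r > 0" using d(1) e(1) r by auto
  then obtain \<rho> where \<rho>: "0 < \<rho>" "\<rho> < - ln r" "\<And>x y. x \<in> \<H> \<Longrightarrow> y \<in> \<H> \<Longrightarrow> norm (x - of_real u) = \<rho> \<Longrightarrow> norm (y - of_real u) = \<rho>
    \<Longrightarrow> norm (\<Theta> x - \<Theta> y) \<le> min d e"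
    using small_crosscut[of "min d e" "- ln r" u] by blast
  define K where "K = \<Theta> ` {x \<in> \<H>. norm (x - of_real u) = \<rho>}"
  have KK: "dist a b \<le> min d e" if "a \<in> K" "b \<in> K" for a b
    using that \<rho>(3) by (auto simp: K_def dist_norm)
  have KK': "K \<subseteq> cball a (min d e)" if "a \<in> closure K" for a
  proof
    fix b assume b: "b \<in> K"
    have "K \<subseteq> cball b (min d e)" using KK[OF b] by auto
    hence "closure K \<subseteq> cball b (min d e)" by (rule closure_minimal) simp
    thus "b \<in> cball a (min d e)" using that by (auto simp: dist_commute)
  qed
  have clK: "closure K \<subseteq> cball a (min d e)" if "a \<in> closure K" for a
    using KK'[OF that] by (rule closure_minimal) simp
  define q where "q = \<Theta> (of_real u + \<i> * of_real \<rho>)"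
  have qK: "q \<in> K" using \<rho>(1) by (auto simp: q_def K_def norm_mult)
  have "ln r < - \<rho>" using \<rho>(2) by simp
  hence "exp (ln r) < exp (- \<rho>)" by (simp only: exp_less_cancel_iff)
  hence "r < exp (- \<rho>)" using r by simp
  hence far_q: "dist (\<Phi> 0) q > d0"
    unfolding q_def lift_def using \<rho>(1) by (intro far) (auto simp: norm_exp_i)
  obtain \<sigma> where \<sigma>: "compact \<sigma>" "connected \<sigma>" "\<sigma> \<subseteq> \<Gamma>" "closure K \<inter> \<Gamma> \<subseteq> \<sigma>" "\<sigma> \<subseteq> cball q (2 * e)"
  proof (cases "closure K \<inter> \<Gamma> = {}")
    case True
    thus thesis by (intro that[of "{}"]) auto
  next
    case False
    then obtain p where p: "p \<in> closure K" "p \<in> \<Gamma>" by blast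
    obtain \<sigma> where s: "compact \<sigma>" "connected \<sigma>" "\<sigma> \<subseteq> \<Gamma>" "\<Gamma> \<inter> cball p d \<subseteq> \<sigma>" "\<sigma> \<subseteq> cball p e" using d(2)[OF p(2)] by blast
    have "dist q p \<le> e" using clK[OF p(1)] qK closure_subset by (fastforce simp: dist_commute)
    hence "cball p e \<subseteq> cball q (2 * e)" by (simp add: cball_subset_cball_iff dist_commute)
    moreover have "closure K \<inter> \<Gamma> \<subseteq> \<Gamma> \<inter> cball p d" using clK[OF p(1)] by auto
    ultimately show thesis using s by (intro that[of \<sigma>]) auto
  qed
  define A where "A = closure K \<union> \<sigma>"
  have "q \<in> closure K" using qK closure_subset by blast
  hence "closure K \<subseteq> cball q (2 * e)" using clK[of q] e(1) by (fastforce simp: cball_def)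
  hence Aq: "A \<subseteq> cball q (2 * e)" using \<sigma>(5) by (simp add: A_def)
  have "bounded K" using KK by (metis bounded_def)
  hence cA: "compact A" unfolding A_def using \<sigma>(1) by (intro compact_Un) simp_all
  have A\<Gamma>: "connected (A \<inter> \<Gamma>)"
  proof -
    have "A \<inter> \<Gamma> = \<sigma>" using \<sigma>(3,4) by (auto simp: A_def)
    thus ?thesis using \<sigma>(2) by simp
  qed
  have main: "dist q (\<Theta> x) \<le> 2 * e" if x: "x \<in> \<H>" "norm (x - of_real u) < \<rho>" for x
  proof (rule ccontr)
    assume nd: "\<not> ?thesis"
    define z where "z = exp (\<i> * x)"
    have z1: "norm z < 1" using x by (simp add: z_def norm_exp_i)
    have "connected (- cball q (2 * e))" by (intro connected_complement_bounded_convex) auto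
    hence "connected_component (- A) (\<Phi> z) (\<Phi> 0)"
      unfolding connected_component_def using Aq nd far_q e d0
      by (intro exI[of _ "- cball q (2 * e)"]) (auto simp: z_def lift_def dist_commute)
    moreover have "\<not> connected_component (- A) (\<Phi> z) (\<Phi> 0)"
    proof (rule separated[OF cA A\<Gamma> z1])
      let ?E = "(\<lambda>x. exp (\<i> * x)) ` (ball (of_real u) \<rho> \<inter> \<H>)"
      let ?F = "(\<lambda>x. exp (\<i> * x)) ` (cball (of_real u) \<rho> \<inter> {x. Im x \<ge> 0})"
      show "open ?E"
      proof (rule open_mapping_thm[where S = UNIV])
        show "\<not> (\<lambda>x. exp (\<i> * x)) constant_on UNIV"
        proof
          assume "(\<lambda>x. exp (\<i> * x)) constant_on UNIV"
          then obtain c where "\<And>x. exp (\<i> * x) = c" unfolding constant_on_def by blast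
          hence "exp (\<i> * 0) = exp (\<i> * of_real pi)" by metis
          thus False by simp
        qed
      qed (auto intro!: holomorphic_intros open_Int open_upper_half_plane)
      have "compact ?F"
        by (intro compact_continuous_image continuous_intros compact_Int_closed closed_halfspace_Im_ge) auto
      thus "open (ball 0 1 - ?F)" by (intro open_Diff compact_imp_closed) auto
      show "?E \<inter> (ball 0 1 - ?F) = {}" by (auto simp: less_imp_le intro!: imageI)
      show "z \<in> ?E" unfolding z_def using x by (intro imageI) (auto simp: dist_norm norm_minus_commute)
      show "0 \<in> ball 0 1 - ?F" by auto
      show "y \<in> ?E \<union> (ball 0 1 - ?F)" if y: "norm y < 1" "\<Phi> y \<notin> A" for y
      proof (rule ccontr)
        assume n: "y \<notin> ?E \<union> (ball 0 1 - ?F)"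
        then obtain x where x: "y = exp (\<i> * x)" "norm (x - of_real u) \<le> \<rho>" "Im x \<ge> 0"
          using y(1) by (auto simp: dist_norm norm_minus_commute)
        have xH: "x \<in> \<H>" using y(1) x by (simp add: norm_exp_i)
        have "norm (x - of_real u) = \<rho>"
        proof (rule ccontr)
          assume "norm (x - of_real u) \<noteq> \<rho>"
          hence "x \<in> ball (of_real u) \<rho> \<inter> \<H>" using x xH by (auto simp: dist_norm norm_minus_commute)
          thus False using n x(1) by blast
        qed
        hence "\<Theta> x \<in> K" using xH by (auto simp: K_def)
        thus False using y(2) closure_subset x(1) by (auto simp: A_def lift_def)
      qed
    qed simp
    ultimately show False by blast
  qed
  show thesis
  proof (rule that[OF \<rho>(1)])
    fix x y assume "x \<in> \<H>" "y \<in> \<H>" "norm (x - of_real u) < \<rho>" "norm (y - of_real u) < \<rho>"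
    hence "dist q (\<Theta> x) \<le> 2 * e" "dist q (\<Theta> y) \<le> 2 * e" using main by blast+
    hence "dist (\<Theta> x) (\<Theta> y) \<le> 4 * e" using dist_triangle3[of "\<Theta> x" "\<Theta> y" q] by linarith
    thus "norm (\<Theta> x - \<Theta> y) \<le> \<epsilon>" using e by (simp add: dist_norm)
  qed
qed

definition boundary :: "real \<Rightarrow> complex" ("\<theta>") where
  "\<theta> u = lim (\<lambda>n. \<Theta> (of_real u + \<i> / of_nat (Suc n)))"

lemma vertical_sequence:
  "of_real u + \<i> / of_nat (Suc n) \<in> \<H>" "(\<lambda>n. of_real u + \<i> / of_nat (Suc n) :: complex) \<longlonglongrightarrow> of_real u"
proof -
  show "of_real u + \<i> / of_nat (Suc n) \<in> \<H>" by (simp add: Im_divide_of_nat del: of_nat_Suc)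
  have "(\<lambda>n. of_real u + \<i> * of_real (inverse (of_nat (Suc n))) :: complex) \<longlonglongrightarrow> of_real u + \<i> * of_real 0"
    by (intro tendsto_intros LIMSEQ_inverse_real_of_nat)
  thus "(\<lambda>n. of_real u + \<i> / of_nat (Suc n) :: complex) \<longlonglongrightarrow> of_real u" by (simp add: divide_inverse)
qed

lemma boundary_LIMSEQ: "(\<lambda>n. \<Theta> (of_real u + \<i> / of_nat (Suc n))) \<longlonglongrightarrow> \<theta> u"
proof -
  have "Cauchy (\<lambda>n. \<Theta> (of_real u + \<i> / of_nat (Suc n)))"
  proof (rule metric_CauchyI)
    fix e :: real assume "e > 0"
    hence "e / 2 > 0" by simp
    from lift_Cauchy_at_boundary[OF this, of u] obtain \<rho> where \<rho>: "\<rho> > 0"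
        "\<And>x y. x \<in> \<H> \<Longrightarrow> y \<in> \<H> \<Longrightarrow> norm (x - of_real u) < \<rho> \<Longrightarrow> norm (y - of_real u) < \<rho> \<Longrightarrow> norm (\<Theta> x - \<Theta> y) \<le> e / 2" by blast
    from vertical_sequence(2)[THEN LIMSEQ_D, OF \<rho>(1), of u] obtain N where
      N: "\<And>n. n \<ge> N \<Longrightarrow> norm (of_real u + \<i> / of_nat (Suc n) - of_real u :: complex) < \<rho>" by blast
    have "dist (\<Theta> (of_real u + \<i> / of_nat (Suc m))) (\<Theta> (of_real u + \<i> / of_nat (Suc n))) < e" if "m \<ge> N" "n \<ge> N" for m n
      using \<rho>(2)[OF vertical_sequence(1) vertical_sequence(1) N N, OF that] \<open>e > 0\<close> unfolding dist_norm by linarith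
    thus "\<exists>M. \<forall>m\<ge>M. \<forall>n\<ge>M. dist (\<Theta> (of_real u + \<i> / of_nat (Suc m))) (\<Theta> (of_real u + \<i> / of_nat (Suc n))) < e" by blast
  qed
  thus ?thesis unfolding boundary_def by (simp add: Cauchy_convergent_iff convergent_LIMSEQ_iff del: of_nat_Suc)
qed

lemma boundary_close:
  assumes "\<epsilon> > 0"
  obtains \<rho> where "\<rho> > 0" "\<And>x. x \<in> \<H> \<Longrightarrow> norm (x - of_real u) < \<rho> \<Longrightarrow> norm (\<Theta> x - \<theta> u) \<le> \<epsilon>"
proof -
  from lift_Cauchy_at_boundary[OF assms, of u] obtain \<rho> where \<rho>: "\<rho> > 0"
    "\<And>x y. x \<in> \<H> \<Longrightarrow> y \<in> \<H> \<Longrightarrow> norm (x - of_real u) < \<rho> \<Longrightarrow> norm (y - of_real u) < \<rho> \<Longrightarrow> norm (\<Theta> x - \<Theta> y) \<le> \<epsilon>" by blast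
  from vertical_sequence(2)[THEN LIMSEQ_D, OF \<rho>(1), of u] obtain N where
    N: "\<And>n. n \<ge> N \<Longrightarrow> norm (of_real u + \<i> / of_nat (Suc n) - of_real u :: complex) < \<rho>" by blast
  show thesis
  proof (rule that[OF \<rho>(1)])
    fix x assume x: "x \<in> \<H>" "norm (x - of_real u) < \<rho>"
    have "(\<lambda>n. norm (\<Theta> x - \<Theta> (of_real u + \<i> / of_nat (Suc n)))) \<longlonglongrightarrow> norm (\<Theta> x - \<theta> u)"
      by (intro tendsto_intros boundary_LIMSEQ)
    moreover have "eventually (\<lambda>n. norm (\<Theta> x - \<Theta> (of_real u + \<i> / of_nat (Suc n))) \<le> \<epsilon>) sequentially"
      using eventually_ge_at_top[of N] by eventually_elim (use \<rho>(2) x N vertical_sequence(1) in blast)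
    ultimately show "norm (\<Theta> x - \<theta> u) \<le> \<epsilon>" by (rule tendsto_upperbound) simp
  qed
qed

lemma boundary_tendsto: "(\<Theta> \<longlongrightarrow> \<theta> u) (at (of_real u) within \<H>)"
proof (rule tendstoI)
  fix e :: real assume "e > 0"
  hence "e / 2 > 0" by simp
  from boundary_close[OF this, of u] obtain \<rho> where \<rho>: "\<rho> > 0"
     "\<And>x. x \<in> \<H> \<Longrightarrow> norm (x - of_real u) < \<rho> \<Longrightarrow> norm (\<Theta> x - \<theta> u) \<le> e / 2" by blast
  thus "eventually (\<lambda>x. dist (\<Theta> x) (\<theta> u) < e) (at (of_real u) within \<H>)"
    unfolding eventually_at using \<open>e > 0\<close>
    by (intro exI[of _ \<rho>]) (force simp: dist_norm)
qed

lemma boundary_seq: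
  assumes "\<And>n. X n \<in> \<H>" "X \<longlonglongrightarrow> of_real u" shows "(\<lambda>n. \<Theta> (X n)) \<longlonglongrightarrow> \<theta> u"
proof -
  have "X n \<noteq> of_real u" for n using assms(1)[of n] by (metis Im_complex_of_real less_irrefl mem_Collect_eq)
  hence "filterlim X (at (of_real u) within \<H>) sequentially"
    using assms by (auto simp: filterlim_at intro!: always_eventually)
  thus ?thesis using boundary_tendsto filterlim_compose by blast
qed

lemma boundary_in_curve: "\<theta> u \<in> \<Gamma>"
proof (rule ccontr)
  assume n: "\<theta> u \<notin> \<Gamma>"
  have norm1: "norm (exp (\<i> * (of_real u + \<i> / of_nat (Suc n)))) < 1" for n
    using vertical_sequence(1)[of u n] exp_i_in_ball by (simp del: of_nat_Suc)
  have "\<theta> u \<in> closure (inside \<Gamma>)"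
    unfolding closure_sequential
    by (intro exI[of _ "\<lambda>n. \<Theta> (of_real u + \<i> / of_nat (Suc n))"] conjI allI boundary_LIMSEQ)
       (simp add: lift_def map_in_inside norm1 del: of_nat_Suc)
  hence ins: "\<theta> u \<in> inside \<Gamma>" using n closure_inside by auto
  hence "isCont inverse_map (\<theta> u)"
    using continuous_inverse_map jordan(1) continuous_on_eq_continuous_at by blast
  hence "(\<lambda>n. inverse_map (\<Theta> (of_real u + \<i> / of_nat (Suc n)))) \<longlonglongrightarrow> inverse_map (\<theta> u)"
    using boundary_LIMSEQ isCont_tendsto_compose by blast
  hence "(\<lambda>n. exp (\<i> * (of_real u + \<i> / of_nat (Suc n)))) \<longlonglongrightarrow> inverse_map (\<theta> u)"
    by (simp add: lift_def norm1 del: of_nat_Suc)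
  moreover have "(\<lambda>n. exp (\<i> * (of_real u + \<i> / of_nat (Suc n)))) \<longlonglongrightarrow> exp (\<i> * of_real u)"
    by (intro tendsto_intros vertical_sequence)
  ultimately have "inverse_map (\<theta> u) = exp (\<i> * of_real u)" by (rule LIMSEQ_unique)
  hence "norm (inverse_map (\<theta> u)) = 1" by simp
  thus False using inverse_map_in_ball[OF ins] by simp
qed

lemma boundary_continuous: "continuous_on UNIV \<theta>"
proof -
  have "isCont \<theta> u" for u
    unfolding isCont_def
  proof (rule tendstoI)
    fix e :: real assume "e > 0"
    hence "e / 2 > 0" by simp
    from boundary_close[OF this, of u] obtain \<rho> where \<rho>: "\<rho> > 0"
       "\<And>x. x \<in> \<H> \<Longrightarrow> norm (x - of_real u) < \<rho> \<Longrightarrow> norm (\<Theta> x - \<theta> u) \<le> e / 2" by blast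
    have "dist (\<theta> t) (\<theta> u) < e" if "dist t u < \<rho>" for t
    proof -
      have "(\<lambda>n. norm (\<Theta> (of_real t + \<i> / of_nat (Suc n)) - \<theta> u)) \<longlonglongrightarrow> norm (\<theta> t - \<theta> u)"
        by (intro tendsto_intros boundary_LIMSEQ)
      moreover have "(\<lambda>n. norm (of_real t + \<i> / of_nat (Suc n) - of_real u :: complex)) \<longlonglongrightarrow> norm (of_real t - of_real u :: complex)"
        by (intro tendsto_intros vertical_sequence)
      hence "eventually (\<lambda>n. norm (of_real t + \<i> / of_nat (Suc n) - of_real u :: complex) < \<rho>) sequentially"
        using that by (intro order_tendstoD) (auto simp: dist_norm simp flip: of_real_diff)
      hence "eventually (\<lambda>n. norm (\<Theta> (of_real t + \<i> / of_nat (Suc n)) - \<theta> u) \<le> e / 2) sequentially"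
        by eventually_elim (intro \<rho>(2) vertical_sequence(1))
      ultimately have "norm (\<theta> t - \<theta> u) \<le> e / 2" by (rule tendsto_upperbound) simp
      thus ?thesis using \<open>e > 0\<close> by (simp add: dist_norm)
    qed
    thus "eventually (\<lambda>t. dist (\<theta> t) (\<theta> u) < e) (at u)"
      unfolding eventually_at using \<rho>(1) by blast
  qed
  thus ?thesis by (simp add: continuous_at_imp_continuous_on)
qed

lemma lift_periodic: "\<Theta> (\<zeta> + of_real (2 * pi)) = \<Theta> \<zeta>"
proof -
  have "\<i> * (\<zeta> + of_real (2 * pi)) = \<i> * \<zeta> + of_real (2 * pi) * \<i>" by (simp add: algebra_simps)
  also have "exp \<dots> = exp (\<i> * \<zeta>)" by (simp add: exp_add)
  finally show ?thesis unfolding lift_def by simp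
qed

lemma boundary_periodic: "\<theta> (u + 2 * pi) = \<theta> u"
proof -
  have "of_real (u + 2 * pi) + z = of_real u + z + of_real (2 * pi)" for z :: complex by simp
  thus ?thesis unfolding boundary_def using lift_periodic by presburger
qed

lemma boundary_not_constant:
  assumes ab: "a < b" shows "\<exists>t \<in> {a<..<b}. \<theta> t \<noteq> p"
proof (rule ccontr)
  assume "\<not> ?thesis"
  hence const: "\<And>t. a < t \<Longrightarrow> t < b \<Longrightarrow> \<theta> t = p" by auto
  have p: "p \<in> \<Gamma>" using const[of "(a + b) / 2"] ab boundary_in_curve[of "(a + b) / 2"] by simp
  obtain B where B: "B > 0" "\<And>z. norm z < 1 \<Longrightarrow> norm (\<Phi> z) \<le> B" using bounded_image by blast
  define v where "v = (b - a) / 4"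
  have v: "v > 0" using ab by (simp add: v_def)
  have hol: "(\<lambda>z. \<Theta> z - p) holomorphic_on \<H>" by (intro holomorphic_intros lift_holomorphic)
  have bd: "norm (\<Theta> z - p) \<le> B + norm p" if "0 < Im z" for z
    using B(2)[of "exp (\<i> * z)"] that norm_triangle_ineq4[of "\<Theta> z" p] by (simp add: norm_exp_i lift_def)
  have arc: "arctan 1 - arctan (-1) \<ge> pi / real 2" by (simp add: arctan_one arctan_minus)
  obtain t X where t: "(a + b) / 2 + (-1) * v \<le> t" "t \<le> (a + b) / 2 + 1 * v" "\<And>m. 0 < Im (X m)" "X \<longlonglongrightarrow> of_real t"
     "\<And>m. norm (\<Theta> (Complex ((a + b) / 2) v) - p) ^ 2 \<le> norm (\<Theta> (X m) - p) * (B + norm p) ^ (2 - 1)"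
    using large_value_near_interval[OF hol bd _ v arc, of "(a + b) / 2"] by auto
  have "a < t" "t < b" using t(1,2) ab by (auto simp: v_def field_simps)
  hence "\<theta> t = p" using const by blast
  have "(\<lambda>m. norm (\<Theta> (X m) - p) * (B + norm p) ^ (2 - 1)) \<longlonglongrightarrow> norm (\<theta> t - p) * (B + norm p) ^ (2 - 1)"
    using t(3,4) by (intro tendsto_intros boundary_seq) auto
  hence "(\<lambda>m. norm (\<Theta> (X m) - p) * (B + norm p) ^ (2 - 1)) \<longlonglongrightarrow> 0" using \<open>\<theta> t = p\<close> by simp
  hence "norm (\<Theta> (Complex ((a + b) / 2) v) - p) ^ 2 \<le> 0"
    by (rule tendsto_lowerbound) (use t(5) in auto)
  hence "\<Theta> (Complex ((a + b) / 2) v) = p" by simp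
  moreover have "\<Theta> (Complex ((a + b) / 2) v) \<in> inside \<Gamma>"
    unfolding lift_def using v by (intro map_in_inside) (simp add: norm_exp_i)
  ultimately show False using p inside_not_in_curve by blast
qed

lemma boundary_radius_compact:
  "compact (insert (\<theta> u) (insert (\<Phi> 0) (\<Theta> ` {x. Re x = u \<and> Im x > 0})))"
proof -
  define G where "G s = (if s = 1 then \<theta> u else \<Phi> (of_real s * cis u))" for s :: real
  have pol: "of_real s * cis u = exp (\<i> * Complex u (- ln s))" if "s > 0" for s
  proof -
    have "exp (\<i> * Complex u (- ln s)) = exp (of_real (ln s)) * exp (\<i> * of_real u)"
      by (simp add: exp_add[symmetric] complex_eq_iff Complex_eq algebra_simps)
    also have "exp (of_real (ln s)) = (of_real s :: complex)" using that by (simp add: exp_of_real)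
    finally show ?thesis by (simp add: cis_conv_exp)
  qed
  have "continuous_on {0..1} G"
    unfolding continuous_on_eq_continuous_within
  proof
    fix s :: real assume s: "s \<in> {0..1}"
    show "continuous (at s within {0..1}) G"
    proof (cases "s = 1")
      case False
      have "continuous_on {0..<1} (\<lambda>s. \<Phi> (of_real s * cis u))"
        by (rule continuous_on_compose2[OF holomorphic_on_imp_continuous_on[OF holomorphic]])
           (auto intro!: continuous_intros simp: norm_mult)
      hence "continuous_on {0..<1} G" by (rule continuous_on_eq) (auto simp: G_def)
      hence "continuous (at s within {0..<1}) G" using s False
        by (simp add: continuous_on_eq_continuous_within)
      moreover have "at s within {0..<1} = at s within {0..1}"
        using s False by (intro at_within_nhd[of s "{..<1}"]) auto
      ultimately show ?thesis by simp
    next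
      case True
      show ?thesis unfolding continuous_within True
      proof (rule tendstoI)
        fix e :: real assume "e > 0"
        hence "e / 2 > 0" by simp
        from boundary_close[OF this, of u] obtain \<rho> where \<rho>: "\<rho> > 0"
           "\<And>x. x \<in> \<H> \<Longrightarrow> norm (x - of_real u) < \<rho> \<Longrightarrow> norm (\<Theta> x - \<theta> u) \<le> e / 2" by blast
        have "dist (G t) (G 1) < e" if t: "t \<in> {0..1}" "t \<noteq> 1" "dist t 1 < 1 - exp (- \<rho>)" for t
        proof -
          have t': "exp (- \<rho>) < t" "t < 1" using t by (auto simp: dist_real_def)
          hence t0: "t > 0" using exp_gt_zero[of "- \<rho>"] by linarith
          have "ln (exp (- \<rho>)) < ln t" using t' t0 by (subst ln_less_cancel_iff) auto
          moreover have "Complex u (- ln t) - of_real u = \<i> * of_real (- ln t)" by (simp add: complex_eq_iff)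
          hence "norm (Complex u (- ln t) - of_real u) = \<bar>ln t\<bar>" by (simp only: norm_mult norm_of_real) simp
          moreover have "ln t < 0" using t' t0 by simp
          ultimately have "norm (\<Theta> (Complex u (- ln t)) - \<theta> u) \<le> e / 2" by (intro \<rho>(2)) auto
          thus ?thesis using t(2) pol[OF t0] \<open>e > 0\<close> by (simp add: G_def lift_def dist_norm)
        qed
        moreover have "1 - exp (- \<rho>) > 0" using \<rho>(1) by simp
        ultimately show "eventually (\<lambda>t. dist (G t) (G 1) < e) (at 1 within {0..1})"
          unfolding eventually_at by blast
      qed
    qed
  qed
  hence "compact (G ` {0..1})" by (intro compact_continuous_image) auto
  also have "G ` {0..1} = insert (\<theta> u) (insert (\<Phi> 0) (\<Theta> ` {x. Re x = u \<and> Im x > 0}))"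
  proof (intro equalityI subsetI)
    fix w assume "w \<in> G ` {0..1}"
    then obtain s where s: "w = G s" "0 \<le> s" "s \<le> 1" by auto
    consider "s = 1" | "s = 0" | "0 < s" "s < 1" using s by linarith
    thus "w \<in> insert (\<theta> u) (insert (\<Phi> 0) (\<Theta> ` {x. Re x = u \<and> Im x > 0}))"
    proof cases
      case 3
      hence "w = \<Theta> (Complex u (- ln s))" using pol[of s] by (simp add: s G_def lift_def)
      moreover have "Complex u (- ln s) \<in> {x. Re x = u \<and> Im x > 0}" using 3 by simp
      ultimately show ?thesis by blast
    qed (auto simp: s G_def)
  next
    fix w assume "w \<in> insert (\<theta> u) (insert (\<Phi> 0) (\<Theta> ` {x. Re x = u \<and> Im x > 0}))"
    then consider "w = \<theta> u" | "w = \<Phi> 0" | x where "Re x = u" "Im x > 0" "w = \<Theta> x" by auto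
    thus "w \<in> G ` {0..1}"
    proof cases
      case 1 thus ?thesis by (intro image_eqI[of _ _ 1]) (auto simp: G_def)
    next
      case 2 thus ?thesis by (intro image_eqI[of _ _ 0]) (auto simp: G_def)
    next
      case (3 x)
      have "Complex u (- ln (exp (- Im x))) = x" using 3 by (simp add: complex_eq_iff)
      hence "w = G (exp (- Im x))" using 3 pol[of "exp (- Im x)"] by (simp add: G_def lift_def)
      thus ?thesis using 3 by (intro image_eqI[of _ _ "exp (- Im x)"]) auto
    qed
  qed
  finally show ?thesis .
qed

lemma sector_open: "open ((\<lambda>x. exp (\<i> * x)) ` {x. a < Re x \<and> Re x < b \<and> 0 < Im x})"
proof (rule open_mapping_thm[where S = UNIV])
  show "\<not> (\<lambda>x. exp (\<i> * x)) constant_on UNIV"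
  proof
    assume "(\<lambda>x. exp (\<i> * x)) constant_on UNIV"
    then obtain c where "\<And>x. exp (\<i> * x) = c" unfolding constant_on_def by blast
    hence "exp (\<i> * 0) = exp (\<i> * of_real pi)" by metis
    thus False by simp
  qed
qed (auto intro!: holomorphic_intros open_Collect_conj open_halfspace_Re_lt open_halfspace_Re_gt open_halfspace_Im_gt)

lemma boundary_injective_aux:
  assumes u: "u1 < u2" "u2 < u1 + 2 * pi" shows "\<theta> u1 \<noteq> \<theta> u2"
proof
  assume eq: "\<theta> u1 = \<theta> u2"
  define p where "p = \<theta> u1"
  define S where "S a b = {x. a < Re x \<and> Re x < b \<and> 0 < Im x}" for a b :: real
  define R where "R u = insert (\<theta> u) (insert (\<Phi> 0) (\<Theta> ` {x. Re x = u \<and> Im x > 0}))" for u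
  define A where "A = R u1 \<union> R u2"
  let ?e = "\<lambda>x. exp (\<i> * x)"
  have cA: "compact A" unfolding A_def R_def by (intro compact_Un boundary_radius_compact)
  have lift_in: "\<Theta> x \<in> inside \<Gamma>" if "Im x > 0" for x
    unfolding lift_def using that by (intro map_in_inside) (simp add: norm_exp_i)
  have A\<Gamma>: "A \<inter> \<Gamma> = {p}"
    using lift_in map_in_inside[of 0] inside_not_in_curve boundary_in_curve
    by (auto simp: A_def R_def p_def eq)
  have e_eq: "\<exists>n::int. x = y + of_real (2 * of_int n * pi)" if "?e x = ?e y" for x y
  proof -
    have "\<exists>n::int. \<i> * x = \<i> * y + of_real (2 * of_int n * pi) * \<i>" using that by (simp only: exp_eq) simp
    then obtain n :: int where "\<i> * x = \<i> * y + of_real (2 * of_int n * pi) * \<i>" by blast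
    hence "\<i> * x = \<i> * (y + of_real (2 * of_int n * pi))" by (simp only: distrib_left mult_ac)
    hence "x = y + of_real (2 * of_int n * pi)" by (simp only: mult_cancel_left) simp
    thus ?thesis by blast
  qed
  have window: "n = 0" if "\<bar>of_int n * (2 * pi)\<bar> < 2 * pi" for n :: int
  proof -
    have "\<bar>of_int n\<bar> * (2 * pi) < 1 * (2 * pi)" using that by (simp add: abs_mult)
    hence "\<bar>real_of_int n\<bar> < 1" by (simp only: mult_less_cancel_right) auto
    thus ?thesis by linarith
  qed
  have disj: "?e ` S u1 u2 \<inter> ?e ` S u2 (u1 + 2 * pi) = {}"
  proof (rule ccontr)
    assume "\<not> ?thesis"
    then obtain x y where x: "x \<in> S u1 u2" and y: "y \<in> S u2 (u1 + 2 * pi)" and "?e x = ?e y" by auto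
    then obtain n :: int where n: "x = y + of_real (2 * of_int n * pi)" using e_eq by blast
    hence "Re x - Re y = of_int n * (2 * pi)" by simp
    moreover have "\<bar>Re x - Re y\<bar> < 2 * pi" using x y u by (auto simp: S_def abs_less_iff)
    ultimately have "n = 0" by (intro window) simp
    hence "x = y" using n by simp
    thus False using x y by (auto simp: S_def)
  qed
  have avoid: "\<Phi> z \<notin> A" if z: "z \<in> ?e ` S a b" and ab: "u1 \<le> a" "b \<le> u1 + 2 * pi" "u2 \<le> a \<or> b \<le> u2" for z a b
  proof
    assume inA: "\<Phi> z \<in> A"
    obtain x where x: "x \<in> S a b" "z = ?e x" using z by blast
    have z1: "norm z < 1" using x by (simp add: norm_exp_i S_def)
    have "\<Phi> z \<noteq> \<theta> u" for u using boundary_in_curve map_in_inside[OF z1] inside_not_in_curve by metis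
    moreover have "\<Phi> z \<noteq> \<Phi> 0" using injective z1 x(2) by (metis exp_not_eq_zero inverse_map norm_zero zero_less_one)
    ultimately have "\<exists>y. (Re y = u1 \<or> Re y = u2) \<and> Im y > 0 \<and> \<Phi> z = \<Theta> y"
      using inA by (auto simp: A_def R_def)
    then obtain y where y: "Re y = u1 \<or> Re y = u2" "Im y > 0" "\<Phi> z = \<Phi> (?e y)" by (auto simp: lift_def)
    have "z = ?e y" using y z1 by (metis inverse_map exp_i_in_ball mem_ball_0)
    then obtain n :: int where n: "x = y + of_real (2 * of_int n * pi)" using e_eq x(2) by metis
    hence "Re x - Re y = of_int n * (2 * pi)" by simp
    moreover have "\<bar>Re x - Re y\<bar> < 2 * pi" using x(1) y(1) ab u by (auto simp: S_def abs_less_iff)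
    ultimately have "n = 0" by (intro window) simp
    hence "x = y" using n by simp
    thus False using x(1) y(1) ab u by (auto simp: S_def)
  qed
  have cover: "z \<in> ?e ` S u1 u2 \<union> ?e ` S u2 (u1 + 2 * pi)" if z: "norm z < 1" "\<Phi> z \<notin> A" for z
  proof -
    have "z \<noteq> 0" using z(2) by (auto simp: A_def R_def)
    obtain t where t: "sgn z = cis t" "u1 \<le> t" "t < u1 + 2 * pi"
      using cis_in_window[of "sgn z" u1] \<open>z \<noteq> 0\<close> by (metis norm_sgn)
    define x where "x = Complex t (- ln (norm z))"
    have "?e x = exp (of_real (ln (norm z))) * exp (\<i> * of_real t)"
      by (simp add: x_def exp_add[symmetric] complex_eq_iff Complex_eq algebra_simps)
    also have "exp (of_real (ln (norm z))) = (of_real (norm z) :: complex)" using \<open>z \<noteq> 0\<close> by (simp add: exp_of_real)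
    also have "exp (\<i> * of_real t) = sgn z" by (simp add: t cis_conv_exp)
    finally have ex: "z = ?e x" using \<open>z \<noteq> 0\<close> by (simp add: sgn_eq)
    have Im: "Im x > 0" using z(1) \<open>z \<noteq> 0\<close> by (simp add: x_def)
    have "Re x \<noteq> u1" "Re x \<noteq> u2" using z(2) Im ex by (auto simp: A_def R_def lift_def)
    hence "x \<in> S u1 u2 \<union> S u2 (u1 + 2 * pi)" using Im t(2,3) by (auto simp: S_def x_def)
    thus ?thesis using ex by blast
  qed
  have half: "\<exists>x. x \<in> S a b \<and> connected_component (- A) (\<Phi> (?e x)) t \<and> t \<in> \<Gamma> - {p}"
    if ab: "a < b" "u1 \<le> a" "b \<le> u1 + 2 * pi" "u2 \<le> a \<or> b \<le> u2" and t: "\<exists>s\<in>{a<..<b}. \<theta> s = t" "t \<noteq> p" for a b t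
  proof -
    obtain s where s: "a < s" "s < b" "t = \<theta> s" using t by auto
    define x where "x = Complex s 1"
    have xS: "x \<in> S a b" using s by (simp add: S_def x_def)
    have "convex (S a b)"
    proof -
      have "S a b = {x. a < Re x} \<inter> {x. Re x < b} \<inter> {x. 0 < Im x}" by (auto simp: S_def)
      thus ?thesis by (simp add: convex_Int convex_halfspace_Re_gt convex_halfspace_Re_lt convex_halfspace_Im_gt)
    qed
    hence "connected (\<Theta> ` S a b)"
      by (intro connected_continuous_image convex_connected continuous_on_subset[OF lift_continuous]) (auto simp: S_def)
    moreover have "t \<in> closure (\<Theta> ` S a b)"
    proof -
      have "of_real s + \<i> / of_nat (Suc n) \<in> S a b" for n
        using s(1,2) vertical_sequence(1)[of s n] by (simp add: S_def Re_divide_of_nat del: of_nat_Suc)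
      hence "\<forall>n. \<Theta> (of_real s + \<i> / of_nat (Suc n)) \<in> \<Theta> ` S a b" by (intro allI imageI)
      thus ?thesis unfolding closure_sequential s(3) using boundary_LIMSEQ[of s] by (intro exI conjI)
    qed
    ultimately have "connected (insert t (\<Theta> ` S a b))"
      using closure_subset[of "\<Theta> ` S a b"]
      by (intro connected_intermediate_closure[of "\<Theta> ` S a b" "insert t (\<Theta> ` S a b)"]) blast+
    moreover have "t \<in> \<Gamma> - {p}" using t(2) s(3) boundary_in_curve by simp
    moreover have "insert t (\<Theta> ` S a b) \<subseteq> - A"
    proof -
      have "\<Theta> x \<notin> A" if "x \<in> S a b" for x using avoid[OF imageI[OF that] ab(2-4)] by (simp add: lift_def)
      moreover have "t \<notin> A" using \<open>t \<in> \<Gamma> - {p}\<close> A\<Gamma> by blast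
      ultimately show ?thesis by blast
    qed
    ultimately have "connected_component (- A) (\<Phi> (?e x)) t \<and> t \<in> \<Gamma> - {p}"
      unfolding connected_component_def using xS
      by (intro conjI exI[of _ "insert t (\<Theta> ` S a b)"]) (auto simp: lift_def)
    thus ?thesis using xS by blast
  qed
  obtain s1 where s1: "\<exists>s\<in>{u1<..<u2}. \<theta> s = \<theta> s1" "\<theta> s1 \<noteq> p" using boundary_not_constant[OF u(1)] by blast
  obtain x1 where x1: "x1 \<in> S u1 u2" "connected_component (- A) (\<Phi> (?e x1)) (\<theta> s1)" "\<theta> s1 \<in> \<Gamma> - {p}"
    using half[OF u(1) _ _ _ s1] u by auto
  obtain s2 where s2: "\<exists>s\<in>{u2<..<u1 + 2 * pi}. \<theta> s = \<theta> s2" "\<theta> s2 \<noteq> p" using boundary_not_constant[OF u(2)] by blast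
  obtain x2 where x2: "x2 \<in> S u2 (u1 + 2 * pi)" "connected_component (- A) (\<Phi> (?e x2)) (\<theta> s2)" "\<theta> s2 \<in> \<Gamma> - {p}"
    using half[OF u(2) _ _ _ s2] u by auto
  have "connected_component (- A) (\<theta> s1) (\<theta> s2)"
    unfolding connected_component_def using connected_curve_minus_point[OF boundary_in_curve[of u1]] x1(3) x2(3) A\<Gamma>
    by (intro exI[of _ "\<Gamma> - {p}"]) (auto simp: p_def)
  hence "connected_component (- A) (\<Phi> (?e x1)) (\<Phi> (?e x2))"
    using x1(2) x2(2) connected_component_sym connected_component_trans by metis
  moreover have "\<not> connected_component (- A) (\<Phi> (?e x1)) (\<Phi> (?e x2))"
  proof (rule separated[OF cA])
    show "connected (A \<inter> \<Gamma>)" using A\<Gamma> by simp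
    show "norm (?e x1) < 1" "norm (?e x2) < 1" using x1(1) x2(1) by (auto simp: S_def norm_exp_i)
    show "open (?e ` S u1 u2)" "open (?e ` S u2 (u1 + 2 * pi))" unfolding S_def by (rule sector_open)+
  qed (use disj x1(1) x2(1) cover in auto)
  ultimately show False by blast
qed

lemma boundary_injective:
  assumes "\<theta> s = \<theta> t" shows "cis s = cis t"
proof -
  have per: "\<theta> (u + 2 * pi * of_int n) = \<theta> u" for u and n :: int
  proof -
    have nat: "\<theta> (u + 2 * pi * real n) = \<theta> u" for u n
    proof (induction n)
      case (Suc n)
      have "\<theta> (u + 2 * pi * real (Suc n)) = \<theta> ((u + 2 * pi * real n) + 2 * pi)" by (simp add: algebra_simps)
      thus ?case using Suc boundary_periodic by simp
    qed simp
    show ?thesis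
    proof (cases "n \<ge> 0")
      case True thus ?thesis using nat[of u "nat n"] by simp
    next
      case False thus ?thesis using nat[of "u + 2 * pi * of_int n" "nat (- n)"] by simp
    qed
  qed
  define n where "n = \<lfloor>(t - s) / (2 * pi)\<rfloor>"
  have n: "real_of_int n \<le> (t - s) / (2 * pi)" "(t - s) / (2 * pi) < n + 1" unfolding n_def by linarith+
  define t' where "t' = t + 2 * pi * of_int (- n)"
  have "s \<le> t'" "t' < s + 2 * pi" using n by (auto simp: t'_def field_simps)
  moreover have "\<theta> t' = \<theta> s" unfolding t'_def per using assms by simp
  ultimately have "t' = s" using boundary_injective_aux[of s t'] by fastforce
  hence "cis s = cis t * cis (2 * pi * of_int (- n))" by (simp add: t'_def cis_mult)
  also have "cis (2 * pi * of_int (- n)) = 1" by (metis cis_multiple_2pi Ints_of_int)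
  finally show ?thesis by simp
qed

end

section \<open>Centrally symmetric curves\<close>

locale odd_curve = circle_embedding +
  assumes odd: "\<And>z. norm z = 1 \<Longrightarrow> f (- z) = - f z"
begin

lemma curve_symmetric: "p \<in> \<Gamma> \<Longrightarrow> - p \<in> \<Gamma>"
proof -
  assume "p \<in> \<Gamma>"
  then obtain z where "norm z = 1" "p = f z" by (auto simp: curve_def)
  thus ?thesis using odd[of z] by (auto simp: curve_def intro!: image_eqI[of _ _ "- z"])
qed

lemma norm_on_circle: "norm z = 1 \<Longrightarrow> l \<le> norm (f z) \<and> norm (f z) \<le> L"
proof -
  assume z: "norm z = 1"
  have "norm (f z - f (- z)) = 2 * norm (f z)" "norm (z - - z) = 2 * norm z"
    unfolding odd[OF z] by (simp_all add: norm_mult flip: mult_2)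
  thus ?thesis using lower[of z "- z"] upper[of z "- z"] z by simp
qed

lemma zero_not_in_curve: "0 \<notin> \<Gamma>"
  using norm_on_circle l_pos by (auto simp: curve_def) fastforce

lemma outside_symmetric: assumes "w \<in> outside \<Gamma>" shows "- w \<in> outside \<Gamma>"
proof -
  let ?C = "uminus ` outside \<Gamma>"
  have con: "connected ?C" by (intro connected_continuous_image continuous_intros jordan(6))
  have disj: "?C \<inter> \<Gamma> = {}"
  proof (rule ccontr)
    assume "\<not> ?thesis"
    then obtain x where "x \<in> outside \<Gamma>" "- x \<in> \<Gamma>" by auto
    thus False using curve_symmetric[of "- x"] outside_no_overlap[of \<Gamma>] by (metis IntI empty_iff minus_minus)
  qed
  have "?C \<inter> inside \<Gamma> = {}"
  proof (rule ccontr)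
    assume "?C \<inter> inside \<Gamma> \<noteq> {}"
    hence "?C \<subseteq> inside \<Gamma>"
      using connected_Int_frontier[OF con, of "inside \<Gamma>"] disj jordan(10) by blast
    hence "bounded ?C" using jordan(3) bounded_subset by blast
    hence "bounded (uminus ` ?C)" by (simp only: bounded_uminus)
    thus False using jordan(7) by (simp add: image_image)
  qed
  thus ?thesis using assms disj jordan(9) by blast
qed

lemma inside_symmetric: assumes "w \<in> inside \<Gamma>" shows "- w \<in> inside \<Gamma>"
proof -
  have "- w \<notin> \<Gamma>" using curve_symmetric[of "- w"] inside_not_in_curve[OF assms] by auto
  moreover have "- w \<notin> outside \<Gamma>" using outside_symmetric[of "- w"] assms jordan(8) by fastforce
  ultimately show ?thesis using jordan(9) by blast
qed

lemma zero_inside: "0 \<in> inside \<Gamma>"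
proof (rule ccontr)
  assume n: "0 \<notin> inside \<Gamma>"
  have "locally path_connected (inside \<Gamma>)" using jordan(1) by (rule open_imp_locally_path_connected)
  moreover have "w \<noteq> 0" if "w \<in> inside \<Gamma>" for w using that n by auto
  ultimately obtain s where s: "s holomorphic_on inside \<Gamma>" "\<And>w. w \<in> inside \<Gamma> \<Longrightarrow> w = s w ^ 2"
    using simply_connected_imp_holomorphic_sqrt[OF holomorphic_on_ident jordan(12)] by metis
  define r where "r w = s (- w) / s w" for w
  have snz: "s w \<noteq> 0" if "w \<in> inside \<Gamma>" for w using s(2)[OF that] that n by (metis power_zero_numeral)
  have r2: "r w ^ 2 = - 1" if "w \<in> inside \<Gamma>" for w
  proof -
    have "s (- w) ^ 2 = - (s w ^ 2)" using s(2)[OF that] s(2)[OF inside_symmetric[OF that]] by simp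
    thus ?thesis using snz[OF that] by (simp add: r_def power_divide)
  qed
  have "continuous_on (inside \<Gamma>) (\<lambda>w. s (- w))"
    by (rule continuous_on_compose2[OF holomorphic_on_imp_continuous_on[OF s(1)]])
       (auto intro!: continuous_intros inside_symmetric)
  hence "continuous_on (inside \<Gamma>) r" unfolding r_def
    using snz holomorphic_on_imp_continuous_on[OF s(1)] by (intro continuous_intros) auto
  hence "connected (r ` inside \<Gamma>)" using jordan(2) connected_continuous_image by blast
  moreover have "r ` inside \<Gamma> \<subseteq> {\<i>, - \<i>}"
    using r2 by (auto simp only: power2_i[symmetric] power2_eq_iff)
  hence "finite (r ` inside \<Gamma>)" by (rule finite_subset) simp
  ultimately obtain c where c: "r ` inside \<Gamma> = {c}"
    using connected_finite_iff_sing jordan(4) by blast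
  obtain w where w: "w \<in> inside \<Gamma>" using jordan(4) by blast
  have "r w = c" "r (- w) = c" using c w inside_symmetric by auto
  moreover have "r w * r (- w) = 1" using snz[OF w] snz[OF inside_symmetric[OF w]] by (simp add: r_def)
  ultimately have "r w ^ 2 = 1" by (simp add: power2_eq_square)
  thus False using r2[OF w] by simp
qed

lemma odd_Riemann_map:
  obtains \<Phi> where "conformal_curve f L l \<Phi>" "\<Phi> 0 = 0" "\<And>z. norm z < 1 \<Longrightarrow> \<Phi> (- z) = - \<Phi> z"
proof -
  have "inside \<Gamma> \<noteq> UNIV" using jordan(3) not_bounded_UNIV by auto
  then obtain F G where F: "F holomorphic_on inside \<Gamma>" and G: "G holomorphic_on ball 0 1"
     and FG: "\<And>z. z \<in> inside \<Gamma> \<Longrightarrow> F z \<in> ball 0 1 \<and> G (F z) = z" "\<And>z. z \<in> ball 0 1 \<Longrightarrow> G z \<in> inside \<Gamma> \<and> F (G z) = z"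
    using Riemann_mapping_theorem[of "inside \<Gamma>"] jordan(1,4,12) by blast
  have "F 0 \<in> ball 0 1" using FG(1) zero_inside by blast
  then obtain p q where pq: "p (F 0) = 0" "p holomorphic_on ball 0 1" "p ` ball 0 1 \<subseteq> ball 0 1"
    "q holomorphic_on ball 0 1" "q ` ball 0 1 \<subseteq> ball 0 1" "\<And>z. z \<in> ball 0 1 \<Longrightarrow> p (q z) = z" "\<And>z. z \<in> ball 0 1 \<Longrightarrow> q (p z) = z"
    by (rule ball_biholomorphism_exists) blast
  define \<Phi> where "\<Phi> = G \<circ> q"
  have hol: "\<Phi> holomorphic_on ball 0 1" unfolding \<Phi>_def
    by (rule holomorphic_on_compose_gen[OF pq(4) G pq(5)])
  have inv: "p (F (\<Phi> z)) = z" if "z \<in> ball 0 1" for z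
    using FG(2)[of "q z"] pq(5,6) that by (force simp: \<Phi>_def)
  have img: "\<Phi> ` ball 0 1 = inside \<Gamma>"
  proof
    show "\<Phi> ` ball 0 1 \<subseteq> inside \<Gamma>" using FG(2) pq(5) by (auto simp: \<Phi>_def)
    show "inside \<Gamma> \<subseteq> \<Phi> ` ball 0 1"
    proof
      fix w assume w: "w \<in> inside \<Gamma>"
      hence "F w \<in> ball 0 1" "G (F w) = w" using FG(1) by auto
      hence "w = \<Phi> (p (F w))" "p (F w) \<in> ball 0 1" using pq(3,7) unfolding \<Phi>_def comp_def by (metis, blast)
      thus "w \<in> \<Phi> ` ball 0 1" by blast
    qed
  qed
  interpret conformal_curve f L l \<Phi>
  proof unfold_locales
    show "inj_on \<Phi> (ball 0 1)" by (rule inj_on_inverseI[of _ "\<lambda>w. p (F w)"]) (rule inv)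
  qed (rule hol, rule img)
  have z0: "\<Phi> 0 = 0"
  proof -
    have "q 0 = F 0" using pq(1,7) \<open>F 0 \<in> ball 0 1\<close> by metis
    thus ?thesis using FG(1)[OF zero_inside] by (simp add: \<Phi>_def)
  qed
  define h where "h z = inverse_map (- \<Phi> z)" for z
  have hb: "norm (h z) < 1" "\<Phi> (h z) = - \<Phi> z" if "norm z < 1" for z
    using inverse_map_in_ball[OF inside_symmetric[OF map_in_inside[OF that]]] by (auto simp: h_def)
  have "h holomorphic_on ball 0 1"
  proof -
    have "inverse_map \<circ> (\<lambda>z. - \<Phi> z) holomorphic_on ball 0 1"
      by (rule holomorphic_on_compose_gen[OF _ inverse_map_holomorphic])
         (auto intro!: holomorphic_intros holomorphic inside_symmetric map_in_inside)
    thus ?thesis by (simp add: o_def h_def[abs_def])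
  qed
  moreover have "h 0 = 0" using inverse_map[of 0] z0 by (simp add: h_def)
  ultimately have S: "norm (h z) \<le> norm z" "(\<exists>z. norm z < 1 \<and> z \<noteq> 0 \<and> norm (h z) = norm z) \<or> norm (deriv h 0) = 1 \<Longrightarrow>
      \<exists>\<alpha>. (\<forall>z. norm z < 1 \<longrightarrow> h z = \<alpha> * z) \<and> norm \<alpha> = 1" if "norm z < 1" for z
    using Schwarz_Lemma[of h z] hb that by blast+
  have hh: "h (h z) = z" if "norm z < 1" for z
    using hb[OF that] inverse_map[OF that] by (simp add: h_def)
  have "norm (h (1/2)) = norm (1/2 :: complex)"
    using S(1)[of "1/2"] S(1)[of "h (1/2)"] hb(1)[of "1/2"] hh[of "1/2"] by (simp add: norm_divide)
  hence "\<exists>z. norm z < 1 \<and> z \<noteq> 0 \<and> norm (h z) = norm z" by (intro exI[of _ "1/2"]) simp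
  then obtain \<alpha> where \<alpha>: "\<And>z. norm z < 1 \<Longrightarrow> h z = \<alpha> * z"
    using S(2)[of 0] by auto
  have half: "norm (1/2 :: complex) < 1" by simp
  have "h (h (1/2)) = \<alpha> * h (1/2)" by (rule \<alpha>[OF hb(1)[OF half]])
  hence "\<alpha> * (\<alpha> * (1/2)) = 1/2" unfolding hh[OF half] using \<alpha>[OF half] by simp
  hence "\<alpha>\<^sup>2 = 1" by (simp add: power2_eq_square)
  hence "\<alpha> = 1 \<or> \<alpha> = - 1" by (simp add: power2_eq_1_iff)
  moreover have "\<alpha> \<noteq> 1"
  proof
    assume "\<alpha> = 1"
    hence "\<Phi> (1/2) = - \<Phi> (1/2)" using hb(2)[OF half] \<alpha>[OF half] by simp
    hence "\<Phi> (1/2) = \<Phi> 0" using z0 by simp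
    hence "(1/2::complex) = 0" using inverse_map[OF half] inverse_map[of 0] by simp
    thus False by simp
  qed
  ultimately have "h z = - z" if "norm z < 1" for z using \<alpha>[OF that] by auto
  hence "\<Phi> (- z) = - \<Phi> z" if "norm z < 1" for z using hb(2)[OF that] that by simp
  thus thesis using that conformal_curve_axioms z0 by blast
qed

lemma inverse_on_curve_continuous: "continuous_on \<Gamma> (inv_into (sphere 0 1) f)"
  unfolding curve_def using continuous inj by (intro continuous_on_inv) (auto simp: inv_into_f_f)

end

locale odd_conformal_curve = conformal_curve f L l \<Phi> + odd_curve f L l for f L l \<Phi> +
  assumes map_zero: "\<Phi> 0 = 0" and map_odd: "\<And>z. norm z < 1 \<Longrightarrow> \<Phi> (- z) = - \<Phi> z"
begin

lemma boundary_parametrization: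
  obtains f' and g :: "real \<Rightarrow> real" where
    "f' = f \<or> f' = (\<lambda>z. f (cnj z))" "continuous_on UNIV g" "strict_mono g" "\<And>u. g (u + pi) = g u + pi"
    "\<And>u. (\<Theta> \<longlongrightarrow> f' (cis (g u))) (at (of_real u) within \<H>)"
proof -
  define h where "h u = inv_into (sphere 0 1) f (\<theta> u)" for u
  have h: "norm (h u) = 1" "f (h u) = \<theta> u" for u
    using boundary_in_curve[of u] unfolding curve_def h_def
    by (metis inv_into_into mem_sphere_0, metis f_inv_into_f)
  have odd\<theta>: "\<theta> (u + pi) = - \<theta> u" for u
  proof (rule LIMSEQ_unique[OF boundary_LIMSEQ])
    have "\<Theta> (of_real (u + pi) + \<i> / of_nat (Suc n)) = - \<Theta> (of_real u + \<i> / of_nat (Suc n))" for n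
    proof -
      have "exp (\<i> * (of_real (u + pi) + \<i> / of_nat (Suc n))) = exp (\<i> * (of_real u + \<i> / of_nat (Suc n))) * exp (of_real pi * \<i>)"
        by (simp only: exp_add[symmetric]) (simp add: algebra_simps del: of_nat_Suc)
      also have "\<dots> = - exp (\<i> * (of_real u + \<i> / of_nat (Suc n)))" by (simp add: exp_pi_i del: of_nat_Suc)
      finally show ?thesis unfolding lift_def
        using map_odd vertical_sequence(1)[of u n] by (simp add: norm_exp_i del: of_nat_Suc)
    qed
    thus "(\<lambda>n. \<Theta> (of_real (u + pi) + \<i> / of_nat (Suc n))) \<longlonglongrightarrow> - \<theta> u"
      using tendsto_minus[OF boundary_LIMSEQ[of u]] by (simp del: of_nat_Suc)
  qed
  have oddh: "h (u + pi) = - h u" for u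
  proof (rule inj_onD[OF inj])
    show "f (h (u + pi)) = f (- h u)" using h odd odd\<theta> by simp
  qed (use h in auto)
  have injh: "cis s = cis t" if "h s = h t" for s t using boundary_injective h(2) that by metis
  have ch: "continuous_on UNIV h" unfolding h_def
    by (rule continuous_on_compose2[OF inverse_on_curve_continuous boundary_continuous]) (use boundary_in_curve in auto)
  have hnz: "h u \<noteq> 0" for u using h(1)[of u] by auto
  obtain m where m: "continuous_on UNIV m" "\<And>u. h u = exp (m u)"
    by (rule continuous_logarithm_on_contractible[OF ch convex_imp_contractible[OF convex_UNIV] hnz]) simp
  define g where "g u = Im (m u)" for u
  have g: "h u = cis (g u)" for u
  proof -
    have "Re (m u) = 0" using h(1)[of u] m(2)[of u] by (simp add: norm_exp_eq_Re)
    hence "m u = \<i> * of_real (g u)" by (simp add: complex_eq_iff g_def)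
    thus ?thesis using m(2) by (simp add: cis_conv_exp)
  qed
  have cg: "continuous_on UNIV g" unfolding g_def using m(1) by (intro continuous_intros)
  have cis1: "\<exists>n::int. x = y + 2 * pi * of_int n" if "cis x = cis y" for x y
  proof -
    have "exp (\<i> * of_real x) = exp (\<i> * of_real y)" using that by (simp add: cis_conv_exp)
    then obtain n :: int where "\<i> * of_real x = \<i> * of_real y + of_real (of_int (2 * n) * pi) * \<i>" unfolding exp_eq by blast
    hence "Im (\<i> * of_real x) = Im (\<i> * of_real y + of_real (of_int (2 * n) * pi) * \<i>)" by simp
    thus ?thesis by (intro exI[of _ n]) simp
  qed
  define D where "D u = (g (u + pi) - g u - pi) / (2 * pi)" for u
  have D: "D u \<in> \<int>" for u
  proof -
    have "cis (g (u + pi)) = cis (g u + pi)" using oddh[of u] by (simp add: g minus_cis)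
    then obtain n :: int where "g (u + pi) = g u + pi + 2 * pi * of_int n" using cis1 by blast
    hence "D u = of_int n" by (simp add: D_def)
    thus ?thesis by simp
  qed
  have cD: "continuous_on UNIV D" unfolding D_def
    by (intro continuous_intros cg continuous_on_compose2[OF cg]) auto
  have "D constant_on UNIV"
  proof (rule continuous_discrete_range_constant[OF connected_UNIV cD])
    fix u :: real
    have "1 \<le> norm (D t - D u)" if "D t \<noteq> D u" for t
      using Ints_nonzero_abs_ge1[OF Ints_diff[OF D[of t] D[of u]]] that by simp
    thus "\<exists>e>0. \<forall>t. t \<in> UNIV \<and> D t \<noteq> D u \<longrightarrow> e \<le> norm (D t - D u)" by (intro exI[of _ 1]) auto
  qed
  then obtain d where d: "\<And>u. D u = d" unfolding constant_on_def by blast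
  then obtain k :: int where k: "d = of_int k" using D[of 0] by (auto elim: Ints_cases)
  have gpi: "g (u + pi) = g u + (2 * of_int k + 1) * pi" for u
    using d[of u] k by (simp add: D_def field_simps)
  have gn: "g (u + 2 * pi * real n) = g u + real n * (2 * (2 * of_int k + 1) * pi)" for u n
  proof (induction n)
    case (Suc n)
    have "g (u + 2 * pi * real (Suc n)) = g ((u + 2 * pi * real n + pi) + pi)" by (simp add: algebra_simps)
    thus ?case unfolding gpi Suc by (simp add: algebra_simps)
  qed simp
  have odd_ne: "2 * real_of_int k + 1 \<noteq> 0"
  proof
    assume "2 * real_of_int k + 1 = 0"
    hence "of_int (2 * k + 1) = (0::real)" by simp
    hence "2 * k + 1 = 0" by (simp only: of_int_eq_0_iff)
    thus False by presburger
  qed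
  have injg: "inj g"
  proof -
    have *: "s = t" if "g s = g t" "s \<le> t" for s t
    proof -
      have "h t = h s" using that(1) by (simp add: g)
      then obtain n :: int where n: "t = s + 2 * pi * of_int n" using cis1[OF injh] by blast
      hence "n \<ge> 0" using that(2) pi_gt_zero by (simp add: zero_le_mult_iff del: pi_gt_zero)
      hence "g t = g s + real (nat n) * (2 * (2 * of_int k + 1) * pi)" using gn[of s "nat n"] n by simp
      hence "nat n = 0" using that(1) odd_ne by simp
      thus ?thesis using n \<open>n \<ge> 0\<close> by simp
    qed
    show ?thesis by (rule injI) (metis * linear)
  qed
  have k01: "k = 0 \<or> k = - 1"
  proof (rule ccontr)
    assume nk: "\<not> ?thesis"
    have g2: "g (2 * pi) = g 0 + 2 * (2 * of_int k + 1) * pi" using gn[of 0 1] by simp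
    have "\<exists>s\<in>{0..2*pi}. g s = g 0 + 2 * pi \<or> g s = g 0 - 2 * pi"
    proof (cases "k \<ge> 1")
      case True
      hence "real_of_int k \<ge> 1" by simp
      hence "g (2 * pi) \<ge> g 0 + 2 * pi" using g2 by (simp add: mult_right_mono)
      thus ?thesis using IVT'[of g 0 "g 0 + 2 * pi" "2 * pi"] continuous_on_subset[OF cg] by (metis atLeastAtMost_iff less_eq_real_def pi_ge_zero le_add_same_cancel1 mult_2 subset_UNIV add_increasing)
    next
      case False
      hence "k \<le> - 2" using nk by linarith
      hence "real_of_int k \<le> - 2" by simp
      hence "(2 * of_int k + 1) * pi \<le> (- 1) * pi" by (intro mult_right_mono) auto
      hence "g (2 * pi) \<le> g 0 - 2 * pi" unfolding g2 mult.assoc by linarith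
      thus ?thesis using IVT2'[of g "2 * pi" "g 0 - 2 * pi" 0] continuous_on_subset[OF cg] by (metis atLeastAtMost_iff diff_le_eq le_add_same_cancel1 mult_2 subset_UNIV add_increasing pi_ge_zero)
    qed
    then obtain s where s: "0 \<le> s" "s \<le> 2 * pi" "g s = g 0 + 2 * pi \<or> g s = g 0 - 2 * pi" by auto
    hence "h s = h 0" unfolding g by (auto simp flip: cis_mult cis_divide)
    hence "cis s = cis 0" by (rule injh)
    then obtain n :: int where n: "s = 0 + 2 * pi * of_int n" using cis1 by blast
    have "0 \<le> n" "real_of_int n \<le> 1" using s(1,2) n pi_gt_zero by (simp_all add: zero_le_mult_iff del: pi_gt_zero)
    hence "n = 0 \<or> n = 1" by linarith
    thus False
    proof
      assume "n = 0" thus False using s(3) n by simp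
    next
      assume "n = 1"
      hence "2 * (2 * of_int k + 1) * pi = 2 * pi \<or> 2 * (2 * of_int k + 1) * pi = - (2 * pi)"
        using s(3) n g2 by auto
      hence "(2 * of_int k + 1) * pi = 1 * pi \<or> (2 * of_int k + 1) * pi = (- 1) * pi"
        unfolding mult.assoc by linarith
      hence "2 * real_of_int k + 1 = 1 \<or> 2 * real_of_int k + 1 = - 1" by (simp only: mult_cancel_right) simp
      hence "k = 0 \<or> real_of_int k = - 1" by auto
      hence "k = 0 \<or> k = - 1" by linarith
      thus False using nk by simp
    qed
  qed
  have mono: "strict_mono G" if G: "continuous_on UNIV G" "inj G" "\<And>u n. G (u + 2 * pi * real n) = G u + real n * (2 * pi)" for G :: "real \<Rightarrow> real"
  proof (rule strict_monoI)
    fix s t :: real assume st: "s < t"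
    obtain n :: nat where n: "t - s < real n" using reals_Archimedean2 by blast
    have "real n * 1 \<le> real n * (2 * pi)" using pi_gt3 by (intro mult_left_mono) auto
    hence tb: "t < s + 2 * pi * real n" using n by (simp add: algebra_simps)
    have "G (s + 2 * pi * real n) > G s" using G(3)[of s n] n st by simp
    thus "G s < G t" using continuous_inj_imp_mono[OF st tb, of G] G(1,2) continuous_on_subset inj_on_subset
      by (metis less_asym less_trans subset_UNIV)
  qed
  show thesis
  proof (cases "k = 0")
    case True
    show ?thesis
    proof (rule that[of f g])
      show "strict_mono g" using gn True by (intro mono cg injg) simp
      show "g (u + pi) = g u + pi" for u using gpi True by simp
      show "(\<Theta> \<longlongrightarrow> f (cis (g u))) (at (of_real u) within \<H>)" for u
        using boundary_tendsto[of u] h(2)[of u] g[of u] by simp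
    qed (use cg in auto)
  next
    case False
    hence k: "k = - 1" using k01 by simp
    show ?thesis
    proof (rule that[of "\<lambda>z. f (cnj z)" "\<lambda>u. - g u"])
      show "strict_mono (\<lambda>u. - g u)" using gn k injg by (intro mono continuous_intros cg) (auto simp: inj_def)
      show "- g (u + pi) = - g u + pi" for u using gpi k by simp
      show "(\<Theta> \<longlongrightarrow> f (cnj (cis (- g u)))) (at (of_real u) within \<H>)" for u
        using boundary_tendsto[of u] h(2)[of u] g[of u] by (simp add: cis_cnj)
    qed (use cg in \<open>auto intro!: continuous_intros\<close>)
  qed
qed

end

lemma tan_pi_tenth: "tan (pi / 10) < 3255 / 10000"
proof -
  define s c where "s = sin (pi / 10)" and "c = cos (pi / 10)"
  have pos: "s > 0" "c > 0" unfolding s_def c_def by (auto intro: sin_gt_zero cos_gt_zero)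
  have "cos (3 * (pi / 10)) = sin (2 * (pi / 10))"
    by (subst sin_cos_eq) (simp add: field_simps)
  hence "4 * c ^ 3 - 3 * c = 2 * s * c" unfolding cos_treble_cos sin_double by (simp add: s_def c_def)
  hence "c * (4 * c\<^sup>2 - 3 - 2 * s) = 0" by (simp add: power3_eq_cube power2_eq_square algebra_simps)
  hence "4 * c\<^sup>2 - 3 = 2 * s" using pos by simp
  moreover have sc: "s\<^sup>2 + c\<^sup>2 = 1" by (simp add: s_def c_def)
  ultimately have q: "4 * s\<^sup>2 + 2 * s = 1" by linarith
  have s: "s < 3091 / 10000"
  proof (rule ccontr)
    assume "\<not> ?thesis"
    hence "s \<ge> 3091 / 10000" by simp
    hence "s\<^sup>2 \<ge> (3091 / 10000)\<^sup>2" by (intro power_mono) auto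
    moreover have "(3091 / 10000)\<^sup>2 = (9554281 / 100000000 :: real)" by (simp add: power2_eq_square)
    ultimately show False using q \<open>s \<ge> _\<close> by linarith
  qed
  hence "s\<^sup>2 \<le> (3091 / 10000)\<^sup>2" using pos by (intro power_mono) auto
  moreover have "(3091 / 10000)\<^sup>2 = (9554281 / 100000000 :: real)" "(951 / 1000)\<^sup>2 = (904401 / 1000000 :: real)"
    by (simp_all add: power2_eq_square)
  ultimately have "(951 / 1000)\<^sup>2 \<le> c\<^sup>2" using sc by linarith
  hence "951 / 1000 \<le> c" by (rule power2_le_imp_le) (use pos in simp)
  hence "s < 3255 / 10000 * c" using s by simp
  thus ?thesis using pos by (simp add: tan_def s_def c_def field_simps)
qed

lemma arctan_diff_ge:
  assumes "a \<le> b" "1 + a * b > 0" "b - a \<ge> 3255 / 10000 * (1 + a * b)"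
  shows "arctan b - arctan a \<ge> pi / 10"
proof (rule ccontr)
  assume "\<not> ?thesis"
  hence lt: "arctan b - arctan a < pi / 10" by simp
  have ge: "arctan b - arctan a \<ge> 0" using assms(1) by (simp add: arctan_le_iff)
  have "cos (arctan b - arctan a) > 0" using lt ge pi_gt_zero by (intro cos_gt_zero_pi) linarith+
  hence "tan (arctan b - arctan a) = (b - a) / (1 + b * a)" by (subst tan_diff) (auto simp: tan_arctan)
  also have "\<dots> \<ge> 3255 / 10000" using assms by (simp add: pos_le_divide_eq mult.commute)
  finally have "tan (arctan b - arctan a) > tan (pi / 10)" using tan_pi_tenth by linarith
  moreover have "tan (arctan b - arctan a) < tan (pi / 10)" using lt ge pi_gt_zero by (intro tan_monotone) linarith+
  ultimately show False by simp
qed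

lemma pi_le: "pi \<le> 31416 / 10000"
  using pi_approx(2) by simp

lemma pi_ge: "3141 / 1000 \<le> pi"
  using pi_approx(1) by simp

lemma exp_le_power3: "exp (real n) \<le> 3 ^ n"
  using power_mono[OF exp_le, of n] by (simp flip: exp_of_nat_mult)

lemma exp_le_3_power: "x \<le> real n \<Longrightarrow> exp x \<le> 3 ^ n"
  using exp_le_power3[of n] by (meson exp_le_cancel_iff order_trans)

context odd_curve begin

definition radius :: real where "radius = (SUP z\<in>sphere 0 1. norm (f z))"

lemma radius:
  obtains p where "p \<in> \<Gamma>" "norm p = radius" "\<And>q. q \<in> \<Gamma> \<Longrightarrow> norm q \<le> radius" "l \<le> radius" "radius \<le> L"
proof -
  have "continuous_on (sphere 0 1) (\<lambda>z. norm (f z))" by (intro continuous_intros continuous)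
  then obtain z where z: "z \<in> sphere 0 1" "\<And>y. y \<in> sphere 0 1 \<Longrightarrow> norm (f y) \<le> norm (f z)"
    using continuous_attains_sup[of "sphere (0::complex) 1" "\<lambda>z. norm (f z)"] by auto
  have "radius = norm (f z)" unfolding radius_def using z by (intro cSup_eq_maximum) auto
  thus thesis using z norm_on_circle[of z] by (intro that[of "f z"]) (auto simp: curve_def)
qed

lemma radius_pos: "radius > 0" using radius l_pos by fastforce

lemma norm_curve_le: "q \<in> \<Gamma> \<Longrightarrow> norm q \<le> radius" using radius by blast

lemma radius_bounds: "l \<le> radius" "radius \<le> L" using radius by blast+

lemma far_point:
  assumes "p \<in> \<Gamma>" obtains q where "q \<in> \<Gamma>" "norm (p - q) \<ge> radius" "q \<noteq> p"
proof -
  obtain m where m: "m \<in> \<Gamma>" "norm m = radius" using radius by blast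
  have "2 * radius = norm ((p + m) - (p - m))" using m(2) by (simp flip: mult_2 add: norm_mult)
  also have "\<dots> \<le> norm (p - - m) + norm (p - m)" using norm_triangle_ineq4[of "p + m" "p - m"] by simp
  finally have "norm (p - m) \<ge> radius \<or> norm (p - - m) \<ge> radius" by linarith
  thus thesis using that[of m] that[of "- m"] m(1) curve_symmetric radius_pos by fastforce
qed

end

section \<open>Distortion estimates on one side of the curve\<close>

definition C0 :: real where "C0 = 16 * 10 ^ 12"

lemma C0_pos: "C0 > 0" by (simp add: C0_def)

locale pi_equivariant =
  fixes g :: "real \<Rightarrow> real"
  assumes g_cont: "continuous_on UNIV g" and g_mono: "strict_mono g" and g_pi: "\<And>u. g (u + pi) = g u + pi"
begin

lemma g_increment: assumes "y \<ge> 0" shows "y - pi \<le> g (x + y) - g x" "g (x + y) - g x \<le> y + pi"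
proof -
  have gn: "g (x + real n * pi) = g x + real n * pi" for n
  proof (induction n)
    case (Suc n)
    have "g (x + real (Suc n) * pi) = g ((x + real n * pi) + pi)" by (simp add: algebra_simps)
    thus ?case unfolding g_pi Suc by (simp add: algebra_simps)
  qed simp
  define n where "n = nat \<lfloor>y / pi\<rfloor>"
  have "real n = of_int \<lfloor>y / pi\<rfloor>" using assms by (simp add: n_def)
  hence "real n \<le> y / pi" "y / pi < real n + 1" by linarith+
  hence n: "real n * pi \<le> y" "y < real n * pi + pi" by (simp_all add: field_simps)
  have "g (x + real n * pi) \<le> g (x + y)" using n(1) g_mono by (simp add: strict_mono_less_eq)
  moreover have "g (x + y) \<le> g (x + real (Suc n) * pi)"
    using n(2) g_mono by (simp add: strict_mono_less_eq algebra_simps)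
  ultimately show "y - pi \<le> g (x + y) - g x" "g (x + y) - g x \<le> y + pi"
    unfolding gn using n by (simp_all add: algebra_simps)
qed

lemma g_le: "x \<le> y \<Longrightarrow> g x \<le> g y" using g_mono by (simp add: strict_mono_less_eq)

end

text \<open>The common features of the two sides, with \<open>\<sigma> = -1\<close> for the inside and \<open>\<sigma> = 1\<close> for the
  outside. The Moebius images \<open>X p\<close> of the Riemann map and the nonvanishing derivative \<open>J\<close>, corrected
  by a power of the coordinate, are holomorphic at the puncture as well, so that the maximum
  principle applies to them on the full disc.\<close>

locale conformal_side = odd_curve f L l + pi_equivariant g for f L l g +
  fixes \<Theta> J :: "complex \<Rightarrow> complex" and X :: "complex \<Rightarrow> complex \<Rightarrow> complex" and \<sigma> :: real
  assumes sigma: "\<sigma> = 1 \<or> \<sigma> = - 1"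
    and lift_hol: "\<Theta> holomorphic_on \<H>" and lift_nonzero: "\<And>\<zeta>. 0 < Im \<zeta> \<Longrightarrow> \<Theta> \<zeta> \<noteq> 0"
    and lift_off: "\<And>\<zeta>. 0 < Im \<zeta> \<Longrightarrow> \<Theta> \<zeta> \<notin> \<Gamma>"
    and lift_eq: "\<And>\<zeta> \<xi>. 0 < Im \<zeta> \<Longrightarrow> 0 < Im \<xi> \<Longrightarrow> \<Theta> \<zeta> = \<Theta> \<xi> \<Longrightarrow> \<exists>n::int. \<zeta> = \<xi> + of_real (2 * pi * of_int n)"
    and lift_pi: "\<And>\<zeta>. 0 < Im \<zeta> \<Longrightarrow> \<Theta> (\<zeta> + of_real pi) = - \<Theta> \<zeta>"
    and lift_boundary: "\<And>u. (\<Theta> \<longlongrightarrow> f (cis (g u))) (at (of_real u) within \<H>)"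
    and growth: "\<And>\<zeta>. 0 < Im \<zeta> \<Longrightarrow> norm (\<Theta> \<zeta>) \<le> radius * exp (\<sigma> * Im \<zeta>)"
    and X_hol: "\<And>p. p \<in> \<Gamma> \<Longrightarrow> X p holomorphic_on ball 0 1" and X_inj: "\<And>p. p \<in> \<Gamma> \<Longrightarrow> inj_on (X p) (ball 0 1)"
    and X_lift: "\<And>p \<zeta>. p \<in> \<Gamma> \<Longrightarrow> 0 < Im \<zeta> \<Longrightarrow> X p (exp (\<i> * \<zeta>)) = 1 / (\<Theta> \<zeta> - p)"
    and X_omits: "\<And>p q. p \<in> \<Gamma> \<Longrightarrow> q \<in> \<Gamma> \<Longrightarrow> q \<noteq> p \<Longrightarrow> 1 / (q - p) \<notin> X p ` ball 0 1"
    and Schwarz_Pick: "\<And>\<zeta>. 0 < Im \<zeta> \<Longrightarrow> infdist (\<Theta> \<zeta>) \<Gamma> * exp (- Im \<zeta>) \<le> (1 - exp (- 2 * Im \<zeta>)) * norm (deriv \<Theta> \<zeta>)"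
    and J_hol: "J holomorphic_on ball 0 1" and J_nonzero: "\<And>z. norm z < 1 \<Longrightarrow> J z \<noteq> 0"
    and J_lift: "\<And>\<zeta>. 0 < Im \<zeta> \<Longrightarrow> norm (J (exp (\<i> * \<zeta>))) = norm (deriv \<Theta> \<zeta>) * exp (- \<sigma> * Im \<zeta>)"
begin

definition bdry :: "real \<Rightarrow> complex" where "bdry t = f (cis (g t))"

definition delta :: "real \<Rightarrow> real \<Rightarrow> real" where "delta u v = infdist (\<Theta> (Complex u v)) \<Gamma>"

lemma bdry_in_curve: "bdry t \<in> \<Gamma>" using curve_cis by (auto simp: bdry_def)

lemma delta_le: "p \<in> \<Gamma> \<Longrightarrow> delta u v \<le> norm (\<Theta> (Complex u v) - p)"
  unfolding delta_def dist_norm[symmetric] by (rule infdist_le)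

lemma delta_attained: obtains p where "p \<in> \<Gamma>" "norm (\<Theta> (Complex u v) - p) = delta u v"
  using infdist_attains_inf[OF closed_curve curve_nonempty] unfolding delta_def dist_norm by metis

lemma delta_nonneg: "delta u v \<ge> 0" by (simp add: delta_def infdist_nonneg)

lemma cross_ratio:
  assumes v: "v > 0" and p: "p \<in> \<Gamma>" "q \<in> \<Gamma>" "p \<noteq> q" and ab: "arctan b - arctan a \<ge> pi / 10"
  obtains t where "u + a * v \<le> t" "t \<le> u + b * v"
    "norm (bdry t - \<Theta> (Complex u v)) * norm (p - q) \<le> C0 * norm (\<Theta> (Complex u v) - p) * norm (bdry t - q)"
proof -
  define w where "w = \<Theta> (Complex u v)"
  define z where "z = exp (\<i> * Complex u v)"
  have z: "z \<in> ball 0 1" using v by (simp add: z_def norm_exp_i)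
  have Xz: "X q z = 1 / (w - q)" using X_lift[OF p(2), of "Complex u v"] v by (simp add: z_def w_def)
  have "open (X q ` ball 0 1)" using open_mapping_thm3[OF X_hol[OF p(2)] open_ball X_inj[OF p(2)]] .
  then obtain y where y: "y \<notin> X q ` ball 0 1" "norm (X q z - y) \<le> norm (X q z - 1 / (p - q))"
      "ball (X q z) (norm (X q z - y)) \<subseteq> X q ` ball 0 1"
    using nearest_omitted_value[OF _ X_omits[OF p(2,1,3)]] by blast
  obtain k where k: "k holomorphic_on ball 0 1" "\<And>x. x \<in> ball 0 1 \<Longrightarrow> norm (k x) \<le> 5/2" "k z = 1/2"
    "\<And>x. x \<in> ball 0 1 \<Longrightarrow> norm (X q x - y) * (norm (k x))\<^sup>2 \<le> (1 + norm (k x))\<^sup>2 * norm (X q z - y)"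
    using sqrt_comparison_function[OF open_ball convex_ball X_hol[OF p(2)] X_inj[OF p(2)] z y(1,3)] by metis
  have hol: "(\<lambda>\<zeta>. k (exp (\<i> * \<zeta>))) holomorphic_on \<H>"
  proof -
    have "k \<circ> (\<lambda>\<zeta>. exp (\<i> * \<zeta>)) holomorphic_on \<H>"
      by (rule holomorphic_on_compose_gen[OF _ k(1)]) (auto intro!: holomorphic_intros simp: norm_exp_i)
    thus ?thesis by (simp add: o_def)
  qed
  have kb: "norm (k (exp (\<i> * \<zeta>))) \<le> 5/2" if "Im \<zeta> > 0" for \<zeta> using k(2) that by (simp add: norm_exp_i)
  have ab': "arctan b - arctan a \<ge> pi / real 10" using ab by simp
  obtain t Y where t: "u + a * v \<le> t" "t \<le> u + b * v" "\<And>m. Im (Y m) > 0" "Y \<longlonglongrightarrow> complex_of_real t"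
    "\<And>m. norm (k (exp (\<i> * Complex u v))) ^ 10 \<le> norm (k (exp (\<i> * Y m))) * (5/2) ^ (10 - 1)"
    using large_value_near_interval[OF hol kb _ v ab', of u] by (metis zero_less_numeral)
  have main: "norm (\<Theta> (Y m) - w) * norm (p - q) \<le> C0 * norm (w - p) * norm (\<Theta> (Y m) - q)" for m
  proof -
    define x where "x = exp (\<i> * Y m)"
    have x: "x \<in> ball 0 1" using t(3)[of m] by (simp add: x_def norm_exp_i)
    define \<kappa> where "\<kappa> = norm (k x)"
    have "norm (k z) ^ 10 \<le> \<kappa> * (5/2) ^ 9" using t(5)[of m] by (simp add: x_def z_def \<kappa>_def)
    hence kap: "\<kappa> * 3906250 \<ge> 1" by (simp add: k(3) norm_divide power_divide field_simps)
    hence kpos: "\<kappa> > 0" by linarith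
    have "(1 + \<kappa>)\<^sup>2 \<le> (3906251 * \<kappa>)\<^sup>2" using kap kpos by (intro power_mono) auto
    hence "norm (X q x - y) * \<kappa>\<^sup>2 \<le> 3906251\<^sup>2 * \<kappa>\<^sup>2 * norm (X q z - y)"
      using k(4)[OF x] unfolding \<kappa>_def[symmetric] power_mult_distrib
      by (meson mult_right_mono norm_ge_zero order_trans)
    hence "norm (X q x - y) * \<kappa>\<^sup>2 \<le> (3906251\<^sup>2 * norm (X q z - y)) * \<kappa>\<^sup>2" by (simp only: mult_ac)
    hence "norm (X q x - y) \<le> 3906251\<^sup>2 * norm (X q z - y)" using kpos by (simp only: mult_le_cancel_right) auto
    hence "norm (X q x - X q z) \<le> C0 * norm (X q z - y)"
    proof -
      assume a: "norm (X q x - y) \<le> 3906251\<^sup>2 * norm (X q z - y)"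
      have "norm (X q x - X q z) \<le> norm (X q x - y) + norm (X q z - y)"
        using norm_triangle_ineq4[of "X q x - y" "X q z - y"] by simp
      moreover have "3906251\<^sup>2 * norm (X q z - y) + norm (X q z - y) \<le> C0 * norm (X q z - y)"
      proof -
        have "(3906251\<^sup>2 + 1) * norm (X q z - y) \<le> C0 * norm (X q z - y)"
          unfolding C0_def by (rule mult_right_mono) simp_all
        thus ?thesis by (simp only: distrib_right mult_1)
      qed
      ultimately show ?thesis using a by linarith
    qed
    also have "\<dots> \<le> C0 * norm (X q z - 1 / (p - q))" using y(2) C0_pos by simp
    finally have *: "norm (X q x - X q z) \<le> C0 * norm (X q z - 1 / (p - q))" .
    define A B C where "A = \<Theta> (Y m) - q" and "B = w - q" and "C = p - q"
    have nz: "A \<noteq> 0" "B \<noteq> 0" "C \<noteq> 0"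
      using lift_off[of "Y m"] lift_off[of "Complex u v"] t(3)[of m] v p by (auto simp: A_def B_def C_def w_def)
    have "X q x = 1 / A" using X_lift[OF p(2) t(3)] by (simp add: x_def A_def)
    hence "norm (1 / A - 1 / B) \<le> C0 * norm (1 / B - 1 / C)" using * Xz by (simp add: B_def C_def)
    moreover have "1 / A - 1 / B = (B - A) / (A * B)" "1 / B - 1 / C = (C - B) / (B * C)"
      using nz by (simp_all add: field_simps)
    ultimately have "norm (B - A) / (norm A * norm B) \<le> C0 * (norm (C - B) / (norm B * norm C))"
      by (simp add: norm_divide norm_mult)
    hence "norm (B - A) * norm C \<le> C0 * norm (C - B) * norm A" using nz by (simp add: field_simps)
    moreover have "norm (B - A) = norm (\<Theta> (Y m) - w)" "norm (C - B) = norm (w - p)"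
      by (simp_all add: A_def B_def C_def norm_minus_commute)
    ultimately show ?thesis by (simp add: A_def C_def)
  qed
  have "Y m \<noteq> of_real t" for m using t(3)[of m] by (metis Im_complex_of_real less_irrefl)
  hence "filterlim Y (at (of_real t) within \<H>) sequentially"
    using t(3,4) by (auto simp: filterlim_at intro!: always_eventually)
  hence lim: "(\<lambda>m. \<Theta> (Y m)) \<longlonglongrightarrow> bdry t" unfolding bdry_def using lift_boundary filterlim_compose by blast
  have "norm (bdry t - w) * norm (p - q) \<le> C0 * norm (w - p) * norm (bdry t - q)"
    by (rule tendsto_le[OF _ _ _ always_eventually[OF allI[OF main]]]) (auto intro!: tendsto_intros lim)
  thus thesis using that t(1,2) by (simp add: w_def)
qed

lemma near_boundary_point:
  assumes v: "v > 0" and ab: "arctan b - arctan a \<ge> pi / 10"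
  obtains t where "u + a * v \<le> t" "t \<le> u + b * v" "norm (bdry t - \<Theta> (Complex u v)) \<le> 2 * C0 * delta u v"
proof -
  obtain p where p: "p \<in> \<Gamma>" "norm (\<Theta> (Complex u v) - p) = delta u v" using delta_attained by blast
  obtain q where q: "q \<in> \<Gamma>" "norm (p - q) \<ge> radius" "q \<noteq> p" using far_point[OF p(1)] by blast
  obtain t where t: "u + a * v \<le> t" "t \<le> u + b * v"
    "norm (bdry t - \<Theta> (Complex u v)) * norm (p - q) \<le> C0 * norm (\<Theta> (Complex u v) - p) * norm (bdry t - q)"
    using cross_ratio[OF v p(1) q(1) q(3)[symmetric] ab] by metis
  have "norm (bdry t - q) \<le> 2 * radius"
    using norm_triangle_ineq4[of "bdry t" q] norm_curve_le[OF q(1)] norm_curve_le[OF bdry_in_curve[of t]] by linarith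
  hence "C0 * delta u v * norm (bdry t - q) \<le> C0 * delta u v * (2 * radius)"
    using C0_pos delta_nonneg by (intro mult_left_mono) auto
  moreover have "norm (bdry t - \<Theta> (Complex u v)) * radius \<le> norm (bdry t - \<Theta> (Complex u v)) * norm (p - q)"
    using q(2) by (intro mult_left_mono) auto
  ultimately have "norm (bdry t - \<Theta> (Complex u v)) * radius \<le> (2 * C0 * delta u v) * radius"
    using t(3) p(2) by (simp add: mult_ac)
  thus thesis using that[OF t(1,2)] radius_pos by simp
qed

lemma bdry_lower: assumes "\<bar>g s - g t\<bar> \<le> pi" shows "l * (2 / pi * \<bar>g s - g t\<bar>) \<le> norm (bdry s - bdry t)"
proof -
  have "l * (2 / pi * \<bar>g s - g t\<bar>) \<le> l * norm (cis (g s) - cis (g t))"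
    using l_pos norm_cis_diff_ge[OF assms] by (intro mult_left_mono) auto
  also have "\<dots> \<le> norm (bdry s - bdry t)" unfolding bdry_def by (rule lower) auto
  finally show ?thesis .
qed

lemma bdry_upper: "norm (bdry s - bdry t) \<le> L * \<bar>g s - g t\<bar>"
proof -
  have "norm (bdry s - bdry t) \<le> L * norm (cis (g s) - cis (g t))" unfolding bdry_def by (rule upper) auto
  also have "\<dots> \<le> L * \<bar>g s - g t\<bar>" using L_pos norm_cis_diff_le by (intro mult_left_mono) auto
  finally show ?thesis .
qed

lemma boundary_window:
  assumes v: "0 < v" "v \<le> 3/2"
  obtains t1 t2 where "u + v/2 \<le> t1" "t2 \<le> u - v/2" "g t1 - g t2 \<le> pi"
    "norm (bdry t1 - \<Theta> (Complex u v)) \<le> 2 * C0 * delta u v" "norm (bdry t2 - \<Theta> (Complex u v)) \<le> 2 * C0 * delta u v"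
proof -
  have "arctan 1 - arctan (1/2) \<ge> pi / 10" by (rule arctan_diff_ge) auto
  then obtain t1 where t1: "u + (1/2) * v \<le> t1" "t1 \<le> u + 1 * v" "norm (bdry t1 - \<Theta> (Complex u v)) \<le> 2 * C0 * delta u v"
    using near_boundary_point[OF v(1), of 1 "1/2" u] by blast
  have "arctan (- 1/2) - arctan (- 1) \<ge> pi / 10" by (rule arctan_diff_ge) auto
  then obtain t2 where t2: "u + (- 1) * v \<le> t2" "t2 \<le> u + (- 1/2) * v" "norm (bdry t2 - \<Theta> (Complex u v)) \<le> 2 * C0 * delta u v"
    using near_boundary_point[OF v(1), of "- 1/2" "- 1" u] by blast
  have "t1 \<le> t2 + pi" using t1(2) t2(1) v pi_gt3 by simp
  hence "g t1 \<le> g t2 + pi" using g_le[of t1 "t2 + pi"] g_pi by simp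
  thus thesis using that[of t1 t2] t1 t2 by simp
qed

lemma window_increment_le:
  assumes v: "0 < v" "v \<le> 3/2"
  shows "l * (g (u + v/2) - g (u - v/2)) \<le> 2 * pi * C0 * delta u v"
proof -
  obtain t1 t2 where t: "u + v/2 \<le> t1" "t2 \<le> u - v/2" "g t1 - g t2 \<le> pi"
    "norm (bdry t1 - \<Theta> (Complex u v)) \<le> 2 * C0 * delta u v" "norm (bdry t2 - \<Theta> (Complex u v)) \<le> 2 * C0 * delta u v"
    using boundary_window[OF v] by blast
  have g: "g (u + v/2) \<le> g t1" "g t2 \<le> g (u - v/2)" using t g_le by auto
  have "t2 \<le> t1" using t v by linarith
  hence "g t2 \<le> g t1" by (rule g_le)
  hence "l * (2 / pi * (g t1 - g t2)) \<le> norm (bdry t1 - bdry t2)" using bdry_lower[of t1 t2] t(3) by simp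
  also have "\<dots> \<le> 4 * C0 * delta u v"
    using t(4,5) norm_triangle_ineq4[of "bdry t1 - \<Theta> (Complex u v)" "bdry t2 - \<Theta> (Complex u v)"] by simp
  finally have "l * (g t1 - g t2) \<le> 2 * pi * C0 * delta u v" by (simp add: field_simps)
  moreover have "l * (g (u + v/2) - g (u - v/2)) \<le> l * (g t1 - g t2)" using g l_pos by (intro mult_left_mono) auto
  ultimately show ?thesis by linarith
qed

lemma norm_opposite_cis:
  assumes "\<bar>x - y\<bar> \<le> pi / 2" shows "norm (cis x + cis y) \<ge> 4 / 10"
proof -
  have "norm (2 * cis x) \<le> norm (cis x + cis y) + norm (cis x - cis y)"
    using norm_triangle_ineq[of "cis x + cis y" "cis x - cis y"] by (simp add: algebra_simps)
  moreover have "norm (2 * cis x) = 2" by (simp add: norm_mult)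
  ultimately show ?thesis using norm_cis_diff_le[of x y] assms pi_le by linarith
qed

lemma opposite_points:
  assumes "norm (bdry s - w) \<le> e" "norm (bdry t - w) \<le> e" "\<bar>g s + pi - g t\<bar> \<le> pi / 2"
  shows "l \<le> 5 * e"
proof -
  have "norm (cis (g s + pi) + cis (g t)) \<ge> 4 / 10" by (rule norm_opposite_cis[OF assms(3)])
  moreover have "cis (g s + pi) + cis (g t) = - (cis (g s) - cis (g t))" by (simp add: minus_cis[symmetric])
  ultimately have "l * (4 / 10) \<le> l * norm (cis (g s) - cis (g t))" using l_pos by (simp add: norm_minus_commute)
  also have "\<dots> \<le> norm (bdry s - bdry t)" unfolding bdry_def by (rule lower) auto
  also have "\<dots> \<le> 2 * e" using assms(1,2) norm_triangle_ineq4[of "bdry s - w" "bdry t - w"] by simp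
  finally show ?thesis by simp
qed

lemma delta_lower: "l \<le> 10 * C0 * delta u (3/2)"
proof -
  have a1: "arctan 0 - arctan (- pi/3) \<ge> pi / 10" using pi_gt3 by (intro arctan_diff_ge) auto
  have a2: "arctan (pi/3) - arctan 0 \<ge> pi / 10" using pi_gt3 by (intro arctan_diff_ge) auto
  have pp: "pi\<^sup>2 \<le> 987 / 100"
  proof -
    have "pi * pi \<le> (31416 / 10000) * (31416 / 10000)" using pi_le pi_gt3 by (intro mult_mono) auto
    thus ?thesis unfolding power2_eq_square by simp
  qed
  have "pi / 3 \<ge> 3255 / 10000 * (1 + 2 * pi\<^sup>2 / 9)" using pp pi_ge by simp
  hence num: "2 * pi / 3 - pi / 3 \<ge> 3255 / 10000 * (1 + pi / 3 * (2 * pi / 3))" by (simp add: power2_eq_square)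
  have a3: "arctan (2*pi/3) - arctan (pi/3) \<ge> pi / 10"
    using num by (intro arctan_diff_ge) (auto simp: add_pos_nonneg)
  have a4: "arctan (- pi/3) - arctan (- 2*pi/3) \<ge> pi / 10" using a3 by (simp add: arctan_minus minus_divide_left[symmetric])
  have v: "(3/2::real) > 0" by simp
  have "g (u + pi/2) - g (u - pi/2) = pi" using g_pi[of "u - pi/2"] by (simp add: add.commute)
  then consider "g u - g (u - pi/2) \<le> pi/2" | "g (u + pi/2) - g u \<le> pi/2" by linarith
  hence "l \<le> 5 * (2 * C0 * delta u (3/2))"
  proof cases
    case 1
    obtain s where s: "u + (- pi/3) * (3/2) \<le> s" "s \<le> u + 0 * (3/2)" "norm (bdry s - \<Theta> (Complex u (3/2))) \<le> 2 * C0 * delta u (3/2)"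
      using near_boundary_point[OF v a1] by blast
    obtain t where t: "u + (pi/3) * (3/2) \<le> t" "t \<le> u + (2*pi/3) * (3/2)" "norm (bdry t - \<Theta> (Complex u (3/2))) \<le> 2 * C0 * delta u (3/2)"
      using near_boundary_point[OF v a3] by blast
    have "g (u - pi/2) \<le> g s" "g s \<le> g u" using s g_le by auto
    moreover have "g (u - pi/2) \<le> g (t - pi)" "g (t - pi) \<le> g u" using t g_le by auto
    moreover have "g t = g (t - pi) + pi" using g_pi[of "t - pi"] by simp
    ultimately have "\<bar>g s + pi - g t\<bar> \<le> pi / 2" using 1 by linarith
    thus ?thesis using opposite_points s(3) t(3) by blast
  next
    case 2
    obtain t where t: "u + 0 * (3/2) \<le> t" "t \<le> u + (pi/3) * (3/2)" "norm (bdry t - \<Theta> (Complex u (3/2))) \<le> 2 * C0 * delta u (3/2)"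
      using near_boundary_point[OF v a2] by blast
    obtain s where s: "u + (- 2*pi/3) * (3/2) \<le> s" "s \<le> u + (- pi/3) * (3/2)" "norm (bdry s - \<Theta> (Complex u (3/2))) \<le> 2 * C0 * delta u (3/2)"
      using near_boundary_point[OF v a4] by blast
    have "g u \<le> g t" "g t \<le> g (u + pi/2)" using t g_le by auto
    moreover have "g u \<le> g (s + pi)" "g (s + pi) \<le> g (u + pi/2)" using s g_le by auto
    ultimately have "\<bar>g s + pi - g t\<bar> \<le> pi / 2" using 2 unfolding g_pi by linarith
    thus ?thesis using opposite_points s(3) t(3) by blast
  qed
  thus ?thesis by simp
qed

lemma delta_le_deriv:
  assumes v: "0 < v" "v \<le> 3/2" shows "delta u v \<le> 18 * v * norm (deriv \<Theta> (Complex u v))"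
proof -
  have "delta u v * exp (- v) \<le> (1 - exp (- 2 * v)) * norm (deriv \<Theta> (Complex u v))"
    using Schwarz_Pick[of "Complex u v"] v by (simp add: delta_def)
  also have "\<dots> \<le> (2 * v) * norm (deriv \<Theta> (Complex u v))"
    using exp_ge_add_one_self[of "- 2 * v"] by (intro mult_right_mono) auto
  finally have "(delta u v * exp (- v)) * exp v \<le> ((2 * v) * norm (deriv \<Theta> (Complex u v))) * exp v"
    by (intro mult_right_mono) auto
  moreover have "(delta u v * exp (- v)) * exp v = delta u v" by (simp add: mult.assoc flip: exp_add)
  moreover have "((2 * v) * norm (deriv \<Theta> (Complex u v))) * exp v \<le> ((2 * v) * norm (deriv \<Theta> (Complex u v))) * 9"
    using exp_le_3_power[of v 2] v by (intro mult_left_mono) auto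
  ultimately have "delta u v \<le> ((2 * v) * norm (deriv \<Theta> (Complex u v))) * 9" by linarith
  thus ?thesis by simp
qed

lemma deriv_lower:
  assumes v: "3/2 \<le> v" shows "l * exp (\<sigma> * v) \<le> 2430 * C0 * norm (deriv \<Theta> (Complex u v))"
proof -
  define r where "r = exp (- (3/2) :: real)"
  have r: "0 < r" "r < 1" by (auto simp: r_def)
  have circ: "norm (1 / J z) \<le> 2430 * C0 / l" if "norm z = r" for z
  proof -
    have "z = r * cis (Arg z)" using that by (metis rcis_cmod_Arg rcis_def)
    also have "\<dots> = exp (\<i> * Complex (Arg z) (3/2))"
      by (simp add: r_def cis_conv_exp exp_of_real[symmetric] exp_add[symmetric] Complex_eq algebra_simps)
    finally have z: "z = exp (\<i> * Complex (Arg z) (3/2))" .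
    have "norm (J z) = norm (deriv \<Theta> (Complex (Arg z) (3/2))) * exp (- \<sigma> * (3/2))"
      using J_lift[of "Complex (Arg z) (3/2)"] z by simp
    moreover have "exp (- \<sigma> * (3/2)) \<ge> 1 / 9"
    proof -
      have "exp (\<sigma> * (3/2)) \<le> 3 ^ 2" using sigma by (intro exp_le_3_power) auto
      thus ?thesis by (simp add: exp_minus field_simps)
    qed
    hence "norm (deriv \<Theta> (Complex (Arg z) (3/2))) * (1 / 9) \<le> norm (deriv \<Theta> (Complex (Arg z) (3/2))) * exp (- \<sigma> * (3/2))"
      by (intro mult_left_mono) auto
    moreover have "delta (Arg z) (3/2) \<le> 27 * norm (deriv \<Theta> (Complex (Arg z) (3/2)))"
      using delta_le_deriv[of "3/2" "Arg z"] by simp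
    hence "10 * C0 * delta (Arg z) (3/2) \<le> 10 * C0 * (27 * norm (deriv \<Theta> (Complex (Arg z) (3/2))))"
      using C0_pos by (intro mult_left_mono) auto
    hence "l \<le> 270 * C0 * norm (deriv \<Theta> (Complex (Arg z) (3/2)))" using delta_lower[of "Arg z"] by simp
    moreover have "270 * C0 * norm (deriv \<Theta> (Complex (Arg z) (3/2))) = 2430 * C0 * (norm (deriv \<Theta> (Complex (Arg z) (3/2))) * (1/9))" by simp
    ultimately have "l \<le> 2430 * C0 * norm (J z)" using C0_pos by (smt (verit) mult_left_mono mult_pos_pos)
    moreover have "norm (J z) > 0" using J_nonzero[of z] that r by simp
    ultimately show ?thesis using l_pos by (simp add: norm_divide field_simps)
  qed
  have sub: "cball 0 r \<subseteq> ball (0::complex) 1" using r by auto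
  have hol: "(\<lambda>z. 1 / J z) holomorphic_on ball 0 1" using J_nonzero by (intro holomorphic_intros J_hol) auto
  define z where "z = exp (\<i> * Complex u v)"
  have zr: "norm z \<le> r" using v by (simp add: z_def norm_exp_i r_def)
  have "norm (1 / J z) \<le> 2430 * C0 / l"
  proof (cases "norm z = r")
    case False
    show ?thesis
    proof (rule maximum_modulus_frontier[where S = "ball 0 r" and f = "\<lambda>z. 1 / J z" and \<xi> = z])
      show "(\<lambda>z. 1 / J z) holomorphic_on interior (ball 0 r)"
        using sub ball_subset_cball by (intro holomorphic_on_subset[OF hol]) force
      show "continuous_on (closure (ball 0 r)) (\<lambda>z. 1 / J z)"
        using sub r by (intro continuous_on_subset[OF holomorphic_on_imp_continuous_on[OF hol]]) simp
      show "norm (1 / J z) \<le> 2430 * C0 / l" if "z \<in> frontier (ball 0 r)" for z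
        using circ[of z] that r by simp
      show "z \<in> ball 0 r" using False zr by simp
    qed simp
  qed (rule circ)
  moreover have "norm (J z) = norm (deriv \<Theta> (Complex u v)) * exp (- \<sigma> * v)"
    using J_lift[of "Complex u v"] v by (simp add: z_def)
  moreover have "norm (J z) > 0" using J_nonzero[of z] zr r by simp
  ultimately have "l \<le> 2430 * C0 * (norm (deriv \<Theta> (Complex u v)) * exp (- \<sigma> * v))"
    using l_pos by (simp add: norm_divide field_simps)
  hence "l * exp (\<sigma> * v) \<le> 2430 * C0 * (norm (deriv \<Theta> (Complex u v)) * exp (- \<sigma> * v)) * exp (\<sigma> * v)"
    by (intro mult_right_mono) auto
  also have "\<dots> = 2430 * C0 * norm (deriv \<Theta> (Complex u v)) * (exp (- \<sigma> * v) * exp (\<sigma> * v))" by (simp only: mult_ac)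
  finally show ?thesis by (simp add: exp_add[symmetric])
qed

end

section \<open>An extension operator of Beurling-Ahlfors type\<close>

lemma shear_bounds:
  fixes pu pv qu qv m M x y :: real
  assumes m: "m > 0" "m \<le> pv" "m \<le> - qv" "pv \<le> pu" "- qv \<le> qu" and M: "pu \<le> M" "qu \<le> M"
  defines "\<alpha> \<equiv> pu * x + pv * y" and "\<beta> \<equiv> qu * x + qv * y"
  shows "m * norm (Complex x y) \<le> 2 * norm (Complex ((\<alpha> + \<beta>) / 2) (2 * (\<alpha> - \<beta>)))"
    "norm (Complex ((\<alpha> + \<beta>) / 2) (2 * (\<alpha> - \<beta>))) \<le> 20 * M * norm (Complex x y)"
proof -
  define N where "N = norm (Complex ((\<alpha> + \<beta>) / 2) (2 * (\<alpha> - \<beta>)))"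
  have N: "\<bar>(\<alpha> + \<beta>) / 2\<bar> \<le> N" "\<bar>2 * (\<alpha> - \<beta>)\<bar> \<le> N"
    unfolding N_def using abs_Re_le_cmod[of "Complex ((\<alpha> + \<beta>) / 2) (2 * (\<alpha> - \<beta>))"]
      abs_Im_le_cmod[of "Complex ((\<alpha> + \<beta>) / 2) (2 * (\<alpha> - \<beta>))"] by simp_all
  have "\<bar>\<alpha> + \<beta>\<bar> \<le> 2 * N" "2 * \<bar>\<alpha> - \<beta>\<bar> \<le> N"
    using N by (simp_all only: abs_mult abs_divide abs_numeral) simp
  hence "\<alpha> + \<beta> \<le> 2 * N" "- (\<alpha> + \<beta>) \<le> 2 * N" "2 * (\<alpha> - \<beta>) \<le> N" "2 * - (\<alpha> - \<beta>) \<le> N"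
    by (auto dest: abs_le_D1 abs_le_D2 simp: abs_if split: if_splits)
  hence "4 * \<alpha> \<le> 5 * N" "4 * (- \<alpha>) \<le> 5 * N" "4 * \<beta> \<le> 5 * N" "4 * (- \<beta>) \<le> 5 * N" by argo+
  hence ab: "4 * \<bar>\<alpha>\<bar> \<le> 5 * N" "4 * \<bar>\<beta>\<bar> \<le> 5 * N" by (simp_all add: abs_if)
  have n1: "norm (Complex x y) \<le> \<bar>x\<bar> + \<bar>y\<bar>" using cmod_le[of "Complex x y"] by simp
  have n2: "\<bar>x\<bar> \<le> norm (Complex x y)" "\<bar>y\<bar> \<le> norm (Complex x y)"
    using abs_Re_le_cmod[of "Complex x y"] abs_Im_le_cmod[of "Complex x y"] by simp_all
  have same: "m * (\<bar>x\<bar> + \<bar>y\<bar>) \<le> \<bar>c * x + d * y\<bar>" if "m \<le> c" "m \<le> d" "x * y \<ge> 0" for c d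
  proof -
    have "m * \<bar>x\<bar> \<le> c * \<bar>x\<bar>" "m * \<bar>y\<bar> \<le> d * \<bar>y\<bar>" using that by (auto intro: mult_right_mono)
    moreover have "\<bar>c * x + d * y\<bar> = c * \<bar>x\<bar> + d * \<bar>y\<bar>"
    proof (cases "x \<ge> 0 \<and> y \<ge> 0")
      case True
      hence "c * x \<ge> 0" "d * y \<ge> 0" using that m(1) by auto
      thus ?thesis using True by simp
    next
      case False
      hence xy: "x \<le> 0" "y \<le> 0" using that(3) by (auto simp: zero_le_mult_iff)
      have "c * x \<le> 0" "d * y \<le> 0" using that m(1) xy by (auto simp: mult_nonneg_nonpos)
      thus ?thesis using xy by (simp add: abs_of_nonpos)
    qed
    ultimately show ?thesis by (simp add: distrib_left)
  qed
  have "m * (\<bar>x\<bar> + \<bar>y\<bar>) \<le> max \<bar>\<alpha>\<bar> \<bar>\<beta>\<bar>"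
  proof (cases "x * y \<ge> 0")
    case True
    have "m * (\<bar>x\<bar> + \<bar>y\<bar>) \<le> \<bar>\<alpha>\<bar>" unfolding \<alpha>_def using m True by (intro same) auto
    thus ?thesis by simp
  next
    case False
    have "m * (\<bar>x\<bar> + \<bar>- y\<bar>) \<le> \<bar>qu * x + (- qv) * (- y)\<bar>"
    proof -
      have "x * (- y) \<ge> 0" using False by simp
      have "m \<le> qu" using m by linarith
      hence "m * \<bar>x\<bar> \<le> qu * \<bar>x\<bar>" "m * \<bar>y\<bar> \<le> (- qv) * \<bar>y\<bar>" using m(3) by (intro mult_right_mono; simp)+
      moreover have "\<bar>qu * x + qv * y\<bar> = qu * \<bar>x\<bar> + (- qv) * \<bar>y\<bar>"
      proof (cases "x \<ge> 0")
        case True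
        hence "y \<le> 0" using False by (meson mult_nonneg_nonneg linear)
        hence "qu * x \<ge> 0" "qv * y \<ge> 0" using True m by (auto simp: mult_nonpos_nonpos)
        thus ?thesis using True \<open>y \<le> 0\<close> by simp
      next
        case F: False
        hence "y \<ge> 0" using False by (meson mult_nonpos_nonpos linear)
        hence "qu * x \<le> 0" "qv * y \<le> 0" using F m by (auto simp: mult_nonneg_nonpos mult_nonpos_nonneg)
        thus ?thesis using F \<open>y \<ge> 0\<close> by (simp add: abs_of_nonpos)
      qed
      ultimately show ?thesis by (simp add: distrib_left)
    qed
    thus ?thesis by (simp add: \<beta>_def)
  qed
  moreover have "m * norm (Complex x y) \<le> m * (\<bar>x\<bar> + \<bar>y\<bar>)" using n1 m by (intro mult_left_mono) auto
  moreover have "N \<ge> 0" by (simp add: N_def)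
  ultimately show "m * norm (Complex x y) \<le> 2 * norm (Complex ((\<alpha> + \<beta>) / 2) (2 * (\<alpha> - \<beta>)))"
    unfolding N_def[symmetric] using ab by linarith
  have up: "\<bar>c * x + d * y\<bar> \<le> 2 * (M * norm (Complex x y))" if "\<bar>c\<bar> \<le> M" "\<bar>d\<bar> \<le> M" for c d
  proof -
    have "\<bar>c * x\<bar> \<le> M * norm (Complex x y)" "\<bar>d * y\<bar> \<le> M * norm (Complex x y)"
      unfolding abs_mult using that n2 by (auto intro!: mult_mono)
    thus ?thesis by linarith
  qed
  have "\<bar>\<alpha>\<bar> \<le> 2 * (M * norm (Complex x y))" "\<bar>\<beta>\<bar> \<le> 2 * (M * norm (Complex x y))"
    unfolding \<alpha>_def \<beta>_def using m M by (auto intro!: up)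
  moreover have "norm (Complex ((\<alpha> + \<beta>) / 2) (2 * (\<alpha> - \<beta>))) \<le> \<bar>(\<alpha> + \<beta>) / 2\<bar> + \<bar>2 * (\<alpha> - \<beta>)\<bar>"
    using cmod_le[of "Complex ((\<alpha> + \<beta>) / 2) (2 * (\<alpha> - \<beta>))"] by simp
  moreover have "\<bar>(\<alpha> + \<beta>) / 2\<bar> = \<bar>\<alpha> + \<beta>\<bar> / 2" "\<bar>2 * (\<alpha> - \<beta>)\<bar> = 2 * \<bar>\<alpha> - \<beta>\<bar>" by (simp_all only: abs_mult abs_divide abs_numeral)
  moreover have "\<bar>\<alpha> + \<beta>\<bar> \<le> \<bar>\<alpha>\<bar> + \<bar>\<beta>\<bar>" "\<bar>\<alpha> - \<beta>\<bar> \<le> \<bar>\<alpha>\<bar> + \<bar>\<beta>\<bar>" "0 \<le> \<bar>\<alpha>\<bar>"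
    by (rule abs_triangle_ineq, rule abs_triangle_ineq4, simp)
  ultimately show "norm (Complex ((\<alpha> + \<beta>) / 2) (2 * (\<alpha> - \<beta>))) \<le> 20 * M * norm (Complex x y)"
    unfolding mult.assoc by argo
qed

context pi_equivariant begin

lemma g_less: "x < y \<Longrightarrow> g x < g y" using g_mono by (simp add: strict_mono_less)

lemma primitive_exists: "\<exists>G. \<forall>x. (G has_real_derivative g x) (at x)"
proof -
  define G where "G x = (if x \<ge> 0 then integral {0..x} g else - integral {x..0} g)" for x
  have int: "g integrable_on {a..b}" for a b
    using continuous_on_subset[OF g_cont] by (intro integrable_continuous_real) auto
  have G: "G x = integral {- c..x} g - integral {- c..0} g" if "c \<ge> 0" "x \<ge> - c" for x c
  proof (cases "x \<ge> 0")
    case True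
    have "integral {- c..0} g + integral {0..x} g = integral {- c..x} g"
      using True that int by (intro Henstock_Kurzweil_Integration.integral_combine) auto
    thus ?thesis using True by (simp add: G_def)
  next
    case False
    have "integral {- c..x} g + integral {x..0} g = integral {- c..0} g"
      using False that int by (intro Henstock_Kurzweil_Integration.integral_combine) auto
    thus ?thesis using False by (simp add: G_def)
  qed
  have "(G has_real_derivative g x) (at x)" for x
  proof -
    define c where "c = \<bar>x\<bar> + 1"
    have "((\<lambda>y. integral {- c..y} g) has_real_derivative g x) (at x within {- c..c})"
      by (rule integral_has_real_derivative) (auto simp: c_def abs_if intro: continuous_on_subset[OF g_cont])
    moreover have "at x within {- c..c} = at x"
      by (rule at_within_interior) (auto simp: c_def abs_if interior_atLeastAtMost_real)
    ultimately have "((\<lambda>y. integral {- c..y} g) has_real_derivative g x) (at x)" by simp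
    hence d: "((\<lambda>y. integral {- c..y} g - integral {- c..0} g) has_real_derivative g x) (at x)"
      by (auto intro!: derivative_eq_intros)
    show ?thesis
      by (rule has_field_derivative_transform_within_open[OF d, of "{- c<..}"]) (use G[of c] in \<open>auto simp: c_def abs_if\<close>)
  qed
  thus ?thesis by blast
qed

definition prim :: "real \<Rightarrow> real" where "prim = (SOME G. \<forall>x. (G has_real_derivative g x) (at x))"

lemma prim_deriv: "(prim has_real_derivative g x) (at x)"
  using someI_ex[OF primitive_exists] unfolding prim_def by blast

lemma prim_deriv' [derivative_intros]:
  assumes "(h has_real_derivative h') (at x)" shows "((\<lambda>x. prim (h x)) has_real_derivative g (h x) * h') (at x)"
  using DERIV_chain2[OF prim_deriv assms] .

lemma prim_pi: "prim (x + pi) = prim x + pi * x + (prim pi - prim 0)"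
proof -
  define k where "k x = prim (x + pi) - prim x - pi * x" for x
  have "(k has_real_derivative 0) (at y)" for y
    unfolding k_def by (auto intro!: derivative_eq_intros prim_deriv' simp: g_pi)
  hence "k x = k 0" using DERIV_isconst_all by blast
  thus ?thesis by (simp add: k_def)
qed

lemma prim_mean: assumes "a < b" obtains c where "a < c" "c < b" "prim b - prim a = (b - a) * g c"
  using MVT2[OF assms, of prim g] prim_deriv by blast

definition rmean :: "real \<Rightarrow> real \<Rightarrow> real" where "rmean u r = (prim (u + r) - prim u) / r"
definition lmean :: "real \<Rightarrow> real \<Rightarrow> real" where "lmean u r = (prim u - prim (u - r)) / r"

lemma rmean_bounds: assumes "r > 0" shows "g u < rmean u r" "rmean u r < g (u + r)"
proof -
  obtain c where "u < c" "c < u + r" "prim (u + r) - prim u = (u + r - u) * g c"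
    using prim_mean[of u "u + r"] assms by auto
  thus "g u < rmean u r" "rmean u r < g (u + r)" using assms g_less by (auto simp: rmean_def)
qed

lemma lmean_bounds: assumes "r > 0" shows "g (u - r) < lmean u r" "lmean u r < g u"
  using rmean_bounds[OF assms, of "u - r"] by (simp_all add: rmean_def lmean_def)

lemma rmean_gap: assumes "r > 0" shows "g (u + r) - rmean u r \<ge> (g (u + r) - g (u + r/4)) / 4"
proof -
  obtain c where c: "u < c" "c < u + r/4" "prim (u + r/4) - prim u = (u + r/4 - u) * g c"
    using prim_mean[of u "u + r/4"] assms by auto
  obtain d where d: "u + r/4 < d" "d < u + r" "prim (u + r) - prim (u + r/4) = (u + r - (u + r/4)) * g d"
    using prim_mean[of "u + r/4" "u + r"] assms by auto
  have e: "prim (u + r) - prim u = r * (g c / 4 + 3 / 4 * g d)" using c(3) d(3) by (simp add: field_simps)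
  have "rmean u r = g c / 4 + 3 / 4 * g d" unfolding rmean_def e using assms by simp
  moreover have "g c \<le> g (u + r/4)" "g d \<le> g (u + r)" using c d g_le by auto
  ultimately show ?thesis by argo
qed

lemma lmean_gap: assumes "r > 0" shows "lmean u r - g (u - r) \<ge> (g (u - r/4) - g (u - r)) / 4"
proof -
  obtain c where c: "u - r/4 < c" "c < u" "prim u - prim (u - r/4) = (u - (u - r/4)) * g c"
    using prim_mean[of "u - r/4" u] assms by auto
  obtain d where d: "u - r < d" "d < u - r/4" "prim (u - r/4) - prim (u - r) = (u - r/4 - (u - r)) * g d"
    using prim_mean[of "u - r" "u - r/4"] assms by auto
  have e: "prim u - prim (u - r) = r * (g c / 4 + 3 / 4 * g d)" using c(3) d(3) by (simp add: field_simps)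
  have "lmean u r = g c / 4 + 3 / 4 * g d" unfolding lmean_def e using assms by simp
  moreover have "g (u - r/4) \<le> g c" "g (u - r) \<le> g d" using c d g_le by auto
  ultimately show ?thesis by argo
qed

lemma mean_difference: assumes "r > 0" shows "\<bar>rmean u r - lmean u r - r\<bar> \<le> pi"
proof -
  define \<phi> where "\<phi> s = prim (u + s) + prim (u - s) - s\<^sup>2" for s
  have "(\<phi> has_real_derivative g (u + s) - g (u - s) - 2 * s) (at s)" for s
    unfolding \<phi>_def by (auto intro!: derivative_eq_intros prim_deriv')
  then obtain s where s: "0 < s" "s < r" "\<phi> r - \<phi> 0 = (r - 0) * (g (u + s) - g (u - s) - 2 * s)"
    using MVT2[OF assms, of \<phi> "\<lambda>s. g (u + s) - g (u - s) - 2 * s"] by blast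
  have e: "rmean u r - lmean u r - r = (\<phi> r - \<phi> 0) / r"
    using assms by (simp add: rmean_def lmean_def \<phi>_def diff_divide_distrib add_divide_distrib power2_eq_square)
  have "rmean u r - lmean u r - r = g (u + s) - g (u - s) - 2 * s"
    unfolding e s(3) using assms by simp
  moreover have "u - s + 2 * s = u + s" by simp
  ultimately show ?thesis using g_increment[of "2 * s" "u - s"] s(1) by (simp only: abs_le_iff) linarith
qed

definition ext :: "complex \<Rightarrow> complex" where
  "ext \<zeta> = Complex ((rmean (Re \<zeta>) (Im \<zeta> / 2) + lmean (Re \<zeta>) (Im \<zeta> / 2)) / 2)
     (2 * (rmean (Re \<zeta>) (Im \<zeta> / 2) - lmean (Re \<zeta>) (Im \<zeta> / 2)))"

lemma Im_ext: assumes "Im \<zeta> > 0" shows "Im (ext \<zeta>) > 0" "\<bar>Im (ext \<zeta>) - Im \<zeta>\<bar> \<le> 2 * pi"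
  "Im (ext \<zeta>) \<le> 2 * (g (Re \<zeta> + Im \<zeta> / 2) - g (Re \<zeta> - Im \<zeta> / 2))"
proof -
  have r: "Im \<zeta> / 2 > 0" using assms by simp
  show "Im (ext \<zeta>) > 0" using rmean_bounds[OF r, of "Re \<zeta>"] lmean_bounds[OF r, of "Re \<zeta>"] by (simp add: ext_def)
  show "\<bar>Im (ext \<zeta>) - Im \<zeta>\<bar> \<le> 2 * pi" using mean_difference[OF r, of "Re \<zeta>"] by (simp add: ext_def abs_le_iff)
  show "Im (ext \<zeta>) \<le> 2 * (g (Re \<zeta> + Im \<zeta> / 2) - g (Re \<zeta> - Im \<zeta> / 2))"
    using rmean_bounds[OF r, of "Re \<zeta>"] lmean_bounds[OF r, of "Re \<zeta>"] by (simp add: ext_def)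
qed

lemma Re_ext: assumes "Im \<zeta> > 0" shows "g (Re \<zeta> - Im \<zeta> / 2) \<le> Re (ext \<zeta>)" "Re (ext \<zeta>) \<le> g (Re \<zeta> + Im \<zeta> / 2)"
proof -
  have r: "Im \<zeta> / 2 > 0" using assms by simp
  have "g (Re \<zeta> - Im \<zeta> / 2) < g (Re \<zeta>)" "g (Re \<zeta>) < g (Re \<zeta> + Im \<zeta> / 2)" using r g_less by auto
  thus "g (Re \<zeta> - Im \<zeta> / 2) \<le> Re (ext \<zeta>)" "Re (ext \<zeta>) \<le> g (Re \<zeta> + Im \<zeta> / 2)"
    using rmean_bounds[OF r, of "Re \<zeta>"] lmean_bounds[OF r, of "Re \<zeta>"] by (simp_all add: ext_def)
qed

lemma ext_pi: assumes "Im \<zeta> > 0" shows "ext (\<zeta> + of_real pi) = ext \<zeta> + of_real pi"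
proof -
  have "rmean (u + pi) r = rmean u r + pi" "lmean (u + pi) r = lmean u r + pi" if "r > 0" for u r
  proof -
    have "u + pi + r = (u + r) + pi" "u + pi - r = (u - r) + pi" by simp_all
    thus "rmean (u + pi) r = rmean u r + pi" "lmean (u + pi) r = lmean u r + pi"
      using that unfolding rmean_def lmean_def by (simp_all only: prim_pi) (simp_all add: field_simps)
  qed
  thus ?thesis using assms by (simp add: ext_def complex_eq_iff)
qed

lemma ext_injective:
  assumes "Im \<zeta> > 0" "Im \<xi> > 0" "ext \<zeta> = ext \<xi>" shows "\<zeta> = \<xi>"
proof -
  have rl: "rmean (Re \<zeta>) (Im \<zeta> / 2) = rmean (Re \<xi>) (Im \<xi> / 2)" "lmean (Re \<zeta>) (Im \<zeta> / 2) = lmean (Re \<xi>) (Im \<xi> / 2)"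
    using assms(3) by (auto simp: ext_def)
  have ru: "rmean u r < rmean u' r" if "u < u'" "r > 0" for u u' r
  proof (rule DERIV_pos_imp_increasing[OF that(1)])
    fix x
    have "((\<lambda>u. rmean u r) has_real_derivative (g (x + r) - g x) / r) (at x)"
      unfolding rmean_def using that by (auto intro!: derivative_eq_intros prim_deriv')
    thus "\<exists>y. ((\<lambda>u. rmean u r) has_real_derivative y) (at x) \<and> 0 < y" using g_less[of x "x + r"] that by auto
  qed
  have lu: "lmean u r < lmean u' r" if "u < u'" "r > 0" for u u' r
    using ru[of "u - r" "u' - r" r] that by (simp add: rmean_def lmean_def)
  have rr: "rmean u r < rmean u r'" if "r < r'" "r > 0" for u r r'
  proof (rule DERIV_pos_imp_increasing[OF that(1)])
    fix x assume x: "r \<le> x"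
    have "((\<lambda>r. rmean u r) has_real_derivative (g (u + x) - rmean u x) / x) (at x)"
      unfolding rmean_def using that x by (auto intro!: derivative_eq_intros prim_deriv' simp: field_simps)
    thus "\<exists>y. ((\<lambda>r. rmean u r) has_real_derivative y) (at x) \<and> 0 < y" using rmean_bounds[of x u] x that by auto
  qed
  have lr: "lmean u r' < lmean u r" if "r < r'" "r > 0" for u r r'
  proof (rule DERIV_neg_imp_decreasing[OF that(1)])
    fix x assume x: "r \<le> x"
    have "((\<lambda>r. lmean u r) has_real_derivative (g (u - x) - lmean u x) / x) (at x)"
      unfolding lmean_def using that x by (auto intro!: derivative_eq_intros prim_deriv' simp: field_simps)
    moreover have "(g (u - x) - lmean u x) / x < 0" using lmean_bounds[of x u] x that by (intro divide_neg_pos) auto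
    ultimately show "\<exists>y. ((\<lambda>r. lmean u r) has_real_derivative y) (at x) \<and> y < 0" by blast
  qed
  have key: False if u: "Re x \<le> Re y" and ne: "x \<noteq> y" and pos: "Im x > 0" "Im y > 0"
      and eq: "rmean (Re x) (Im x / 2) = rmean (Re y) (Im y / 2)" "lmean (Re x) (Im x / 2) = lmean (Re y) (Im y / 2)" for x y
  proof (cases "Im x \<le> Im y")
    case True
    have "rmean (Re x) (Im x / 2) \<le> rmean (Re y) (Im x / 2)" using ru[of "Re x" "Re y" "Im x / 2"] u pos by (cases "Re x = Re y") auto
    moreover have "rmean (Re y) (Im x / 2) \<le> rmean (Re y) (Im y / 2)" using rr[of "Im x / 2" "Im y / 2" "Re y"] True pos by (cases "Im x = Im y") auto
    moreover have "Re x \<noteq> Re y \<or> Im x \<noteq> Im y" using ne by (auto simp: complex_eq_iff)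
    ultimately show False using eq(1) ru[of "Re x" "Re y" "Im x / 2"] rr[of "Im x / 2" "Im y / 2" "Re y"] True u pos by fastforce
  next
    case False
    have "lmean (Re x) (Im x / 2) < lmean (Re x) (Im y / 2)" using lr[of "Im y / 2" "Im x / 2" "Re x"] False pos by simp
    moreover have "lmean (Re x) (Im y / 2) \<le> lmean (Re y) (Im y / 2)" using lu[of "Re x" "Re y" "Im y / 2"] u pos by (cases "Re x = Re y") auto
    ultimately show False using eq(2) by linarith
  qed
  show ?thesis using key[of \<zeta> \<xi>] key[of \<xi> \<zeta>] rl assms(1,2) by (metis linear)
qed

lemma ext_has_derivative:
  assumes v: "v > 0"
  defines "r \<equiv> v / 2"
  obtains D where "(ext has_derivative D) (at (Complex u v))"
    "\<And>m h. 0 < m \<Longrightarrow> m \<le> (g (u + v/2) - g (u + v/8)) / (4 * v) \<Longrightarrow> m \<le> (g (u - v/8) - g (u - v/2)) / (4 * v) \<Longrightarrow> m * norm h \<le> 2 * norm (D h)"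
    "\<And>h. norm (D h) \<le> 20 * ((g (u + v/2) - g (u - v/2)) / (v/2)) * norm h"
proof -
  define pu pv qu qv where "pu = (g (u + r) - g u) / r" and "pv = (g (u + r) - rmean u r) / v"
    and "qu = (g u - g (u - r)) / r" and "qv = - (lmean u r - g (u - r)) / v"
  have r: "r > 0" using v by (simp add: r_def)
  have prim_comp: "((\<lambda>\<zeta>. prim (k \<zeta>)) has_derivative (\<lambda>h. g (k x) * k' h)) (at x)"
    if "(k has_derivative k') (at x)" for k :: "complex \<Rightarrow> real" and k' x
    using has_derivative_compose[OF that, of prim "(*) (g (k x))"] prim_deriv[of "k x"]
    unfolding has_field_derivative_def by simp
  have vr: "v = 2 * r" by (simp add: r_def)
  have dRe: "(Re has_derivative Re) (at (Complex u v))" and dIm: "((\<lambda>\<zeta>. Im \<zeta> / 2) has_derivative (\<lambda>h. Im h / 2)) (at (Complex u v))"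
    using bounded_linear_imp_has_derivative[OF bounded_linear_Re]
      bounded_linear_imp_has_derivative[OF bounded_linear_compose[OF bounded_linear_divide bounded_linear_Im]] by auto
  have R: "((\<lambda>\<zeta>. rmean (Re \<zeta>) (Im \<zeta> / 2)) has_derivative (\<lambda>h. pu * Re h + pv * Im h)) (at (Complex u v))"
  proof -
    have "((\<lambda>\<zeta>. (prim (Re \<zeta> + Im \<zeta> / 2) - prim (Re \<zeta>)) / (Im \<zeta> / 2)) has_derivative
      (\<lambda>h. ((g (u + r) * (Re h + Im h / 2) - g u * Re h) * r - (prim (u + r) - prim u) * (Im h / 2)) / (r * r))) (at (Complex u v))"
      using v by (intro has_derivative_eq_rhs[OF has_derivative_divide'[OF has_derivative_diff[OF
        prim_comp[OF has_derivative_add[OF dRe dIm]] prim_comp[OF dRe]] dIm]]) (auto simp: r_def)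
    moreover have "((g (u + r) * (Re h + Im h / 2) - g u * Re h) * r - (prim (u + r) - prim u) * (Im h / 2)) / (r * r)
        = pu * Re h + pv * Im h" for h
      using r by (simp add: pu_def pv_def rmean_def vr field_simps)
    ultimately show ?thesis unfolding rmean_def by simp
  qed
  have Q: "((\<lambda>\<zeta>. lmean (Re \<zeta>) (Im \<zeta> / 2)) has_derivative (\<lambda>h. qu * Re h + qv * Im h)) (at (Complex u v))"
  proof -
    have "((\<lambda>\<zeta>. (prim (Re \<zeta>) - prim (Re \<zeta> - Im \<zeta> / 2)) / (Im \<zeta> / 2)) has_derivative
      (\<lambda>h. ((g u * Re h - g (u - r) * (Re h - Im h / 2)) * r - (prim u - prim (u - r)) * (Im h / 2)) / (r * r))) (at (Complex u v))"
      using v by (intro has_derivative_eq_rhs[OF has_derivative_divide'[OF has_derivative_diff[OF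
        prim_comp[OF dRe] prim_comp[OF has_derivative_diff[OF dRe dIm]]] dIm]]) (auto simp: r_def)
    moreover have "((g u * Re h - g (u - r) * (Re h - Im h / 2)) * r - (prim u - prim (u - r)) * (Im h / 2)) / (r * r)
        = qu * Re h + qv * Im h" for h
      using r by (simp add: qu_def qv_def lmean_def vr field_simps)
    ultimately show ?thesis unfolding lmean_def by simp
  qed
  define D where "D h = Complex (((pu * Re h + pv * Im h) + (qu * Re h + qv * Im h)) / 2)
      (2 * ((pu * Re h + pv * Im h) - (qu * Re h + qv * Im h)))" for h
  have "((\<lambda>\<zeta>. of_real ((rmean (Re \<zeta>) (Im \<zeta> / 2) + lmean (Re \<zeta>) (Im \<zeta> / 2)) / 2)
      + \<i> * of_real (2 * (rmean (Re \<zeta>) (Im \<zeta> / 2) - lmean (Re \<zeta>) (Im \<zeta> / 2)))) has_derivative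
      (\<lambda>h. of_real (((pu * Re h + pv * Im h) + (qu * Re h + qv * Im h)) / 2)
      + \<i> * of_real (2 * ((pu * Re h + pv * Im h) - (qu * Re h + qv * Im h))))) (at (Complex u v))"
    by (intro has_derivative_add has_derivative_mult_right has_derivative_diff R Q
      bounded_linear.has_derivative[OF bounded_linear_of_real] bounded_linear.has_derivative[OF bounded_linear_divide])
  hence der: "(ext has_derivative D) (at (Complex u v))" by (simp only: ext_def[abs_def] Complex_eq D_def[abs_def])
  have le1: "pv \<le> pu" "- qv \<le> qu"
  proof -
    have "pv \<le> (g (u + r) - g u) / v" unfolding pv_def using rmean_bounds[OF r, of u] v by (intro divide_right_mono) auto
    also have "\<dots> \<le> pu" unfolding pu_def using v g_le[of u "u + r"] r by (intro divide_left_mono) (auto simp: r_def)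
    finally show "pv \<le> pu" .
    have "- qv \<le> (g u - g (u - r)) / v" unfolding qv_def minus_divide_left minus_minus
      using lmean_bounds[OF r, of u] v by (intro divide_right_mono) auto
    also have "\<dots> \<le> qu" unfolding qu_def using v g_le[of "u - r" u] r by (intro divide_left_mono) (auto simp: r_def)
    finally show "- qv \<le> qu" .
  qed
  have gap: "(g (u + v/2) - g (u + v/8)) / (4 * v) \<le> pv" "(g (u - v/8) - g (u - v/2)) / (4 * v) \<le> - qv"
  proof -
    have "(g (u + v/2) - g (u + v/8)) / (4 * v) = ((g (u + r) - g (u + r/4)) / 4) / v" by (simp add: r_def)
    also have "\<dots> \<le> pv" unfolding pv_def using rmean_gap[OF r, of u] v by (intro divide_right_mono) auto
    finally show "(g (u + v/2) - g (u + v/8)) / (4 * v) \<le> pv" .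
    have "(g (u - v/8) - g (u - v/2)) / (4 * v) = ((g (u - r/4) - g (u - r)) / 4) / v" by (simp add: r_def)
    also have "\<dots> \<le> - qv" unfolding qv_def minus_divide_left minus_minus
      using lmean_gap[OF r, of u] v by (intro divide_right_mono) auto
    finally show "(g (u - v/8) - g (u - v/2)) / (4 * v) \<le> - qv" .
  qed
  have gpos: "g (u + v/2) - g (u + v/8) > 0" "g (u - v/8) - g (u - v/2) > 0" using v by (auto intro!: g_less)
  have M: "pu \<le> (g (u + v/2) - g (u - v/2)) / (v/2)" "qu \<le> (g (u + v/2) - g (u - v/2)) / (v/2)"
    unfolding pu_def qu_def using v r g_le[of u "u + r"] g_le[of "u - r" u]
    by (auto simp: r_def intro!: divide_right_mono)
  have D_eq: "D h = Complex (((pu * Re h + pv * Im h) + (qu * Re h + qv * Im h)) / 2) (2 * ((pu * Re h + pv * Im h) - (qu * Re h + qv * Im h)))" for h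
    by (simp add: D_def)
  show thesis
  proof (rule that[OF der])
    fix m h assume m: "0 < m" "m \<le> (g (u + v/2) - g (u + v/8)) / (4 * v)" "m \<le> (g (u - v/8) - g (u - v/2)) / (4 * v)"
    have "m * norm (Complex (Re h) (Im h)) \<le> 2 * norm (D h)"
      unfolding D_eq using m gap le1 M by (intro shear_bounds(1)) auto
    thus "m * norm h \<le> 2 * norm (D h)" by simp
  next
    fix h
    define m where "m = min pv (- qv)"
    have "0 < (g (u + v/2) - g (u + v/8)) / (4 * v)" "0 < (g (u - v/8) - g (u - v/2)) / (4 * v)" using gpos v by auto
    hence "m > 0" using gap by (simp add: m_def)
    hence "norm (D h) \<le> 20 * ((g (u + v/2) - g (u - v/2)) / (v/2)) * norm (Complex (Re h) (Im h))"
      unfolding D_eq using le1 M by (intro shear_bounds(2)[where m = m]) (auto simp: m_def)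
    thus "norm (D h) \<le> 20 * ((g (u + v/2) - g (u - v/2)) / (v/2)) * norm h" by simp
  qed
qed

end

lemma exp_times_exp_minus: "exp (x::real) * exp (- x) = 1"
  by (simp flip: exp_add)

context conformal_side begin

lemma lift_ball:
  assumes "0 < \<rho>" "\<rho> \<le> v" "\<rho> \<le> 3"
  shows "ball (Complex u v) \<rho> \<subseteq> \<H>" "inj_on \<Theta> (ball (Complex u v) \<rho>)"
proof -
  have near: "\<bar>Re x - u\<bar> < \<rho>" "\<bar>Im x - v\<bar> < \<rho>" if "x \<in> ball (Complex u v) \<rho>" for x
  proof -
    have "norm (x - Complex u v) < \<rho>" using that by (simp add: dist_norm norm_minus_commute)
    thus "\<bar>Re x - u\<bar> < \<rho>" "\<bar>Im x - v\<bar> < \<rho>"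
      using abs_Re_le_cmod[of "x - Complex u v"] abs_Im_le_cmod[of "x - Complex u v"] by simp_all
  qed
  show sub: "ball (Complex u v) \<rho> \<subseteq> \<H>" using near(2) assms(2) by force
  show "inj_on \<Theta> (ball (Complex u v) \<rho>)"
  proof (rule inj_onI)
    fix x y assume x: "x \<in> ball (Complex u v) \<rho>" and y: "y \<in> ball (Complex u v) \<rho>" and eq: "\<Theta> x = \<Theta> y"
    obtain n :: int where n: "x = y + of_real (2 * pi * of_int n)" using lift_eq[OF _ _ eq] sub x y by blast
    have "Re x - Re y = 2 * pi * of_int n" using n by simp
    hence "\<bar>2 * pi * of_int n\<bar> < 6" using near(1)[OF x] near(1)[OF y] assms(3) by linarith
    hence "pi * \<bar>real_of_int n\<bar> < 3" by (simp add: abs_mult)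
    moreover have "3 * \<bar>real_of_int n\<bar> \<le> pi * \<bar>real_of_int n\<bar>" using pi_gt3 by (intro mult_right_mono) auto
    ultimately have "\<bar>real_of_int n\<bar> < 1" by linarith
    hence "n = 0" by linarith
    thus "x = y" using n by simp
  qed
qed

lemma lift_Koebe:
  assumes "0 < \<rho>" "\<rho> \<le> v" "\<rho> \<le> 3" "y \<notin> \<Theta> ` \<H>"
  shows "norm (deriv \<Theta> (Complex u v)) * \<rho> \<le> 20 * norm (\<Theta> (Complex u v) - y)"
  using lift_ball[OF assms(1-3), of u] assms(4)
  by (intro weak_Koebe assms(1)) (auto intro: holomorphic_on_subset[OF lift_hol])

lemma upper_rate:
  assumes v: "v > 0"
  shows "exp (\<sigma> * v) * (l * ((g (u + v/2) - g (u - v/2)) / (v/2))) \<le> 20000 * C0 * norm (deriv \<Theta> (Complex u v))"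
proof -
  define n where "n = norm (deriv \<Theta> (Complex u v))"
  define D where "D = g (u + v/2) - g (u - v/2)"
  have n0: "n \<ge> 0" by (simp add: n_def)
  have Cn: "C0 * n \<ge> 0" using n0 C0_pos by simp
  show ?thesis
  proof (cases "v \<le> 3/2")
    case True
    have "l * D \<le> 2 * pi * C0 * delta u v" unfolding D_def by (rule window_increment_le[OF v True])
    also have "\<dots> \<le> 2 * pi * C0 * (18 * v * n)"
      using delta_le_deriv[OF v True, of u] C0_pos by (intro mult_left_mono) (auto simp: n_def)
    also have "\<dots> = (72 * pi * (C0 * n)) * (v / 2)" by simp
    finally have "l * D / (v/2) \<le> 72 * pi * (C0 * n)" using v by (simp only: pos_divide_le_eq half_gt_zero_iff)
    also have "\<dots> \<le> 72 * 4 * (C0 * n)" using pi_less_4 Cn by (intro mult_right_mono) auto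
    finally have a: "l * (D / (v/2)) \<le> 288 * (C0 * n)" by simp
    have e: "exp (\<sigma> * v) \<le> 3 ^ 2" using sigma True v by (intro exp_le_3_power) auto
    have "D \<ge> 0" unfolding D_def using g_le[of "u - v/2" "u + v/2"] v by simp
    hence "0 \<le> l * (D / (v/2))" using l_pos v by simp
    hence "exp (\<sigma> * v) * (l * (D / (v/2))) \<le> 3 ^ 2 * (288 * (C0 * n))"
      using mult_mono[OF e a] by simp
    also have "\<dots> \<le> 20000 * (C0 * n)" using Cn by simp
    finally show ?thesis unfolding n_def D_def by (simp only: mult.assoc)
  next
    case False
    have e: "u + v/2 = (u - v/2) + v" by simp
    have "0 \<le> v" using v by simp
    hence "D \<le> v + pi" unfolding D_def e by (rule g_increment(2))
    also have "\<dots> \<le> 7 * (v / 2)" using False pi_le by simp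
    finally have "D / (v/2) \<le> 7" using v by (simp add: pos_divide_le_eq)
    hence "exp (\<sigma> * v) * (l * (D / (v/2))) \<le> exp (\<sigma> * v) * (l * 7)" using l_pos by (intro mult_left_mono) auto
    also have "\<dots> = 7 * (l * exp (\<sigma> * v))" by simp
    also have "\<dots> \<le> 7 * (2430 * C0 * n)" using deriv_lower[of v u] False by (intro mult_left_mono) (auto simp: n_def)
    also have "\<dots> \<le> 20000 * (C0 * n)" using Cn by simp
    finally show ?thesis unfolding n_def D_def by (simp only: mult.assoc)
  qed
qed

lemma lower_rate_near:
  assumes v: "0 < v" "v \<le> 9" and ab: "arctan b - arctan a \<ge> pi / 10"
    and D: "\<And>t. u + a * v \<le> t \<Longrightarrow> t \<le> u + b * v \<Longrightarrow> \<bar>g t - g s\<bar> \<le> D"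
  shows "norm (deriv \<Theta> (Complex u v)) \<le> 5 * 10 ^ 6 * C0 * L * exp (\<sigma> * v) * (D / (4 * v))"
proof -
  define w n where "w = \<Theta> (Complex u v)" and "n = norm (deriv \<Theta> (Complex u v))"
  obtain p where p: "p \<in> \<Gamma>" "norm (bdry s - p) \<ge> radius" "p \<noteq> bdry s" using far_point[OF bdry_in_curve] by blast
  obtain t where t: "u + a * v \<le> t" "t \<le> u + b * v"
      "norm (bdry t - w) * norm (p - bdry s) \<le> C0 * norm (w - p) * norm (bdry t - bdry s)"
    using cross_ratio[OF v(1) p(1) bdry_in_curve p(3) ab] unfolding w_def by metis
  have LD: "norm (bdry t - bdry s) \<le> L * D"
    using bdry_upper[of t s] mult_left_mono[OF D[OF t(1,2)], of L] L_pos by linarith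
  have wp: "norm (w - p) \<le> radius * (19684 * exp (\<sigma> * v))"
  proof -
    have "exp (- (\<sigma> * v)) \<le> 3 ^ 9" using sigma v by (intro exp_le_3_power) auto
    hence "exp (\<sigma> * v) * exp (- (\<sigma> * v)) \<le> exp (\<sigma> * v) * 19683" by (intro mult_left_mono) auto
    hence "1 \<le> 19683 * exp (\<sigma> * v)" by (simp add: exp_times_exp_minus mult.commute)
    hence "radius * (exp (\<sigma> * v) + 1) \<le> radius * (19684 * exp (\<sigma> * v))" using radius_pos by (intro mult_left_mono) auto
    moreover have "norm (w - p) \<le> radius * exp (\<sigma> * v) + radius"
      using norm_triangle_ineq4[of w p] growth[of "Complex u v"] norm_curve_le[OF p(1)] v by (simp add: w_def)
    ultimately show ?thesis by (simp add: distrib_left)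
  qed
  have "delta u v * radius \<le> norm (bdry t - w) * norm (p - bdry s)"
    using delta_le[OF bdry_in_curve, of u v t] p(2) radius_pos delta_nonneg
    by (intro mult_mono) (auto simp: w_def norm_minus_commute)
  also have "\<dots> \<le> C0 * norm (w - p) * norm (bdry t - bdry s)" by (rule t(3))
  also have "\<dots> \<le> C0 * (radius * (19684 * exp (\<sigma> * v))) * (L * D)"
    using wp LD C0_pos radius_pos by (intro mult_mono) auto
  also have "\<dots> = (19684 * C0 * L * exp (\<sigma> * v) * D) * radius" by simp
  finally have d: "delta u v \<le> 19684 * C0 * L * exp (\<sigma> * v) * D" using radius_pos by simp
  obtain y where y: "y \<in> \<Gamma>" "norm (w - y) = delta u v" using delta_attained unfolding w_def by blast
  have "n * (v/3) \<le> 20 * norm (w - y)"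
    unfolding n_def w_def using v y(1) lift_off by (intro lift_Koebe) auto
  hence "n * (v/3) \<le> 20 * (19684 * C0 * L * exp (\<sigma> * v) * D)" using y(2) d by linarith
  hence "n * v \<le> 1181040 * (C0 * L * exp (\<sigma> * v) * D)" by simp
  also have "\<dots> \<le> 1250000 * (C0 * L * exp (\<sigma> * v) * D)"
  proof -
    have "D \<ge> 0" using D[OF t(1,2)] by linarith
    hence "C0 * L * exp (\<sigma> * v) * D \<ge> 0" using C0_pos L_pos by simp
    thus ?thesis by (intro mult_right_mono) auto
  qed
  finally have "n \<le> 1250000 * (C0 * L * exp (\<sigma> * v) * D) / v" using v by (simp add: pos_le_divide_eq)
  also have "\<dots> = 5 * 10 ^ 6 * C0 * L * exp (\<sigma> * v) * (D / (4 * v))" using v by (simp add: field_simps)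
  finally show ?thesis by (simp only: n_def)
qed

lemma lower_rate_far:
  assumes v: "9 \<le> v" and D: "3 * v / 8 - pi \<le> D"
  shows "norm (deriv \<Theta> (Complex u v)) \<le> 5 * 10 ^ 6 * C0 * L * exp (\<sigma> * v) * (D / (4 * v))"
proof -
  define n where "n = norm (deriv \<Theta> (Complex u v))"
  have "n * 3 \<le> 20 * norm (\<Theta> (Complex u v) - 0)"
    unfolding n_def using v lift_nonzero by (intro lift_Koebe) auto
  also have "\<dots> \<le> 20 * (radius * exp (\<sigma> * v))" using growth[of "Complex u v"] v by simp
  also have "\<dots> \<le> 20 * (L * exp (\<sigma> * v))" using radius_bounds by (intro mult_left_mono mult_right_mono) auto
  finally have "n * 3 \<le> 20 * (L * exp (\<sigma> * v))" .
  moreover have "0 \<le> L * exp (\<sigma> * v)" using L_pos by simp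
  ultimately have "n \<le> 7 * (L * exp (\<sigma> * v))" by linarith
  also have "\<dots> \<le> (5 * 10 ^ 6 * C0 * (1 / 160)) * (L * exp (\<sigma> * v))"
    using L_pos by (intro mult_right_mono) (auto simp: C0_def)
  also have "\<dots> = 5 * 10 ^ 6 * C0 * L * exp (\<sigma> * v) * (1 / 160)" by simp
  also have "\<dots> \<le> 5 * 10 ^ 6 * C0 * L * exp (\<sigma> * v) * (D / (4 * v))"
  proof (intro mult_left_mono)
    have "4 * v \<le> 160 * (3 * v / 8 - pi)" using v pi_le by simp
    hence "4 * v \<le> 160 * D" using D by argo
    thus "1 / 160 \<le> D / (4 * v)" using v by (simp add: pos_le_divide_eq)
  qed (use C0_pos L_pos in auto)
  finally show ?thesis by (simp add: n_def)
qed

lemma lower_rate: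
  assumes v: "v > 0"
  shows "norm (deriv \<Theta> (Complex u v)) \<le> 5 * 10 ^ 6 * C0 * L * exp (\<sigma> * v) * ((g (u + v/2) - g (u + v/8)) / (4 * v))"
    "norm (deriv \<Theta> (Complex u v)) \<le> 5 * 10 ^ 6 * C0 * L * exp (\<sigma> * v) * ((g (u - v/8) - g (u - v/2)) / (4 * v))"
proof -
  show "norm (deriv \<Theta> (Complex u v)) \<le> 5 * 10 ^ 6 * C0 * L * exp (\<sigma> * v) * ((g (u + v/2) - g (u + v/8)) / (4 * v))"
  proof (cases "v \<le> 9")
    case True
    have "arctan (1/2) - arctan (1/8) \<ge> pi / 10" by (rule arctan_diff_ge) auto
    thus ?thesis
    proof (rule lower_rate_near[OF v True, where s = "u + v/8"])
      fix t assume "u + 1/8 * v \<le> t" "t \<le> u + 1/2 * v"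
      hence "g (u + v/8) \<le> g t" "g t \<le> g (u + v/2)" using g_le by auto
      thus "\<bar>g t - g (u + v/8)\<bar> \<le> g (u + v/2) - g (u + v/8)" by simp
    qed
  next
    case False
    have e: "u + v/2 = (u + v/8) + 3 * v / 8" by simp
    have nn: "0 \<le> 3 * v / 8" using v by simp
    have "3 * v / 8 - pi \<le> g (u + v/2) - g (u + v/8)" using g_increment(1)[OF nn, of "u + v/8"] by (simp only: e)
    thus ?thesis using False by (intro lower_rate_far) auto
  qed
  show "norm (deriv \<Theta> (Complex u v)) \<le> 5 * 10 ^ 6 * C0 * L * exp (\<sigma> * v) * ((g (u - v/8) - g (u - v/2)) / (4 * v))"
  proof (cases "v \<le> 9")
    case True
    have "arctan (- 1/8) - arctan (- 1/2) \<ge> pi / 10" by (rule arctan_diff_ge) auto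
    thus ?thesis
    proof (rule lower_rate_near[OF v True, where s = "u - v/8"])
      fix t assume "u + - 1/2 * v \<le> t" "t \<le> u + - 1/8 * v"
      hence "g (u - v/2) \<le> g t" "g t \<le> g (u - v/8)" using g_le by auto
      thus "\<bar>g t - g (u - v/8)\<bar> \<le> g (u - v/8) - g (u - v/2)" by simp
    qed
  next
    case False
    have e: "u - v/8 = (u - v/2) + 3 * v / 8" by simp
    have nn: "0 \<le> 3 * v / 8" using v by simp
    have "3 * v / 8 - pi \<le> g (u - v/8) - g (u - v/2)" using g_increment(1)[OF nn, of "u - v/2"] by (simp only: e)
    thus ?thesis using False by (intro lower_rate_far) auto
  qed
qed

lemma deriv_lift_nonzero: assumes "Im \<zeta> > 0" shows "deriv \<Theta> \<zeta> \<noteq> 0"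
proof
  assume "deriv \<Theta> \<zeta> = 0"
  hence "norm (J (exp (\<i> * \<zeta>))) = 0" using J_lift[OF assms] by simp
  thus False using J_nonzero[of "exp (\<i> * \<zeta>)"] assms by (simp add: norm_exp_i)
qed

definition param :: "complex \<Rightarrow> complex" where
  "param \<zeta> = exp (Complex (\<sigma> * Im (ext \<zeta>)) (Re (ext \<zeta>)))"

lemma norm_param: "norm (param \<zeta>) = exp (\<sigma> * Im (ext \<zeta>))" by (simp add: param_def norm_exp_eq_Re)

lemma norm_param_bounds:
  assumes "Im \<zeta> > 0" shows "norm (param \<zeta>) \<le> 3 ^ 7 * exp (\<sigma> * Im \<zeta>)" "exp (\<sigma> * Im \<zeta>) \<le> 3 ^ 7 * norm (param \<zeta>)"
proof -
  have "2 * pi \<le> real 7" using pi_le by simp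
  hence e: "exp (2 * pi) \<le> 3 ^ 7" by (rule exp_le_3_power)
  have b: "\<bar>Im (ext \<zeta>) - Im \<zeta>\<bar> \<le> 2 * pi" by (rule Im_ext(2)[OF assms])
  have "\<sigma> * Im (ext \<zeta>) \<le> 2 * pi + \<sigma> * Im \<zeta>" "\<sigma> * Im \<zeta> \<le> 2 * pi + \<sigma> * Im (ext \<zeta>)"
    using sigma b by (auto simp: abs_le_iff)
  hence "exp (\<sigma> * Im (ext \<zeta>)) \<le> exp (2 * pi + \<sigma> * Im \<zeta>)" "exp (\<sigma> * Im \<zeta>) \<le> exp (2 * pi + \<sigma> * Im (ext \<zeta>))" by simp_all
  moreover have "exp (2 * pi + x) \<le> 3 ^ 7 * exp x" for x unfolding exp_add using e by (intro mult_right_mono) auto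
  ultimately show "norm (param \<zeta>) \<le> 3 ^ 7 * exp (\<sigma> * Im \<zeta>)" "exp (\<sigma> * Im \<zeta>) \<le> 3 ^ 7 * norm (param \<zeta>)"
    unfolding norm_param by (meson order_trans)+
qed

lemma param_pi: assumes "Im \<zeta> > 0" shows "param (\<zeta> + of_real pi) = - param \<zeta>"
proof -
  have "Complex (\<sigma> * Im (ext \<zeta>)) (Re (ext \<zeta>) + pi) = Complex (\<sigma> * Im (ext \<zeta>)) (Re (ext \<zeta>)) + of_real pi * \<i>"
    by (simp add: complex_eq_iff)
  thus ?thesis unfolding param_def ext_pi[OF assms] by (simp add: exp_add exp_pi_i)
qed

lemma shift_int:
  assumes "Im \<zeta> > 0"
  shows "\<Theta> (\<zeta> + of_real (2 * pi * of_int n)) = \<Theta> \<zeta>" "ext (\<zeta> + of_real (2 * pi * of_int n)) = ext \<zeta> + of_real (2 * pi * of_int n)"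
proof -
  have two: "\<Theta> (\<xi> + of_real (2 * pi)) = \<Theta> \<xi>" "ext (\<xi> + of_real (2 * pi)) = ext \<xi> + of_real (2 * pi)" if "Im \<xi> > 0" for \<xi>
  proof -
    have e: "x + of_real (2 * pi) = (x + of_real pi) + of_real pi" for x :: complex by simp
    have "Im (\<xi> + of_real pi) > 0" using that by simp
    thus "\<Theta> (\<xi> + of_real (2 * pi)) = \<Theta> \<xi>" "ext (\<xi> + of_real (2 * pi)) = ext \<xi> + of_real (2 * pi)"
      using that by (simp_all only: e lift_pi ext_pi minus_minus)
  qed
  have nat: "\<Theta> (\<xi> + of_real (2 * pi * real n)) = \<Theta> \<xi> \<and> ext (\<xi> + of_real (2 * pi * real n)) = ext \<xi> + of_real (2 * pi * real n)"
    if "Im \<xi> > 0" for \<xi> n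
  proof (induction n)
    case (Suc n)
    have e: "\<xi> + of_real (2 * pi * real (Suc n)) = (\<xi> + of_real (2 * pi * real n)) + of_real (2 * pi)" by (simp add: algebra_simps)
    have "Im (\<xi> + of_real (2 * pi * real n)) > 0" using that by simp
    hence "\<Theta> (\<xi> + of_real (2 * pi * real (Suc n))) = \<Theta> (\<xi> + of_real (2 * pi * real n))"
      "ext (\<xi> + of_real (2 * pi * real (Suc n))) = ext (\<xi> + of_real (2 * pi * real n)) + of_real (2 * pi)"
      unfolding e by (fact two)+
    thus ?case using Suc by (simp add: algebra_simps)
  qed simp
  have "\<Theta> (\<zeta> + of_real (2 * pi * of_int n)) = \<Theta> \<zeta> \<and> ext (\<zeta> + of_real (2 * pi * of_int n)) = ext \<zeta> + of_real (2 * pi * of_int n)"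
  proof (cases "n \<ge> 0")
    case True
    thus ?thesis using nat[OF assms, of "nat n"] by simp
  next
    case False
    have "Im (\<zeta> + of_real (2 * pi * of_int n)) > 0" using assms by simp
    from nat[OF this, of "nat (- n)"] False show ?thesis by (simp add: algebra_simps)
  qed
  thus "\<Theta> (\<zeta> + of_real (2 * pi * of_int n)) = \<Theta> \<zeta>" "ext (\<zeta> + of_real (2 * pi * of_int n)) = ext \<zeta> + of_real (2 * pi * of_int n)"
    by blast+
qed

lemma param_eq_iff:
  assumes "Im \<zeta> > 0" "Im \<xi> > 0" shows "param \<zeta> = param \<xi> \<longleftrightarrow> \<Theta> \<zeta> = \<Theta> \<xi>"
proof
  assume "\<Theta> \<zeta> = \<Theta> \<xi>"
  then obtain n :: int where n: "\<zeta> = \<xi> + of_real (2 * pi * of_int n)" using lift_eq[OF assms] by blast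
  have "ext \<zeta> = ext \<xi> + of_real (2 * pi * of_int n)" unfolding n by (rule shift_int(2)[OF assms(2)])
  hence "Complex (\<sigma> * Im (ext \<zeta>)) (Re (ext \<zeta>)) = Complex (\<sigma> * Im (ext \<xi>)) (Re (ext \<xi>)) + of_real (of_int (2 * n) * pi) * \<i>"
    by (simp add: complex_eq_iff)
  thus "param \<zeta> = param \<xi>" unfolding param_def exp_eq by blast
next
  assume "param \<zeta> = param \<xi>"
  then obtain n :: int where "Complex (\<sigma> * Im (ext \<zeta>)) (Re (ext \<zeta>)) = Complex (\<sigma> * Im (ext \<xi>)) (Re (ext \<xi>)) + of_real (of_int (2 * n) * pi) * \<i>"
    unfolding param_def exp_eq by blast
  hence "\<sigma> * Im (ext \<zeta>) = \<sigma> * Im (ext \<xi>)" and re: "Re (ext \<zeta>) = Re (ext \<xi>) + 2 * pi * of_int n"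
    by (simp_all add: complex_eq_iff)
  hence "Im (ext \<zeta>) = Im (ext \<xi>)" using sigma by (metis mult_cancel_left mult_minus1 neg_equal_iff_equal mult_1)
  hence "ext \<zeta> = ext \<xi> + of_real (2 * pi * of_int n)" using re by (simp add: complex_eq_iff)
  also have "\<dots> = ext (\<xi> + of_real (2 * pi * of_int n))" by (rule shift_int(2)[OF assms(2), symmetric])
  finally have "ext \<zeta> = ext (\<xi> + of_real (2 * pi * of_int n))" .
  moreover have "Im (\<xi> + of_real (2 * pi * of_int n)) > 0" using assms(2) by simp
  ultimately have "\<zeta> = \<xi> + of_real (2 * pi * of_int n)" using ext_injective[OF assms(1)] by blast
  thus "\<Theta> \<zeta> = \<Theta> \<xi>" using shift_int(1)[OF assms(2)] by simp
qed

definition side_map :: "complex \<Rightarrow> complex" where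
  "side_map w = param (SOME \<zeta>. 0 < Im \<zeta> \<and> \<Theta> \<zeta> = w)"

lemma side_map_lift: assumes "Im \<zeta> > 0" shows "side_map (\<Theta> \<zeta>) = param \<zeta>"
proof -
  have "0 < Im (SOME \<xi>. 0 < Im \<xi> \<and> \<Theta> \<xi> = \<Theta> \<zeta>) \<and> \<Theta> (SOME \<xi>. 0 < Im \<xi> \<and> \<Theta> \<xi> = \<Theta> \<zeta>) = \<Theta> \<zeta>"
    by (rule someI[of _ \<zeta>]) (use assms in simp)
  thus ?thesis unfolding side_map_def using param_eq_iff assms by blast
qed

lemma side_map_derivative:
  assumes "Im \<zeta> > 0"
  obtains D where "(side_map has_derivative D) (at (\<Theta> \<zeta>))"
    "\<And>h. norm h \<le> 10 ^ 27 * L * norm (D h)" "\<And>h. l * norm (D h) \<le> 10 ^ 23 * norm h"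
proof -
  define u v where "u = Re \<zeta>" and "v = Im \<zeta>"
  have \<zeta>: "\<zeta> = Complex u v" and v: "v > 0" using assms by (auto simp: u_def v_def)
  define c where "c = deriv \<Theta> \<zeta>"
  have c: "c \<noteq> 0" unfolding c_def by (rule deriv_lift_nonzero[OF assms])
  define \<rho> where "\<rho> = min v 3"
  have \<rho>: "0 < \<rho>" "\<rho> \<le> v" "\<rho> \<le> 3" using v by (auto simp: \<rho>_def)
  note ball = lift_ball[OF \<rho>, of u, folded \<zeta>]
  have holb: "\<Theta> holomorphic_on ball \<zeta> \<rho>" using lift_hol ball(1) by (rule holomorphic_on_subset)
  obtain k where k: "k holomorphic_on \<Theta> ` ball \<zeta> \<rho>" "\<And>z. z \<in> ball \<zeta> \<rho> \<Longrightarrow> deriv \<Theta> z * deriv k (\<Theta> z) = 1"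
      "\<And>z. z \<in> ball \<zeta> \<rho> \<Longrightarrow> k (\<Theta> z) = z"
    using holomorphic_has_inverse[OF holb open_ball ball(2)] by metis
  have op: "open (\<Theta> ` ball \<zeta> \<rho>)" using open_mapping_thm3[OF holb open_ball ball(2)] .
  have \<zeta>b: "\<zeta> \<in> ball \<zeta> \<rho>" using \<rho> by simp
  have "(k has_field_derivative deriv k (\<Theta> \<zeta>)) (at (\<Theta> \<zeta>))"
    using k(1) op \<zeta>b by (intro holomorphic_derivI[of _ "\<Theta> ` ball \<zeta> \<rho>"]) auto
  moreover have "deriv k (\<Theta> \<zeta>) = 1 / c" using k(2)[OF \<zeta>b] c by (simp add: c_def field_simps)
  ultimately have "(k has_derivative (*) (1 / c)) (at (\<Theta> \<zeta>))" unfolding has_field_derivative_def by simp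
  moreover have "(*) (1 / c) = (\<lambda>h. h / c)" by (simp add: fun_eq_iff)
  ultimately have dk: "(k has_derivative (\<lambda>h. h / c)) (at (\<Theta> \<zeta>))" by metis
  obtain E where E: "(ext has_derivative E) (at \<zeta>)"
    "\<And>m h. 0 < m \<Longrightarrow> m \<le> (g (u + v/2) - g (u + v/8)) / (4 * v) \<Longrightarrow> m \<le> (g (u - v/8) - g (u - v/2)) / (4 * v) \<Longrightarrow> m * norm h \<le> 2 * norm (E h)"
    "\<And>h. norm (E h) \<le> 20 * ((g (u + v/2) - g (u - v/2)) / (v/2)) * norm h"
    using ext_has_derivative[OF v, of u] unfolding \<zeta> by blast
  have swap: "Complex (\<sigma> * Im z) (Re z) = of_real (\<sigma> * Im z) + \<i> * of_real (Re z)" for z by (simp add: complex_eq_iff)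
  have "((\<lambda>x. of_real (\<sigma> * Im (ext x)) + \<i> * of_real (Re (ext x))) has_derivative (\<lambda>h. of_real (\<sigma> * Im (E h)) + \<i> * of_real (Re (E h)))) (at \<zeta>)"
    by (intro has_derivative_add has_derivative_mult_right bounded_linear.has_derivative[OF bounded_linear_of_real]
      bounded_linear.has_derivative[OF bounded_linear_Re] bounded_linear.has_derivative[OF bounded_linear_Im] E(1))
  hence "((\<lambda>x. Complex (\<sigma> * Im (ext x)) (Re (ext x))) has_derivative (\<lambda>h. Complex (\<sigma> * Im (E h)) (Re (E h)))) (at \<zeta>)"
    by (simp only: swap)
  hence dp: "(param has_derivative (\<lambda>h. param \<zeta> * Complex (\<sigma> * Im (E h)) (Re (E h)))) (at \<zeta>)"
    unfolding param_def[abs_def] by (rule has_derivative_compose) (rule DERIV_exp[unfolded has_field_derivative_def])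
  have "((\<lambda>w. param (k w)) has_derivative (\<lambda>h. param \<zeta> * Complex (\<sigma> * Im (E (h / c))) (Re (E (h / c))))) (at (\<Theta> \<zeta>))"
    using has_derivative_compose[OF dk, of param] dp k(3)[OF \<zeta>b] by simp
  hence der: "(side_map has_derivative (\<lambda>h. param \<zeta> * Complex (\<sigma> * Im (E (h / c))) (Re (E (h / c))))) (at (\<Theta> \<zeta>))"
  proof (rule has_derivative_transform_within_open[OF _ op])
    show "\<Theta> \<zeta> \<in> \<Theta> ` ball \<zeta> \<rho>" using \<zeta>b by blast
    fix w assume "w \<in> \<Theta> ` ball \<zeta> \<rho>"
    then obtain x where x: "x \<in> ball \<zeta> \<rho>" "w = \<Theta> x" by blast
    thus "param (k w) = side_map w" using k(3) side_map_lift[of x] ball(1) by auto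
  qed
  define s where "s = exp (\<sigma> * v)"
  have s: "s > 0" by (simp add: s_def)
  have nD: "norm (param \<zeta> * Complex (\<sigma> * Im (E (h / c))) (Re (E (h / c)))) = norm (param \<zeta>) * norm (E (h / c))" for h
  proof -
    have "norm (Complex (\<sigma> * Im x) (Re x)) = norm x" for x using sigma by (auto simp: cmod_def add.commute)
    thus ?thesis by (simp add: norm_mult)
  qed
  have pb: "norm (param \<zeta>) \<le> 2187 * s" "s \<le> 2187 * norm (param \<zeta>)"
    using norm_param_bounds[OF assms] by (simp_all add: s_def v_def)
  show thesis
  proof (rule that[OF der])
    fix h
    define K where "K = 5 * 10 ^ 6 * C0 * L * s"
    have K: "K > 0" using C0_pos L_pos s by (simp add: K_def)
    have "norm c / K * norm (h / c) \<le> 2 * norm (E (h / c))"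
    proof (rule E(2))
      show "0 < norm c / K" using c K by simp
      show "norm c / K \<le> (g (u + v/2) - g (u + v/8)) / (4 * v)" "norm c / K \<le> (g (u - v/8) - g (u - v/2)) / (4 * v)"
        using lower_rate[OF v, of u] K unfolding \<zeta>[symmetric] c_def[symmetric] s_def[symmetric] K_def[symmetric]
        by (simp_all only: pos_divide_le_eq mult.commute)
    qed
    hence "norm h / K \<le> 2 * norm (E (h / c))" using c by (simp add: norm_divide)
    hence "norm h \<le> 2 * norm (E (h / c)) * K" using K by (simp only: pos_divide_le_eq)
    also have "\<dots> = 10 ^ 7 * C0 * L * norm (E (h / c)) * s" by (simp add: K_def)
    also have "\<dots> \<le> 10 ^ 7 * C0 * L * norm (E (h / c)) * (2187 * norm (param \<zeta>))"
      using pb(2) C0_pos L_pos by (intro mult_left_mono) auto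
    also have "\<dots> = (10 ^ 7 * C0 * 2187) * (L * (norm (param \<zeta>) * norm (E (h / c))))" by simp
    also have "\<dots> \<le> 10 ^ 27 * (L * (norm (param \<zeta>) * norm (E (h / c))))"
      using L_pos by (intro mult_right_mono) (auto simp: C0_def)
    finally show "norm h \<le> 10 ^ 27 * L * norm (param \<zeta> * Complex (\<sigma> * Im (E (h / c))) (Re (E (h / c))))"
      unfolding nD by (simp only: mult.assoc)
  next
    fix h
    define M where "M = (g (u + v/2) - g (u - v/2)) / (v/2)"
    have M: "M \<ge> 0" unfolding M_def using v g_le[of "u - v/2" "u + v/2"] by simp
    have "l * (norm (param \<zeta>) * norm (E (h / c))) \<le> l * ((2187 * s) * (20 * M * norm (h / c)))"
      using pb(1) E(3)[of "h / c"] l_pos s M unfolding M_def[symmetric] by (intro mult_left_mono mult_mono) auto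
    also have "\<dots> = (43740 * norm (h / c)) * (s * (l * M))" by simp
    also have "\<dots> \<le> (43740 * norm (h / c)) * (20000 * C0 * norm c)"
      using upper_rate[OF v, of u] unfolding \<zeta>[symmetric] c_def[symmetric] s_def[symmetric] M_def[symmetric]
      by (intro mult_left_mono) auto
    also have "\<dots> = (43740 * 20000 * C0) * norm h" using c by (simp add: norm_divide)
    also have "\<dots> \<le> 10 ^ 23 * norm h" by (intro mult_right_mono) (auto simp: C0_def)
    finally show "l * norm (param \<zeta> * Complex (\<sigma> * Im (E (h / c))) (Re (E (h / c)))) \<le> 10 ^ 23 * norm h"
      unfolding nD .
  qed
qed

end

section \<open>The extension on the two sides\<close>

definition side_ok :: "(complex \<Rightarrow> complex) \<Rightarrow> real \<Rightarrow> real \<Rightarrow> complex set \<Rightarrow> (complex \<Rightarrow> complex) \<Rightarrow> bool" where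
  "side_ok f L l W G \<longleftrightarrow>
    (\<forall>w\<in>W. \<exists>D. (G has_derivative D) (at w) \<and> (\<forall>h. norm h \<le> 10 ^ 27 * L * norm (D h) \<and> l * norm (D h) \<le> 10 ^ 23 * norm h)) \<and>
    inj_on G W \<and> (\<forall>w\<in>W. G (- w) = - G w) \<and>
    (\<forall>z. norm z = 1 \<longrightarrow> (\<forall>e>0. \<exists>d>0. \<forall>w\<in>W. norm (w - f z) < d \<longrightarrow> norm (G w - z) < e))"

lemma side_ok_cnj:
  assumes "side_ok (\<lambda>z. f (cnj z)) L l W G" shows "side_ok f L l W (\<lambda>w. cnj (G w))"
  unfolding side_ok_def
proof (intro conjI ballI allI impI)
  fix w assume w: "w \<in> W"
  obtain D where D: "(G has_derivative D) (at w)" "\<And>h. norm h \<le> 10 ^ 27 * L * norm (D h) \<and> l * norm (D h) \<le> 10 ^ 23 * norm h"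
    using assms w unfolding side_ok_def by blast
  show "\<exists>D. ((\<lambda>w. cnj (G w)) has_derivative D) (at w) \<and> (\<forall>h. norm h \<le> 10 ^ 27 * L * norm (D h) \<and> l * norm (D h) \<le> 10 ^ 23 * norm h)"
    using D by (intro exI[of _ "\<lambda>h. cnj (D h)"] conjI bounded_linear.has_derivative[OF bounded_linear_cnj]) auto
  show "cnj (G (- w)) = - cnj (G w)" using assms w unfolding side_ok_def by simp
next
  show "inj_on (\<lambda>w. cnj (G w)) W" using assms unfolding side_ok_def inj_on_def by simp
next
  fix z :: complex and e :: real assume z: "norm z = 1" "e > 0"
  hence "norm (cnj z) = 1" by simp
  then obtain d where d: "d > 0" "\<And>w. w \<in> W \<Longrightarrow> norm (w - f (cnj (cnj z))) < d \<Longrightarrow> norm (G w - cnj z) < e"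
    using assms z(2) unfolding side_ok_def by blast
  have "norm (cnj (G w) - z) = norm (G w - cnj z)" for w
    by (metis complex_cnj_cnj complex_cnj_diff complex_mod_cnj)
  thus "\<exists>d>0. \<forall>w\<in>W. norm (w - f z) < d \<longrightarrow> norm (cnj (G w) - z) < e" using d by auto
qed

lemma norm_reciprocal_le_iff:
  fixes x :: complex
  assumes "x \<noteq> 0" "l > 0" shows "norm (1 / x) \<le> K / l \<longleftrightarrow> l \<le> K * norm x"
  using assms by (simp add: norm_divide field_simps)

context conformal_side begin

lemma away_from_curve:
  assumes v: "3/2 \<le> v" and p: "p \<in> \<Gamma>" shows "l \<le> 10 * C0 * norm (\<Theta> (Complex u v) - p)"
proof -
  define r where "r = exp (- (3/2) :: real)"
  have r: "0 < r" "r < 1" by (auto simp: r_def)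
  have sub: "cball 0 r \<subseteq> ball (0::complex) 1" using r by auto
  have circ: "norm (X p z) \<le> 10 * C0 / l" if "norm z = r" for z
  proof -
    have "z = r * cis (Arg z)" using that by (metis rcis_cmod_Arg rcis_def)
    also have "\<dots> = exp (\<i> * Complex (Arg z) (3/2))"
      by (simp add: r_def cis_conv_exp exp_of_real[symmetric] exp_add[symmetric] Complex_eq algebra_simps)
    finally have z: "z = exp (\<i> * Complex (Arg z) (3/2))" .
    have "X p z = 1 / (\<Theta> (Complex (Arg z) (3/2)) - p)" using X_lift[OF p, of "Complex (Arg z) (3/2)"] z by simp
    moreover have "l \<le> 10 * C0 * norm (\<Theta> (Complex (Arg z) (3/2)) - p)"
    proof (rule order_trans[OF delta_lower[of "Arg z"]])
      show "10 * C0 * delta (Arg z) (3/2) \<le> 10 * C0 * norm (\<Theta> (Complex (Arg z) (3/2)) - p)"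
        using delta_le[OF p] C0_pos by (intro mult_left_mono) auto
    qed
    moreover have "\<Theta> (Complex (Arg z) (3/2)) - p \<noteq> 0" using lift_off[of "Complex (Arg z) (3/2)"] p by auto
    ultimately show ?thesis using norm_reciprocal_le_iff l_pos by metis
  qed
  define z where "z = exp (\<i> * Complex u v)"
  have zr: "norm z \<le> r" using v by (simp add: z_def norm_exp_i r_def)
  have "norm (X p z) \<le> 10 * C0 / l"
  proof (cases "norm z = r")
    case False
    show ?thesis
    proof (rule maximum_modulus_frontier[where S = "ball 0 r" and f = "X p" and \<xi> = z])
      show "X p holomorphic_on interior (ball 0 r)"
        using sub ball_subset_cball by (intro holomorphic_on_subset[OF X_hol[OF p]]) force
      show "continuous_on (closure (ball 0 r)) (X p)"
        using sub r by (intro continuous_on_subset[OF holomorphic_on_imp_continuous_on[OF X_hol[OF p]]]) simp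
      show "norm (X p z) \<le> 10 * C0 / l" if "z \<in> frontier (ball 0 r)" for z
        using circ[of z] that r by simp
      show "z \<in> ball 0 r" using False zr by simp
    qed simp
  qed (rule circ)
  moreover have "X p z = 1 / (\<Theta> (Complex u v) - p)" using X_lift[OF p, of "Complex u v"] v by (simp add: z_def)
  moreover have "\<Theta> (Complex u v) - p \<noteq> 0" using lift_off[of "Complex u v"] p v by auto
  ultimately show ?thesis using norm_reciprocal_le_iff l_pos by metis
qed

lemma side_map_boundary:
  assumes z: "norm z = 1" and e: "e > 0"
  obtains d where "d > 0" "\<And>\<zeta>. Im \<zeta> > 0 \<Longrightarrow> norm (\<Theta> \<zeta> - f z) < d \<Longrightarrow> norm (side_map (\<Theta> \<zeta>) - z) < e"
proof -
  have "isCont exp (0::real)" by simp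
  then obtain k where k: "k > 0" "\<And>x. \<bar>x\<bar> < k \<Longrightarrow> \<bar>exp x - 1\<bar> < e / 2" for x :: real
    using e unfolding continuous_at_eps_delta by (metis abs_minus_cancel diff_0_right dist_real_def exp_zero half_gt_zero)
  define d where "d = min (l / (10 * C0)) (min (k * l / (16 * C0)) (e * l / (22 * C0)))"
  have "d > 0" using l_pos C0_pos k(1) e by (simp add: d_def)
  have main: "norm (side_map (\<Theta> \<zeta>) - z) < e" if \<zeta>: "Im \<zeta> > 0" "norm (\<Theta> \<zeta> - f z) < d" for \<zeta>
  proof -
    define u v where "u = Re \<zeta>" and "v = Im \<zeta>"
    have zeta: "\<zeta> = Complex u v" and v: "v > 0" using \<zeta>(1) by (auto simp: u_def v_def)
    define w \<eta> where "w = \<Theta> \<zeta>" and "\<eta> = norm (\<Theta> \<zeta> - f z)"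
    have fz: "f z \<in> \<Gamma>" using z by (simp add: curve_def)
    have "\<eta> < l / (10 * C0)" "\<eta> < k * l / (16 * C0)" "\<eta> < e * l / (22 * C0)" using \<zeta>(2) by (auto simp: \<eta>_def d_def)
    hence small: "10 * C0 * \<eta> < l" "16 * C0 * \<eta> < k * l" "22 * C0 * \<eta> < e * l"
      using C0_pos by (simp_all add: pos_less_divide_eq mult.commute)
    have v32: "v \<le> 3/2"
    proof (rule ccontr)
      assume "\<not> v \<le> 3/2"
      hence "l \<le> 10 * C0 * \<eta>" using away_from_curve[OF _ fz, of v u] by (simp add: \<eta>_def zeta)
      thus False using small by simp
    qed
    have dl: "delta u v \<le> \<eta>" using delta_le[OF fz, of u v] by (simp add: \<eta>_def zeta)
    hence Cd: "C0 * delta u v \<le> C0 * \<eta>" using C0_pos by (intro mult_left_mono) auto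
    obtain t1 t2 where t: "u + v/2 \<le> t1" "t2 \<le> u - v/2" "g t1 - g t2 \<le> pi"
      "norm (bdry t1 - w) \<le> 2 * C0 * delta u v" "norm (bdry t2 - w) \<le> 2 * C0 * delta u v"
      using boundary_window[OF v v32, of u] unfolding w_def zeta by metis
    have g12: "g (u + v/2) \<le> g t1" "g t2 \<le> g (u - v/2)" "g t2 \<le> g t1" using t v by (auto intro!: g_le)
    have "l * (2 / pi * (g t1 - g t2)) \<le> norm (bdry t1 - bdry t2)" using bdry_lower[of t1 t2] t(3) g12(3) by simp
    also have "\<dots> \<le> 4 * (C0 * \<eta>)"
      using t(4,5) Cd norm_triangle_ineq4[of "bdry t1 - w" "bdry t2 - w"] by simp
    finally have "l * (g t1 - g t2) \<le> 2 * pi * (C0 * \<eta>)" by (simp add: field_simps)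
    also have "\<dots> \<le> 2 * 4 * (C0 * \<eta>)" using pi_less_4 C0_pos by (intro mult_right_mono) (auto simp: \<eta>_def)
    finally have gd: "l * (g t1 - g t2) \<le> 8 * (C0 * \<eta>)" by simp
    define a b where "a = Re (ext \<zeta>)" and "b = Im (ext \<zeta>)"
    have ab: "g (u - v/2) \<le> a" "a \<le> g (u + v/2)" "0 < b" "b \<le> 2 * (g (u + v/2) - g (u - v/2))"
      using Re_ext[OF \<zeta>(1)] Im_ext[OF \<zeta>(1)] by (simp_all add: a_def b_def u_def v_def)
    have "l * b \<le> l * (2 * (g t1 - g t2))" using ab(4) g12 l_pos by (intro mult_left_mono) auto
    also have "\<dots> = 2 * (l * (g t1 - g t2))" by simp
    also have "\<dots> \<le> 2 * (8 * (C0 * \<eta>))" using gd by simp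
    also have "\<dots> = 16 * C0 * \<eta>" by simp
    also have "\<dots> < l * k" using small(2) by (simp only: mult.commute)
    finally have "l * b < l * k" .
    hence "b < k" using l_pos by simp
    hence "\<bar>\<sigma> * b\<bar> < k" using sigma ab(3) by auto
    hence ex: "\<bar>exp (\<sigma> * b) - 1\<bar> < e / 2" by (rule k(2))
    have "Complex (\<sigma> * b) a = of_real (\<sigma> * b) + \<i> * of_real a" by (simp add: complex_eq_iff)
    hence "param \<zeta> = of_real (exp (\<sigma> * b)) * cis a"
      unfolding param_def a_def[symmetric] b_def[symmetric] by (simp only: exp_add cis_conv_exp exp_of_real)
    hence "param \<zeta> - cis a = of_real (exp (\<sigma> * b) - 1) * cis a" by (simp add: algebra_simps)
    hence "norm (param \<zeta> - cis a) = \<bar>exp (\<sigma> * b) - 1\<bar>" by (simp only: norm_mult norm_of_real norm_cis mult_1_right)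
    hence p1: "norm (param \<zeta> - cis a) < e / 2" using ex by simp
    have "norm (cis a - cis (g t1)) \<le> g t1 - g t2" using norm_cis_diff_le[of a "g t1"] ab(1,2) g12 by linarith
    hence "l * norm (cis a - cis (g t1)) \<le> l * (g t1 - g t2)" using l_pos by (intro mult_left_mono) auto
    hence p2: "l * norm (cis a - cis (g t1)) \<le> 8 * (C0 * \<eta>)" using gd by linarith
    have "l * norm (cis (g t1) - z) \<le> norm (bdry t1 - f z)" unfolding bdry_def using z by (intro lower) auto
    also have "\<dots> \<le> norm (bdry t1 - w) + norm (w - f z)" using norm_triangle_ineq[of "bdry t1 - w" "w - f z"] by simp
    also have "\<dots> \<le> 2 * (C0 * \<eta>) + 1 * \<eta>" using t(4) Cd by (simp add: w_def \<eta>_def)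
    also have "\<dots> \<le> 2 * (C0 * \<eta>) + C0 * \<eta>" by (intro add_left_mono mult_right_mono) (auto simp: C0_def \<eta>_def)
    finally have p3: "l * norm (cis (g t1) - z) \<le> 3 * (C0 * \<eta>)" by simp
    have "norm (cis a - z) \<le> norm (cis a - cis (g t1)) + norm (cis (g t1) - z)"
      using norm_triangle_ineq[of "cis a - cis (g t1)" "cis (g t1) - z"] by simp
    hence "l * norm (cis a - z) \<le> l * norm (cis a - cis (g t1)) + l * norm (cis (g t1) - z)"
      using l_pos by (simp add: distrib_left[symmetric])
    hence "2 * (l * norm (cis a - z)) < e * l" using p2 p3 small(3) by linarith
    hence "l * (2 * norm (cis a - z)) < l * e" by (simp add: mult_ac)
    hence "norm (cis a - z) < e / 2" using l_pos by simp
    thus ?thesis unfolding side_map_lift[OF \<zeta>(1)]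
      using p1 norm_triangle_ineq[of "param \<zeta> - cis a" "cis a - z"] by simp
  qed
  show thesis by (rule that[OF \<open>d > 0\<close> main])
qed

lemma side_map_ok: "side_ok f L l (\<Theta> ` \<H>) side_map"
  unfolding side_ok_def
proof (intro conjI ballI allI impI)
  fix w assume "w \<in> \<Theta> ` \<H>"
  then obtain \<zeta> where \<zeta>: "Im \<zeta> > 0" "w = \<Theta> \<zeta>" by auto
  show "\<exists>D. (side_map has_derivative D) (at w) \<and> (\<forall>h. norm h \<le> 10 ^ 27 * L * norm (D h) \<and> l * norm (D h) \<le> 10 ^ 23 * norm h)"
    using side_map_derivative[OF \<zeta>(1)] unfolding \<zeta>(2) by metis
  have "- w = \<Theta> (\<zeta> + of_real pi)" using lift_pi[OF \<zeta>(1)] \<zeta>(2) by simp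
  moreover have "Im (\<zeta> + of_real pi) > 0" using \<zeta>(1) by simp
  ultimately show "side_map (- w) = - side_map w"
    using side_map_lift param_pi[OF \<zeta>(1)] \<zeta> by metis
next
  show "inj_on side_map (\<Theta> ` \<H>)"
    by (intro inj_onI) (auto simp: side_map_lift param_eq_iff)
next
  fix z :: complex and e :: real assume "norm z = 1" "e > 0"
  then obtain d where "d > 0" "\<And>\<zeta>. Im \<zeta> > 0 \<Longrightarrow> norm (\<Theta> \<zeta> - f z) < d \<Longrightarrow> norm (side_map (\<Theta> \<zeta>) - z) < e"
    using side_map_boundary by metis
  thus "\<exists>d>0. \<forall>w\<in>\<Theta> ` \<H>. norm (w - f z) < d \<longrightarrow> norm (side_map w - z) < e" by auto
qed

end

lemma Schwarz_Pick_at_centre: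
  assumes d: "d > 0" and h: "h holomorphic_on ball c d" "\<And>x. x \<in> ball c d \<Longrightarrow> norm (h x) < 1"
  shows "norm (deriv h c) * d \<le> 1 - (norm (h c))\<^sup>2"
proof -
  define a where "a = h c"
  have a: "norm a < 1" unfolding a_def using d by (intro h(2)) simp
  define m where "m z = (z - a) / (1 - cnj a * z)" for z
  have mM: "m = Moebius_function 0 a" by (simp add: fun_eq_iff m_def Moebius_function_simple)
  define k where "k x = m (h (c + of_real d * x))" for x
  have inb: "c + of_real d * x \<in> ball c d" if "norm x < 1" for x
    using that d by (simp add: dist_norm norm_mult)
  have kh: "k holomorphic_on ball 0 1"
  proof -
    have "h \<circ> (\<lambda>x. c + of_real d * x) holomorphic_on ball 0 1"
      by (rule holomorphic_on_compose_gen[OF _ h(1)]) (use inb in \<open>auto intro!: holomorphic_intros\<close>)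
    hence "m \<circ> (h \<circ> (\<lambda>x. c + of_real d * x)) holomorphic_on ball 0 1"
      unfolding mM by (rule holomorphic_on_compose_gen[OF _ Moebius_function_holomorphic[OF a]]) (use inb h(2) in auto)
    thus ?thesis by (simp add: k_def[abs_def] o_def)
  qed
  have k0: "k 0 = 0" by (simp add: k_def m_def a_def)
  have k1: "norm (k x) < 1" if "norm x < 1" for x
    unfolding k_def mM using Moebius_function_norm_lt_1[OF a] h(2) inb[OF that] by blast
  have "norm (deriv k 0) \<le> 1" using Schwarz_Lemma(2)[OF kh k0 k1, of 0] by simp
  have ca: "1 - cnj a * a = of_real (1 - (norm a)\<^sup>2)" 
    by (metis complex_norm_square mult.commute of_real_1 of_real_diff)
  have pos: "1 - (norm a)\<^sup>2 > 0" using a by (simp add: power_less_one_iff)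
  have dm: "(m has_field_derivative 1 / (1 - cnj a * a)) (at a)"
  proof -
    have nz: "1 - cnj a * a \<noteq> 0" unfolding ca using pos by (metis less_irrefl of_real_eq_0_iff)
    have "((\<lambda>z. z - a) has_field_derivative 1) (at a)" "((\<lambda>z. 1 - cnj a * z) has_field_derivative - cnj a) (at a)"
      by (auto intro!: derivative_eq_intros)
    from DERIV_divide[OF this nz] nz show ?thesis unfolding m_def[abs_def] by simp
  qed
  have dh: "((\<lambda>x. h (c + of_real d * x)) has_field_derivative deriv h c * of_real d) (at 0)"
  proof -
    have "(h has_field_derivative deriv h c) (at (c + of_real d * 0))" using holomorphic_derivI[OF h(1)] d by simp
    moreover have "((\<lambda>x. c + of_real d * x) has_field_derivative of_real d) (at 0)" by (auto intro!: derivative_eq_intros)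
    ultimately show ?thesis by (rule DERIV_chain2)
  qed
  have "(m has_field_derivative 1 / (1 - cnj a * a)) (at (h (c + of_real d * 0)))" using dm by (simp add: a_def)
  hence "(k has_field_derivative 1 / (1 - cnj a * a) * (deriv h c * of_real d)) (at 0)"
    unfolding k_def[abs_def] using dh by (rule DERIV_chain2)
  hence "deriv k 0 = 1 / (1 - cnj a * a) * (deriv h c * of_real d)" by (rule DERIV_imp_deriv)
  hence "norm (deriv k 0) = norm (deriv h c) * d / (1 - (norm a)\<^sup>2)"
    unfolding ca using pos d by (simp add: norm_mult norm_divide del: of_real_diff)
  with \<open>norm (deriv k 0) \<le> 1\<close> show ?thesis using pos by (simp add: a_def divide_le_eq)
qed

lemma Schwarz_Pick_lift:
  assumes T: "T holomorphic_on \<H>" and W: "open W" and Z: "Z holomorphic_on W" "\<And>w. w \<in> W \<Longrightarrow> norm (Z w) < 1"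
    and TZ: "\<And>x. Im x > 0 \<Longrightarrow> T x \<in> W \<and> Z (T x) = exp (\<i> * x)"
    and x: "Im x > 0" and d: "d \<ge> 0" "ball (T x) d \<subseteq> W"
  shows "d * exp (- Im x) \<le> (1 - exp (- 2 * Im x)) * norm (deriv T x)"
proof (cases "d = 0")
  case True
  thus ?thesis using x by simp
next
  case False
  have "(T has_field_derivative deriv T x) (at x)" using holomorphic_derivI[OF T open_upper_half_plane] x by simp
  moreover have "(Z has_field_derivative deriv Z (T x)) (at (T x))" using holomorphic_derivI[OF Z(1) W] TZ[OF x] by simp
  ultimately have "((\<lambda>y. Z (T y)) has_field_derivative deriv Z (T x) * deriv T x) (at x)" by (intro DERIV_chain2)
  hence "((\<lambda>y. exp (\<i> * y)) has_field_derivative deriv Z (T x) * deriv T x) (at x)"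
    by (rule has_field_derivative_transform_within_open[OF _ open_upper_half_plane]) (use x TZ in auto)
  moreover have "((\<lambda>y. exp (\<i> * y)) has_field_derivative exp (\<i> * x) * \<i>) (at x)"
    by (auto intro!: derivative_eq_intros)
  ultimately have "deriv Z (T x) * deriv T x = exp (\<i> * x) * \<i>" by (rule DERIV_unique)
  hence n: "norm (deriv Z (T x)) * norm (deriv T x) = exp (- Im x)"
    by (metis mult.right_neutral norm_exp_i norm_ii norm_mult)
  have "norm (deriv Z (T x)) * d \<le> 1 - (norm (Z (T x)))\<^sup>2"
    using False d Z by (intro Schwarz_Pick_at_centre) (auto intro: holomorphic_on_subset)
  also have "(norm (Z (T x)))\<^sup>2 = exp (- 2 * Im x)" using TZ[OF x] by (simp add: norm_exp_i exp_double[symmetric])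
  finally have "norm (deriv Z (T x)) * d * norm (deriv T x) \<le> (1 - exp (- 2 * Im x)) * norm (deriv T x)"
    by (intro mult_right_mono) auto
  thus ?thesis using n by (metis mult.assoc mult.commute)
qed

lemma exp_i_image: "(\<lambda>x. exp (\<i> * x)) ` \<H> = ball 0 1 - {0}"
proof
  show "(\<lambda>x. exp (\<i> * x)) ` \<H> \<subseteq> ball 0 1 - {0}" by (auto simp: norm_exp_i)
  show "ball 0 1 - {0} \<subseteq> (\<lambda>x. exp (\<i> * x)) ` \<H>"
  proof
    fix z :: complex assume z: "z \<in> ball 0 1 - {0}"
    have "exp (\<i> * (- \<i> * Ln z)) = z" using z by simp
    moreover have "Im (- \<i> * Ln z) > 0" using z by simp
    ultimately show "z \<in> (\<lambda>x. exp (\<i> * x)) ` \<H>" by (intro image_eqI[of _ _ "- \<i> * Ln z"]) auto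
  qed
qed

lemma exp_i_eq:
  assumes "exp (\<i> * x) = exp (\<i> * y)" shows "\<exists>n::int. x = y + of_real (2 * pi * of_int n)"
proof -
  have "\<exists>n::int. \<i> * x = \<i> * y + of_real (of_int (2 * n) * pi) * \<i>" using assms by (simp only: exp_eq)
  then obtain n :: int where "\<i> * x = \<i> * y + of_real (of_int (2 * n) * pi) * \<i>" by blast
  hence "\<i> * x = \<i> * (y + of_real (2 * pi * of_int n))" by (simp add: algebra_simps)
  hence "x = y + of_real (2 * pi * of_int n)" by (simp only: mult_cancel_left) simp
  thus ?thesis by blast
qed

lemma exp_i_shift_pi: "exp (\<i> * (x + of_real pi)) = - exp (\<i> * x)"
proof -
  have "\<i> * (x + of_real pi) = \<i> * x + of_real pi * \<i>" by (simp add: algebra_simps)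
  thus ?thesis by (simp add: exp_add exp_pi_i)
qed

lemma curve_cnj: "circle_embedding.curve (\<lambda>z. f (cnj z)) = circle_embedding.curve f"
  if "circle_embedding f L l" "circle_embedding (\<lambda>z. f (cnj z)) L l"
proof -
  have "(\<lambda>z. f (cnj z)) ` sphere 0 1 = f ` (cnj ` sphere 0 1)" by (simp add: image_image)
  also have "cnj ` sphere 0 1 = sphere 0 1"
  proof (intro equalityI subsetI)
    fix x :: complex assume "x \<in> sphere 0 1"
    thus "x \<in> cnj ` sphere 0 1" by (intro image_eqI[of x cnj "cnj x"]) auto
  qed auto
  finally show ?thesis by (simp add: circle_embedding.curve_def[OF that(1)] circle_embedding.curve_def[OF that(2)])
qed

context odd_curve begin

lemma odd_curve_reflect: "odd_curve (\<lambda>z. f (cnj z)) L l"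
proof unfold_locales
  fix a b :: complex assume ab: "norm a = 1" "norm b = 1"
  have "norm (cnj a - cnj b) = norm (a - b)" by (metis complex_cnj_diff complex_mod_cnj)
  thus "l * norm (a - b) \<le> norm (f (cnj a) - f (cnj b))" "norm (f (cnj a) - f (cnj b)) \<le> L * norm (a - b)"
    using lower[of "cnj a" "cnj b"] upper[of "cnj a" "cnj b"] ab by simp_all
next
  show "norm z = 1 \<Longrightarrow> f (cnj (- z)) = - f (cnj z)" for z using odd[of "cnj z"] by simp
qed (rule l_pos L_pos)+

lemma reflection_invariance:
  assumes "f' = f \<or> f' = (\<lambda>z. f (cnj z))"
  shows "odd_curve f' L l" "circle_embedding.curve f' = \<Gamma>" "side_ok f' L l W G \<Longrightarrow> \<exists>G'. side_ok f L l W G' \<and> (\<forall>w. norm (G' w) = norm (G w))"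
proof -
  show oc: "odd_curve f' L l" using assms odd_curve_reflect odd_curve_axioms by blast
  show "circle_embedding.curve f' = \<Gamma>"
    using assms curve_cnj[OF circle_embedding_axioms odd_curve.axioms(1)[OF odd_curve_reflect]] by auto
  assume ok: "side_ok f' L l W G"
  show "\<exists>G'. side_ok f L l W G' \<and> (\<forall>w. norm (G' w) = norm (G w))"
    using assms
  proof
    assume "f' = f"
    thus ?thesis using ok by blast
  next
    assume "f' = (\<lambda>z. f (cnj z))"
    thus ?thesis using side_ok_cnj ok by (intro exI[of _ "\<lambda>w. cnj (G w)"]) simp
  qed
qed

end

context odd_conformal_curve begin

lemma norm_map_le: assumes "norm z < 1" shows "norm (\<Phi> z) \<le> radius * norm z"
proof -
  have sub: "inside \<Gamma> \<subseteq> ball 0 radius"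
  proof -
    have "inside \<Gamma> \<subseteq> cball 0 radius" 
    proof -
      have "inside \<Gamma> \<subseteq> cball 0 radius - \<Gamma>"
      proof (rule inside_subset)
        show "connected (- cball (0::complex) radius)" by (intro connected_complement_bounded_convex) auto
        show "\<not> bounded (- cball (0::complex) radius)" by (intro cobounded_imp_unbounded) simp
      qed (use norm_curve_le in auto)
      thus ?thesis by blast
    qed
    hence "interior (inside \<Gamma>) \<subseteq> interior (cball 0 radius)" by (rule interior_mono)
    thus ?thesis using jordan(1) by (simp add: interior_open)
  qed
  define k where "k x = \<Phi> x / of_real radius" for x
  have "norm (k z) \<le> norm z"
  proof (rule Schwarz_Lemma(1))
    show "k holomorphic_on ball 0 1" unfolding k_def using radius_pos by (intro holomorphic_intros holomorphic) auto
    show "k 0 = 0" by (simp add: k_def map_zero)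
    show "norm (k x) < 1" if "norm x < 1" for x
      using map_in_inside[OF that] sub radius_pos by (auto simp: k_def norm_divide)
  qed (rule assms)
  thus ?thesis using radius_pos by (simp add: k_def norm_divide field_simps)
qed

lemma lift_image: "\<Theta> ` \<H> = inside \<Gamma> - {0}"
proof -
  have "\<Theta> ` \<H> = \<Phi> ` (\<lambda>x. exp (\<i> * x)) ` \<H>" by (simp add: image_image lift_def)
  also have "\<dots> = \<Phi> ` ball 0 1 - {\<Phi> 0}" unfolding exp_i_image
    using inj_on_image_set_diff[OF injective, of "ball 0 1" "{0}"] by simp
  finally show ?thesis by (simp add: image map_zero)
qed

lemma deriv_map_nonzero: assumes "norm z < 1" shows "deriv \<Phi> z \<noteq> 0"
  using holomorphic_injective_imp_regular[OF holomorphic open_ball injective] assms by simp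

lemma deriv_lift: assumes "Im x > 0" shows "deriv \<Theta> x = deriv \<Phi> (exp (\<i> * x)) * (exp (\<i> * x) * \<i>)"
proof -
  have "(\<Phi> has_field_derivative deriv \<Phi> (exp (\<i> * x))) (at (exp (\<i> * x)))"
    using assms by (intro holomorphic_derivI[OF holomorphic open_ball]) (simp add: norm_exp_i)
  moreover have "((\<lambda>y. exp (\<i> * y)) has_field_derivative exp (\<i> * x) * \<i>) (at x)"
    by (auto intro!: derivative_eq_intros)
  ultimately have "(\<Theta> has_field_derivative deriv \<Phi> (exp (\<i> * x)) * (exp (\<i> * x) * \<i>)) (at x)"
    unfolding lift_def[abs_def] by (rule DERIV_chain2)
  thus ?thesis by (rule DERIV_imp_deriv)
qed

lemma map_nonzero: assumes "norm z < 1" "z \<noteq> 0" shows "\<Phi> z \<noteq> 0"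
  using inverse_map[OF assms(1)] inverse_map[of 0] map_zero assms(2) by auto

lemma interior_side:
  obtains G where "side_ok f L l (inside \<Gamma> - {0}) G" "\<And>w. w \<in> inside \<Gamma> - {0} \<Longrightarrow> norm (G w) < 1"
    "\<And>w. w \<in> inside \<Gamma> - {0} \<Longrightarrow> G w \<noteq> 0"
    "\<And>e. e > 0 \<Longrightarrow> \<exists>d>0. \<forall>w\<in>inside \<Gamma> - {0}. norm w < d \<longrightarrow> norm (G w) < e"
proof -
  obtain f' and g :: "real \<Rightarrow> real" where f': "f' = f \<or> f' = (\<lambda>z. f (cnj z))" and g: "continuous_on UNIV g" "strict_mono g" "\<And>u. g (u + pi) = g u + pi"
    and lim: "\<And>u. (\<Theta> \<longlongrightarrow> f' (cis (g u))) (at (of_real u) within \<H>)"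
    using boundary_parametrization by blast
  note var = reflection_invariance[OF f']
  interpret F: odd_curve f' L l by (rule var(1))
  have \<Gamma>': "F.curve = \<Gamma>" by (rule var(2))
  have rad: "F.radius = radius" using f'
  proof
    assume fc: "f' = (\<lambda>z. f (cnj z))"
    obtain p where p: "p \<in> \<Gamma>" "norm p = radius" using radius by blast
    obtain q where q: "q \<in> F.curve" "norm q = F.radius" using F.radius by blast
    show ?thesis using F.norm_curve_le[of p] norm_curve_le[of q] p q \<Gamma>' by force
  qed simp
  define X where "X p z = 1 / (\<Phi> z - p)" for p z
  have off: "\<Phi> z \<noteq> p" if "norm z < 1" "p \<in> \<Gamma>" for z p using map_in_inside[OF that(1)] inside_not_in_curve that(2) by metis
  have ball1: "norm (exp (\<i> * x)) < 1" if "Im x > 0" for x using that by (simp add: norm_exp_i)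
  interpret S: conformal_side f' L l g \<Theta> "deriv \<Phi>" X "- 1"
  proof unfold_locales
    show "(- 1 :: real) = 1 \<or> (- 1 :: real) = - 1" by simp
    show "\<Theta> holomorphic_on \<H>" by (rule lift_holomorphic)
    show "\<Theta> x \<noteq> 0" if "0 < Im x" for x
      using map_nonzero[OF ball1[OF that]] by (simp add: lift_def)
    show "\<Theta> x \<notin> F.curve" if "0 < Im x" for x
      unfolding lift_def \<Gamma>' using off[OF ball1[OF that]] by blast
    show "\<exists>n::int. x = y + of_real (2 * pi * of_int n)" if "0 < Im x" "0 < Im y" "\<Theta> x = \<Theta> y" for x y
      using that inverse_map[OF ball1] by (intro exp_i_eq) (metis lift_def)
    show "\<Theta> (x + of_real pi) = - \<Theta> x" if "0 < Im x" for x
      unfolding lift_def exp_i_shift_pi by (rule map_odd[OF ball1[OF that]])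
    show "norm (\<Theta> x) \<le> F.radius * exp (- 1 * Im x)" if "0 < Im x" for x
      using norm_map_le[OF ball1[OF that]] by (simp add: lift_def rad norm_exp_i)
    show "X p holomorphic_on ball 0 1" if "p \<in> F.curve" for p
      unfolding X_def using off that \<Gamma>' by (intro holomorphic_intros holomorphic) auto
    show "inj_on (X p) (ball 0 1)" if "p \<in> F.curve" for p
    proof (rule inj_onI)
      fix x y assume xy: "x \<in> ball 0 1" "y \<in> ball 0 1" "X p x = X p y"
      have "\<Phi> x - p \<noteq> 0" "\<Phi> y - p \<noteq> 0" using off[of x p] off[of y p] xy that \<Gamma>' by auto
      hence "\<Phi> x = \<Phi> y" using xy(3) by (simp add: X_def)
      thus "x = y" using injective xy by (metis inj_onD)
    qed
    show "X p (exp (\<i> * x)) = 1 / (\<Theta> x - p)" for p x by (simp add: X_def lift_def)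
    show "1 / (q - p) \<notin> X p ` ball 0 1" if "p \<in> F.curve" "q \<in> F.curve" "q \<noteq> p" for p q
    proof
      assume "1 / (q - p) \<in> X p ` ball 0 1"
      then obtain z where z: "norm z < 1" "1 / (q - p) = 1 / (\<Phi> z - p)" by (auto simp: X_def)
      hence "q = \<Phi> z" using that(3) off[OF z(1), of p] that(1) \<Gamma>' by (auto simp: field_simps)
      thus False using off[OF z(1), of q] that(2) \<Gamma>' by simp
    qed
    show "infdist (\<Theta> x) F.curve * exp (- Im x) \<le> (1 - exp (- 2 * Im x)) * norm (deriv \<Theta> x)" if "0 < Im x" for x
      unfolding \<Gamma>'
    proof (rule Schwarz_Pick_lift[OF lift_holomorphic jordan(1) inverse_map_holomorphic])
      show "ball (\<Theta> x) (infdist (\<Theta> x) \<Gamma>) \<subseteq> inside \<Gamma>"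
      proof (rule ccontr)
        assume "\<not> ?thesis"
        hence ne: "ball (\<Theta> x) (infdist (\<Theta> x) \<Gamma>) - inside \<Gamma> \<noteq> {}" by blast
        hence "infdist (\<Theta> x) \<Gamma> > 0" 
          using infdist_nonneg[of "\<Theta> x" \<Gamma>] by (cases "infdist (\<Theta> x) \<Gamma> = 0") auto
        hence "\<Theta> x \<in> ball (\<Theta> x) (infdist (\<Theta> x) \<Gamma>) \<inter> inside \<Gamma>"
          using map_in_inside[OF ball1[OF that]] by (simp add: lift_def)
        hence "ball (\<Theta> x) (infdist (\<Theta> x) \<Gamma>) \<inter> \<Gamma> \<noteq> {}"
          using connected_Int_frontier[OF connected_ball _ ne] jordan(10) by blast
        thus False using infdist_le[of _ \<Gamma> "\<Theta> x"] by force
      qed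
    qed (use that ball1 inverse_map_in_ball map_in_inside in \<open>auto simp: lift_def infdist_nonneg\<close>)
    show "deriv \<Phi> holomorphic_on ball 0 1" using holomorphic by (intro holomorphic_deriv) auto
    show "deriv \<Phi> z \<noteq> 0" if "norm z < 1" for z by (rule deriv_map_nonzero[OF that])
    show "norm (deriv \<Phi> (exp (\<i> * x))) = norm (deriv \<Theta> x) * exp (- (- 1) * Im x)" if "0 < Im x" for x
      unfolding deriv_lift[OF that] by (simp add: norm_mult norm_exp_i mult.assoc flip: exp_add)
  qed (use g lim in auto)
  obtain G where G: "side_ok f L l (\<Theta> ` \<H>) G" "\<And>w. norm (G w) = norm (S.side_map w)"
    using var(3)[OF S.side_map_ok] by blast
  show thesis
  proof (rule that[of G])
    show "side_ok f L l (inside \<Gamma> - {0}) G" using G(1) by (simp add: lift_image)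
  next
    fix w assume "w \<in> inside \<Gamma> - {0}"
    then obtain x where x: "Im x > 0" "w = \<Theta> x" unfolding lift_image[symmetric] by auto
    have n: "norm (G w) = exp (- Im (S.ext x))" using G(2) S.side_map_lift[OF x(1)] S.norm_param x(2) by simp
    thus "norm (G w) < 1" using S.Im_ext(1)[OF x(1)] by simp
    show "G w \<noteq> 0" using n by (metis exp_not_eq_zero norm_zero)
  next
    fix e :: real assume e: "e > 0"
    have "isCont inverse_map 0"
      using continuous_inverse_map jordan(1) zero_inside continuous_on_eq_continuous_at by blast
    moreover have "inverse_map 0 = 0" using inverse_map[of 0] map_zero by simp
    ultimately obtain d where d: "d > 0" "\<And>w. norm w < d \<Longrightarrow> norm (inverse_map w) < e / 2187"
      using e unfolding continuous_at_eps_delta by (metis dist_0_norm dist_commute divide_pos_pos zero_less_numeral)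
    have "norm (G w) < e" if w: "w \<in> inside \<Gamma> - {0}" "norm w < d" for w
    proof -
      obtain x where x: "Im x > 0" "w = \<Theta> x" using w(1) unfolding lift_image[symmetric] by auto
      have "norm (G w) \<le> 3 ^ 7 * exp (- 1 * Im x)"
        using G(2) S.side_map_lift[OF x(1)] S.norm_param_bounds(1)[OF x(1)] x(2) by simp
      also have "exp (- 1 * Im x) = norm (inverse_map w)" using x ball1[OF x(1)] by (simp add: lift_def norm_exp_i)
      also have "3 ^ 7 * norm (inverse_map w) < e" using d(2)[OF w(2)] by simp
      finally show ?thesis .
    qed
    thus "\<exists>d>0. \<forall>w\<in>inside \<Gamma> - {0}. norm w < d \<longrightarrow> norm (G w) < e" using d(1) by blast
  qed
qed

end

context odd_curve begin

lemma reciprocal_odd_curve: "odd_curve (\<lambda>z. 1 / f z) (L / l\<^sup>2) (l / L\<^sup>2)"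
proof unfold_locales
  show "l / L\<^sup>2 > 0" "L / l\<^sup>2 > 0" using l_pos L_pos by simp_all
  fix a b :: complex assume ab: "norm a = 1" "norm b = 1"
  have nz: "f a \<noteq> 0" "f b \<noteq> 0" using norm_on_circle[OF ab(1)] norm_on_circle[OF ab(2)] l_pos by auto
  have "1 / f a - 1 / f b = (f b - f a) / (f a * f b)" using nz by (simp add: field_simps)
  hence e: "norm (1 / f a - 1 / f b) = norm (f a - f b) / (norm (f a) * norm (f b))"
    by (simp add: norm_divide norm_mult norm_minus_commute)
  have bd: "l\<^sup>2 \<le> norm (f a) * norm (f b)" "norm (f a) * norm (f b) \<le> L\<^sup>2" "0 < norm (f a) * norm (f b)"
    using norm_on_circle[OF ab(1)] norm_on_circle[OF ab(2)] l_pos nz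
    by (auto simp: power2_eq_square intro!: mult_mono)
  have "l / L\<^sup>2 * norm (a - b) = (l * norm (a - b)) / L\<^sup>2" by simp
  also have "\<dots> \<le> norm (f a - f b) / (norm (f a) * norm (f b))"
    using lower[OF ab] bd l_pos by (intro frac_le) auto
  finally show "l / L\<^sup>2 * norm (a - b) \<le> norm (1 / f a - 1 / f b)" by (simp only: e)
  have "norm (f a - f b) / (norm (f a) * norm (f b)) \<le> (L * norm (a - b)) / l\<^sup>2"
    using upper[OF ab] bd l_pos L_pos by (intro frac_le) auto
  thus "norm (1 / f a - 1 / f b) \<le> L / l\<^sup>2 * norm (a - b)" by (simp add: e)
next
  show "1 / f (- z) = - (1 / f z)" if "norm z = 1" for z using odd[OF that] by simp
qed

lemma reciprocal_curve: "circle_embedding.curve (\<lambda>z. 1 / f z) = (\<lambda>w. 1 / w) ` \<Gamma>"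
  by (simp add: circle_embedding.curve_def[OF odd_curve.axioms(1)[OF reciprocal_odd_curve]] curve_def image_image)

lemma outside_iff_reciprocal_inside:
  "w \<in> outside \<Gamma> \<longleftrightarrow> w \<noteq> 0 \<and> 1 / w \<in> inside ((\<lambda>w. 1 / w) ` \<Gamma>)"
proof -
  interpret I: odd_curve "\<lambda>z. 1 / f z" "L / l\<^sup>2" "l / L\<^sup>2" by (rule reciprocal_odd_curve)
  have \<Gamma>I: "I.curve = (\<lambda>w. 1 / w) ` \<Gamma>" by (rule reciprocal_curve)
  define V where "V = (\<lambda>y. 1 / y) ` (inside I.curve - {0})"
  have conV: "connected V" unfolding V_def
    using connected_open_delete[OF I.jordan(1,2)] by (intro connected_continuous_image continuous_intros) auto
  have V\<Gamma>: "V \<inter> \<Gamma> = {}"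
  proof (rule ccontr)
    assume "\<not> ?thesis"
    then obtain y where y: "y \<in> inside I.curve" "1 / y \<in> \<Gamma>" by (auto simp: V_def)
    have "1 / (1 / y) \<in> I.curve" unfolding \<Gamma>I using y(2) by (rule imageI)
    thus False using I.inside_not_in_curve[OF y(1)] by simp
  qed
  have unb: "\<not> bounded V"
  proof
    assume "bounded V"
    then obtain B where B: "B > 0" "\<And>w. w \<in> V \<Longrightarrow> norm w \<le> B" using bounded_pos by blast
    obtain d where d: "d > 0" "ball 0 d \<subseteq> inside I.curve" using I.jordan(1) I.zero_inside open_contains_ball by blast
    define t where "t = min (d / 2) (1 / (2 * B))"
    have t: "t > 0" "t < d" using d(1) B(1) by (auto simp: t_def)
    have "complex_of_real t \<in> inside I.curve - {0}" using d(2) t by auto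
    hence "norm (1 / complex_of_real t) \<le> B" using B(2) by (auto simp: V_def)
    hence "1 \<le> B * t" using t by (simp add: norm_divide field_simps)
    also have "\<dots> \<le> B * (1 / (2 * B))" using B(1) by (intro mult_left_mono) (auto simp: t_def)
    finally show False using B(1) by simp
  qed
  have sub1: "V \<subseteq> outside \<Gamma>"
  proof -
    have "V \<inter> inside \<Gamma> = {}"
    proof (rule ccontr)
      assume "V \<inter> inside \<Gamma> \<noteq> {}"
      hence "V \<subseteq> inside \<Gamma>" using connected_Int_frontier[OF conV, of "inside \<Gamma>"] V\<Gamma> jordan(10) by blast
      thus False using unb jordan(3) bounded_subset by blast
    qed
    thus ?thesis using V\<Gamma> jordan(9) by blast
  qed
  have z_out: "0 \<notin> outside \<Gamma>" using zero_inside jordan(8) by blast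
  define C where "C = (\<lambda>w. 1 / w) ` outside \<Gamma>"
  have conC: "connected C" unfolding C_def
    using z_out jordan(6) by (intro connected_continuous_image continuous_intros) auto
  have "0 \<in> closure C"
  proof (unfold closure_approachable, intro allI impI)
    fix e :: real assume e: "e > 0"
    obtain w where w: "w \<in> outside \<Gamma>" "norm w > 1 / e" using jordan(7) unfolding bounded_iff by (meson not_le)
    have "0 < 1 / e" using e by simp
    hence "norm w > 0" using w(2) by linarith
    hence "norm (1 / w) < e" using w(2) e by (simp add: norm_divide field_simps)
    thus "\<exists>y\<in>C. dist y 0 < e" using w(1) by (auto simp: C_def)
  qed
  hence "connected (insert 0 C)"
    using conC closure_subset[of C] by (intro connected_intermediate_closure[of C "insert 0 C"]) blast+
  moreover have "insert 0 C \<inter> I.curve = {}"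
  proof (rule ccontr)
    assume "\<not> ?thesis"
    then obtain x where x: "x \<in> insert 0 C" "x \<in> I.curve" by blast
    hence "x \<noteq> 0" using I.zero_not_in_curve by metis
    then obtain w p where w: "w \<in> outside \<Gamma>" "p \<in> \<Gamma>" "1 / w = 1 / p"
      using x unfolding C_def \<Gamma>I by blast
    hence "w = p" using z_out zero_not_in_curve by (metis div_by_1 divide_divide_eq_right mult_1)
    thus False using w outside_no_overlap[of \<Gamma>] by blast
  qed
  ultimately have sub2: "insert 0 C \<subseteq> inside I.curve"
    using connected_Int_frontier[of "insert 0 C" "inside I.curve"] I.zero_inside I.jordan(10) by blast
  show ?thesis
  proof
    assume w: "w \<in> outside \<Gamma>"
    thus "w \<noteq> 0 \<and> 1 / w \<in> inside ((\<lambda>w. 1 / w) ` \<Gamma>)" using z_out sub2 by (auto simp: C_def \<Gamma>I)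
  next
    assume "w \<noteq> 0 \<and> 1 / w \<in> inside ((\<lambda>w. 1 / w) ` \<Gamma>)"
    hence "1 / (1 / w) \<in> V" unfolding V_def \<Gamma>I by (intro imageI) auto
    thus "w \<in> outside \<Gamma>" using sub1 by auto
  qed
qed

lemma exterior_side:
  obtains G K where "side_ok f L l (outside \<Gamma>) G" "\<And>w. w \<in> outside \<Gamma> \<Longrightarrow> norm (G w) > 1"
    "\<And>w. w \<in> outside \<Gamma> \<Longrightarrow> norm w \<le> K * norm (G w)"
proof -
  interpret I: odd_curve "\<lambda>z. 1 / f z" "L / l\<^sup>2" "l / L\<^sup>2" by (rule reciprocal_odd_curve)
  have \<Gamma>I: "I.curve = (\<lambda>w. 1 / w) ` \<Gamma>" by (rule reciprocal_curve)
  note out = outside_iff_reciprocal_inside[folded \<Gamma>I]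
  obtain \<Phi> where \<Phi>: "conformal_curve (\<lambda>z. 1 / f z) (L / l\<^sup>2) (l / L\<^sup>2) \<Phi>" "\<Phi> 0 = 0" "\<And>z. norm z < 1 \<Longrightarrow> \<Phi> (- z) = - \<Phi> z"
    using I.odd_Riemann_map by blast
  interpret E: odd_conformal_curve "\<lambda>z. 1 / f z" "L / l\<^sup>2" "l / L\<^sup>2" \<Phi>
    by (intro odd_conformal_curve.intro \<Phi>(1) I.odd_curve_axioms odd_conformal_curve_axioms.intro \<Phi>(2,3))
  obtain f1 and g :: "real \<Rightarrow> real" where f1: "f1 = (\<lambda>z. 1 / f z) \<or> f1 = (\<lambda>z. 1 / f (cnj z))"
    and g: "continuous_on UNIV g" "strict_mono g" "\<And>u. g (u + pi) = g u + pi"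
    and lim: "\<And>u. (E.lift \<longlongrightarrow> f1 (cis (g u))) (at (of_real u) within \<H>)"
    using E.boundary_parametrization by blast
  define f' where "f' z = 1 / f1 z" for z
  have "f' = f \<or> f' = (\<lambda>z. f (cnj z))" using f1 by (auto simp: f'_def[abs_def])
  note var = reflection_invariance[OF this]
  interpret F: odd_curve f' L l by (rule var(1))
  have \<Gamma>': "F.curve = \<Gamma>" by (rule var(2))
  have ball1: "norm (exp (\<i> * x)) < 1" if "Im x > 0" for x using that by (simp add: norm_exp_i)
  define T where "T x = 1 / E.lift x" for x
  have lift_nz: "E.lift x \<noteq> 0" if "Im x > 0" for x
    using E.map_nonzero[OF ball1[OF that]] by (simp add: E.lift_def)
  have T_out: "T x \<in> outside \<Gamma>" if "Im x > 0" for x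
    using lift_nz[OF that] E.map_in_inside[OF ball1[OF that]] unfolding out T_def by (simp add: E.lift_def)
  have not_recip: "1 - p * \<Phi> z \<noteq> 0" if "norm z < 1" "p \<in> \<Gamma>" for z p
  proof
    assume "1 - p * \<Phi> z = 0"
    hence "\<Phi> z = 1 / p" by (metis divide_inverse eq_iff_diff_eq_0 inverse_unique mult_1)
    hence "\<Phi> z \<in> I.curve" using that(2) by (simp add: \<Gamma>I)
    thus False using I.inside_not_in_curve[OF E.map_in_inside[OF that(1)]] by blast
  qed
  define X where "X p z = \<Phi> z / (1 - p * \<Phi> z)" for p z
  obtain \<phi> where \<phi>: "\<phi> holomorphic_on ball 0 1" "\<And>z. norm z < 1 \<Longrightarrow> \<Phi> z = z * \<phi> z" "deriv \<Phi> 0 = \<phi> 0"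
    using Schwarz3[OF E.holomorphic \<Phi>(2)] by blast
  have \<phi>nz: "\<phi> z \<noteq> 0" if "norm z < 1" for z
  proof (cases "z = 0")
    case True thus ?thesis using E.deriv_map_nonzero[of 0] \<phi>(3) by simp
  next
    case False thus ?thesis using E.map_nonzero[OF that] \<phi>(2)[OF that] by auto
  qed
  define J where "J z = deriv \<Phi> z / (\<phi> z)\<^sup>2" for z
  have T_hol: "T holomorphic_on \<H>" unfolding T_def using lift_nz by (intro holomorphic_intros E.lift_holomorphic) auto
  have T_deriv: "deriv T x = - deriv E.lift x / (E.lift x)\<^sup>2" if "Im x > 0" for x
  proof -
    have "(E.lift has_field_derivative deriv E.lift x) (at x)"
      using holomorphic_derivI[OF E.lift_holomorphic open_upper_half_plane] that by simp
    hence "(T has_field_derivative - deriv E.lift x / (E.lift x)\<^sup>2) (at x)"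
      unfolding T_def using lift_nz[OF that] by (auto intro!: derivative_eq_intros simp: power2_eq_square)
    thus ?thesis by (rule DERIV_imp_deriv)
  qed
  have F_radius: "norm (1 / w) \<le> F.radius" if "w \<in> I.curve" for w
    using that F.norm_curve_le unfolding \<Gamma>I \<Gamma>' by auto
  have grow: "norm z \<le> F.radius * norm (\<Phi> z)" if z: "norm z < 1" for z
  proof (cases "F.radius * norm (\<Phi> z) < 1")
    case False
    thus ?thesis using z by linarith
  next
    case True
    define R where "R = F.radius"
    have R: "R > 0" unfolding R_def by (rule F.radius_pos)
    have sub: "ball 0 (1 / R) \<subseteq> inside I.curve"
    proof (rule ccontr)
      assume "\<not> ?thesis"
      then have "ball 0 (1 / R) \<inter> frontier (inside I.curve) \<noteq> {}"
      proof (intro connected_Int_frontier)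
        show "ball 0 (1 / R) \<inter> inside I.curve \<noteq> {}" using I.zero_inside R by (metis IntI centre_in_ball empty_iff zero_less_divide_1_iff)
      qed auto
      then obtain w where w: "norm w < 1 / R" "w \<in> I.curve" using I.jordan(10) by auto
      have "w \<noteq> 0" using w(2) I.zero_not_in_curve by auto
      hence "1 \<le> R * norm w" using F_radius[OF w(2)] by (simp add: norm_divide R_def field_simps)
      thus False using w(1) R by (simp add: field_simps)
    qed
    have inb: "y / of_real R \<in> inside I.curve" if "norm y < 1" for y :: complex
      using sub that R by (auto simp: norm_divide field_simps intro!: subsetD[OF sub])
    have "norm (E.inverse_map ((of_real R * \<Phi> z) / of_real R)) \<le> norm (of_real R * \<Phi> z)"
    proof (rule Schwarz_Lemma(1))
      have "E.inverse_map \<circ> (\<lambda>y. y / of_real R) holomorphic_on ball 0 1"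
        by (rule holomorphic_on_compose_gen[OF _ E.inverse_map_holomorphic]) (use inb R in \<open>auto intro!: holomorphic_intros\<close>)
      thus "(\<lambda>y. E.inverse_map (y / of_real R)) holomorphic_on ball 0 1" by (simp add: o_def)
      show "E.inverse_map (0 / of_real R) = 0" using E.inverse_map[of 0] \<Phi>(2) by simp
      show "norm (E.inverse_map (y / of_real R)) < 1" if "norm y < 1" for y
        using E.inverse_map_in_ball[OF inb[OF that]] by blast
      show "norm (of_real R * \<Phi> z) < 1" using True R by (simp add: norm_mult R_def)
    qed
    thus ?thesis using R E.inverse_map[OF z] by (simp add: norm_mult R_def)
  qed
  interpret S: conformal_side f' L l g T J X 1
  proof unfold_locales
    show "(1 :: real) = 1 \<or> (1 :: real) = - 1" by simp
    show "T holomorphic_on \<H>" by (rule T_hol)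
    show "T x \<noteq> 0" if "0 < Im x" for x using lift_nz[OF that] by (simp add: T_def)
    show "T x \<notin> F.curve" if "0 < Im x" for x
      using T_out[OF that] outside_no_overlap[of \<Gamma>] \<Gamma>' by blast
    show "\<exists>n::int. x = y + of_real (2 * pi * of_int n)" if "0 < Im x" "0 < Im y" "T x = T y" for x y
    proof (rule exp_i_eq)
      have "E.lift x = E.lift y" using that lift_nz by (simp add: T_def)
      thus "exp (\<i> * x) = exp (\<i> * y)" using E.inverse_map[OF ball1] that unfolding E.lift_def by metis
    qed
    show "T (x + of_real pi) = - T x" if "0 < Im x" for x
      unfolding T_def E.lift_def exp_i_shift_pi E.map_odd[OF ball1[OF that]] by simp
    show "(T \<longlongrightarrow> f' (cis (g u))) (at (of_real u) within \<H>)" for u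
    proof -
      have "f1 (cis (g u)) \<noteq> 0" using f1 norm_on_circle[of "cis (g u)"] norm_on_circle[of "cnj (cis (g u))"] l_pos by auto
      thus ?thesis unfolding T_def f'_def by (intro tendsto_intros lim)
    qed
    show "norm (T x) \<le> F.radius * exp (1 * Im x)" if "0 < Im x" for x
    proof -
      have "exp (- Im x) \<le> F.radius * norm (E.lift x)"
        using grow[OF ball1[OF that]] by (simp add: E.lift_def norm_exp_i)
      hence "exp (- Im x) * exp (Im x) \<le> F.radius * norm (E.lift x) * exp (Im x)" by (intro mult_right_mono) auto
      hence "1 \<le> F.radius * exp (Im x) * norm (E.lift x)" by (simp add: mult_ac flip: exp_add)
      thus ?thesis using lift_nz[OF that] by (simp add: T_def norm_divide pos_divide_le_eq)
    qed
    show "X p holomorphic_on ball 0 1" if "p \<in> F.curve" for p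
      unfolding X_def using not_recip that \<Gamma>' by (intro holomorphic_intros E.holomorphic) auto
    show "inj_on (X p) (ball 0 1)" if "p \<in> F.curve" for p
    proof (rule inj_onI)
      fix x y assume xy: "x \<in> ball 0 1" "y \<in> ball 0 1" "X p x = X p y"
      have "1 - p * \<Phi> x \<noteq> 0" "1 - p * \<Phi> y \<noteq> 0" using not_recip[of x p] not_recip[of y p] xy that \<Gamma>' by auto
      hence "\<Phi> x * (1 - p * \<Phi> y) = \<Phi> y * (1 - p * \<Phi> x)" using xy(3) by (simp add: X_def frac_eq_eq)
      hence "\<Phi> x = \<Phi> y" by (simp add: algebra_simps)
      thus "x = y" using E.injective xy by (metis inj_onD)
    qed
    show "X p (exp (\<i> * x)) = 1 / (T x - p)" if "p \<in> F.curve" "0 < Im x" for p x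
    proof -
      have "T x - p = (1 - p * E.lift x) / E.lift x" using lift_nz[OF that(2)] by (simp add: T_def field_simps)
      thus ?thesis by (simp add: X_def E.lift_def)
    qed
    show "1 / (q - p) \<notin> X p ` ball 0 1" if "p \<in> F.curve" "q \<in> F.curve" "q \<noteq> p" for p q
    proof
      assume "1 / (q - p) \<in> X p ` ball 0 1"
      then obtain z where z: "norm z < 1" "1 / (q - p) = \<Phi> z / (1 - p * \<Phi> z)" by (auto simp: X_def)
      have "1 - p * \<Phi> z \<noteq> 0" using not_recip[OF z(1)] that(1) \<Gamma>' by simp
      hence "1 * (1 - p * \<Phi> z) = \<Phi> z * (q - p)" using z(2) that(3) by (simp add: frac_eq_eq)
      hence "1 - q * \<Phi> z = 0" by (simp add: algebra_simps)
      thus False using not_recip[OF z(1)] that(2) \<Gamma>' by blast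
    qed
    show "infdist (T x) F.curve * exp (- Im x) \<le> (1 - exp (- 2 * Im x)) * norm (deriv T x)" if "0 < Im x" for x
      unfolding \<Gamma>'
    proof (rule Schwarz_Pick_lift[OF T_hol jordan(5)])
      show "(\<lambda>w. E.inverse_map (1 / w)) holomorphic_on outside \<Gamma>"
      proof -
        have "E.inverse_map \<circ> (\<lambda>w. 1 / w) holomorphic_on outside \<Gamma>"
          by (rule holomorphic_on_compose_gen[OF _ E.inverse_map_holomorphic]) (auto intro!: holomorphic_intros simp: out)
        thus ?thesis by (simp add: o_def)
      qed
      show "norm (E.inverse_map (1 / w)) < 1" if "w \<in> outside \<Gamma>" for w
        using E.inverse_map_in_ball that unfolding out by blast
      show "T x \<in> outside \<Gamma> \<and> E.inverse_map (1 / T x) = exp (\<i> * x)" if "0 < Im x" for x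
        using T_out[OF that] E.inverse_map[OF ball1[OF that]] by (simp add: T_def E.lift_def)
      show "ball (T x) (infdist (T x) \<Gamma>) \<subseteq> outside \<Gamma>"
      proof (rule ccontr)
        assume "\<not> ?thesis"
        hence ne: "ball (T x) (infdist (T x) \<Gamma>) - outside \<Gamma> \<noteq> {}" by blast
        hence "infdist (T x) \<Gamma> > 0"
          using infdist_nonneg[of "T x" \<Gamma>] by (cases "infdist (T x) \<Gamma> = 0") auto
        hence "T x \<in> ball (T x) (infdist (T x) \<Gamma>) \<inter> outside \<Gamma>" using T_out[OF that] by simp
        hence "ball (T x) (infdist (T x) \<Gamma>) \<inter> \<Gamma> \<noteq> {}"
          using connected_Int_frontier[OF connected_ball _ ne] jordan(11) by blast
        thus False using infdist_le[of _ \<Gamma> "T x"] by force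
      qed
    qed (use that infdist_nonneg in auto)
    show "J holomorphic_on ball 0 1" unfolding J_def using \<phi>nz
      by (intro holomorphic_intros \<phi>(1) holomorphic_deriv E.holomorphic) auto
    show "J z \<noteq> 0" if "norm z < 1" for z using E.deriv_map_nonzero[OF that] \<phi>nz[OF that] by (simp add: J_def)
    show "norm (J (exp (\<i> * x))) = norm (deriv T x) * exp (- 1 * Im x)" if "0 < Im x" for x
    proof -
      define z where "z = exp (\<i> * x)"
      have z: "norm z < 1" "z \<noteq> 0" "norm z = exp (- 1 * Im x)" using ball1[OF that] by (auto simp: z_def norm_exp_i)
      have "norm (deriv T x) = norm (deriv \<Phi> z) * norm z / (norm (\<Phi> z))\<^sup>2"
        unfolding T_deriv[OF that] E.deriv_lift[OF that] by (simp add: E.lift_def z_def norm_mult norm_divide norm_power)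
      also have "\<dots> * norm z = norm (deriv \<Phi> z) / (norm (\<phi> z))\<^sup>2"
        using z(2) \<phi>(2)[OF z(1)] by (simp add: norm_mult power_mult_distrib power2_eq_square)
      finally show ?thesis using z(3) by (simp add: J_def z_def norm_divide norm_power)
    qed
  qed (use g in auto)
  have img: "T ` \<H> = outside \<Gamma>"
  proof
    show "T ` \<H> \<subseteq> outside \<Gamma>" using T_out by auto
    show "outside \<Gamma> \<subseteq> T ` \<H>"
    proof
      fix w assume "w \<in> outside \<Gamma>"
      hence w: "w \<noteq> 0" "1 / w \<in> inside I.curve" using out by auto
      hence "1 / w \<in> E.lift ` \<H>" unfolding E.lift_image by simp
      then obtain x where "Im x > 0" "1 / w = E.lift x" by auto
      thus "w \<in> T ` \<H>" by (intro image_eqI[of _ _ x]) (auto simp: T_def simp flip: \<open>1 / w = E.lift x\<close>)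
    qed
  qed
  obtain G where G: "side_ok f L l (T ` \<H>) G" "\<And>w. norm (G w) = norm (S.side_map w)"
    using var(3)[OF S.side_map_ok] by blast
  show thesis
  proof (rule that[of G "F.radius * 3 ^ 7"])
    show "side_ok f L l (outside \<Gamma>) G" using G(1) by (simp add: img)
  next
    fix w assume "w \<in> outside \<Gamma>"
    then obtain x where x: "Im x > 0" "w = T x" unfolding img[symmetric] by auto
    have n: "norm (G w) = norm (S.param x)" using G(2) S.side_map_lift[OF x(1)] x(2) by simp
    show "norm (G w) > 1" using n S.norm_param S.Im_ext(1)[OF x(1)] by simp
    have "norm w \<le> F.radius * exp (1 * Im x)" unfolding x(2) by (rule S.growth[OF x(1)])
    also have "\<dots> \<le> F.radius * (3 ^ 7 * norm (S.param x))"
      using S.norm_param_bounds(2)[OF x(1)] F.radius_pos by (intro mult_left_mono) auto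
    finally show "norm w \<le> F.radius * 3 ^ 7 * norm (G w)" unfolding n by (simp only: mult.assoc)
  qed
qed

end

section \<open>Gluing\<close>

lemma Lipschitz_off_closed:
  fixes h :: "'a::euclidean_space \<Rightarrow> 'b::euclidean_space"
  assumes S: "closed S" and cont: "continuous_on UNIV h"
    and on: "\<And>x y. x \<in> S \<Longrightarrow> y \<in> S \<Longrightarrow> norm (h x - h y) \<le> B * norm (x - y)"
    and off: "\<And>x. x \<notin> S \<Longrightarrow> \<exists>D. (h has_derivative D) (at x) \<and> (\<forall>k. norm (D k) \<le> B * norm k)"
  shows "norm (h x - h y) \<le> B * norm (x - y)"
proof -
  define c where "c t = x + t *\<^sub>R (y - x)" for t :: real
  have contc: "continuous_on A c" for A unfolding c_def by (intro continuous_intros)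
  have seg: "norm (h (c b) - h (c a)) \<le> B * norm (y - x) * b - B * norm (y - x) * a"
    if ab: "a \<le> b" and no: "\<And>t. a < t \<Longrightarrow> t < b \<Longrightarrow> c t \<notin> S" for a b
  proof (cases "a = b")
    case False
    hence "a < b" using ab by simp
    obtain D where D: "\<And>x. x \<notin> S \<Longrightarrow> (h has_derivative D x) (at x)" "\<And>x k. x \<notin> S \<Longrightarrow> norm (D x k) \<le> B * norm k"
      using off by metis
    show ?thesis
    proof (rule differentiable_bound_general[OF \<open>a < b\<close>])
      show "continuous_on {a..b} (\<lambda>t. h (c t))" by (rule continuous_on_compose2[OF cont contc]) simp
      show "continuous_on {a..b} (\<lambda>t. B * norm (y - x) * t)" by (intro continuous_intros)
      fix t assume t: "a < t" "t < b"
      have "(c has_vector_derivative (y - x)) (at t)" unfolding c_def by (auto intro!: derivative_eq_intros)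
      thus "((\<lambda>t. h (c t)) has_vector_derivative D (c t) (y - x)) (at t)"
        using vector_derivative_diff_chain_within[of c "y - x" t UNIV h "D (c t)"] has_derivative_at_withinI[OF D(1)[OF no[OF t]]]
        by (simp add: o_def)
      show "((\<lambda>t. B * norm (y - x) * t) has_vector_derivative B * norm (y - x)) (at t)"
        by (auto intro!: derivative_eq_intros simp flip: has_real_derivative_iff_has_vector_derivative)
      show "norm (D (c t) (y - x)) \<le> B * norm (y - x)" by (rule D(2)[OF no[OF t]])
    qed
  qed simp
  define T where "T = {0..1} \<inter> c -` S"
  have c01: "c 0 = x" "c 1 = y" by (simp_all add: c_def)
  show ?thesis
  proof (cases "T = {}")
    case True
    hence "norm (h (c 1) - h (c 0)) \<le> B * norm (y - x) * 1 - B * norm (y - x) * 0"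
    proof (intro seg)
      show "c t \<notin> S" if "0 < t" "t < 1" for t using True that by (auto simp: T_def disjoint_iff)
    qed simp
    thus ?thesis by (simp add: c01 norm_minus_commute)
  next
    case False
    have "compact T" unfolding T_def compact_eq_bounded_closed
      using continuous_closed_vimage[OF S] contc[of UNIV]
      by (auto simp: continuous_on_eq_continuous_at intro: bounded_subset[OF bounded_closed_interval])
    then obtain a b where a: "a \<in> T" "\<And>t. t \<in> T \<Longrightarrow> a \<le> t" and b: "b \<in> T" "\<And>t. t \<in> T \<Longrightarrow> t \<le> b"
      using False compact_attains_inf compact_attains_sup by metis
    have ab: "0 \<le> a" "a \<le> b" "b \<le> 1" "c a \<in> S" "c b \<in> S" using a b by (auto simp: T_def)
    have 1: "norm (h (c a) - h (c 0)) \<le> B * norm (y - x) * a - B * norm (y - x) * 0"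
    proof (intro seg)
      show "c t \<notin> S" if "0 < t" "t < a" for t using a(2)[of t] that ab by (auto simp: T_def)
    qed (rule ab)
    have 3: "norm (h (c 1) - h (c b)) \<le> B * norm (y - x) * 1 - B * norm (y - x) * b"
    proof (intro seg)
      show "c t \<notin> S" if "b < t" "t < 1" for t using b(2)[of t] that ab by (auto simp: T_def)
    qed (rule ab)
    have "c b - c a = (b - a) *\<^sub>R (y - x)" by (simp add: c_def algebra_simps)
    hence 2: "norm (h (c b) - h (c a)) \<le> B * ((b - a) * norm (y - x))"
      using on[OF ab(5,4)] ab(2) by simp
    have "norm (h y - h x) \<le> norm (h (c a) - h (c 0)) + norm (h (c b) - h (c a)) + norm (h (c 1) - h (c b))"
      unfolding c01 by norm
    also have "\<dots> \<le> B * norm (y - x)" using 1 2 3 by (simp add: algebra_simps)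
    finally show ?thesis by (simp add: norm_minus_commute)
  qed
qed

context odd_curve begin

lemma inverse_extension:
  obtains G where "continuous_on UNIV G" "bij G" "\<And>w. G (- w) = - G w" "\<And>z. norm z = 1 \<Longrightarrow> G (f z) = z" "G 0 = 0"
    "\<And>w. w \<notin> insert 0 \<Gamma> \<Longrightarrow> \<exists>D. (G has_derivative D) (at w) \<and>
        (\<forall>h. norm h \<le> 10 ^ 27 * L * norm (D h) \<and> l * norm (D h) \<le> 10 ^ 23 * norm h)"
proof -
  obtain \<Phi> where \<Phi>: "conformal_curve f L l \<Phi>" "\<Phi> 0 = 0" "\<And>z. norm z < 1 \<Longrightarrow> \<Phi> (- z) = - \<Phi> z"
    using odd_Riemann_map by blast
  interpret E: odd_conformal_curve f L l \<Phi>
    by (intro odd_conformal_curve.intro \<Phi>(1) odd_curve_axioms odd_conformal_curve_axioms.intro \<Phi>(2,3))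
  obtain Gi where Gi: "side_ok f L l (inside \<Gamma> - {0}) Gi" "\<And>w. w \<in> inside \<Gamma> - {0} \<Longrightarrow> norm (Gi w) < 1"
    "\<And>w. w \<in> inside \<Gamma> - {0} \<Longrightarrow> Gi w \<noteq> 0"
    "\<And>e. e > 0 \<Longrightarrow> \<exists>d>0. \<forall>w\<in>inside \<Gamma> - {0}. norm w < d \<longrightarrow> norm (Gi w) < e"
    using E.interior_side by blast
  obtain Ge K where Ge: "side_ok f L l (outside \<Gamma>) Ge" "\<And>w. w \<in> outside \<Gamma> \<Longrightarrow> norm (Ge w) > 1"
    "\<And>w. w \<in> outside \<Gamma> \<Longrightarrow> norm w \<le> K * norm (Ge w)"
    using exterior_side by blast
  define G where "G w = (if w = 0 then 0 else if w \<in> inside \<Gamma> then Gi w else if w \<in> outside \<Gamma> then Ge w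
    else inv_into (sphere 0 1) f w)" for w
  have Gin: "G w = Gi w" if "w \<in> inside \<Gamma> - {0}" for w using that by (simp add: G_def)
  have Gout: "G w = Ge w" if "w \<in> outside \<Gamma>" for w
  proof -
    have "w \<notin> inside \<Gamma>" "w \<noteq> 0" using that zero_inside jordan(8) by blast+
    thus ?thesis using that by (simp add: G_def)
  qed
  have f_cases: "f z \<notin> inside \<Gamma>" "f z \<notin> outside \<Gamma>" "f z \<noteq> 0" "f z \<in> \<Gamma>" if "norm z = 1" for z
  proof -
    show "f z \<in> \<Gamma>" using that by (simp add: curve_def)
    thus "f z \<notin> inside \<Gamma>" "f z \<notin> outside \<Gamma>" "f z \<noteq> 0"
      using inside_no_overlap[of \<Gamma>] outside_no_overlap[of \<Gamma>] zero_not_in_curve by (blast, blast, metis)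
  qed
  have Gf: "G (f z) = z" if "norm z = 1" for z
    using f_cases[OF that] inv_into_f_f[OF inj, of z] that by (simp add: G_def)
  have G0: "G 0 = 0" by (simp add: G_def)
  have split: "(w = 0 \<Longrightarrow> P) \<Longrightarrow> (w \<in> inside \<Gamma> - {0} \<Longrightarrow> P) \<Longrightarrow> (w \<in> outside \<Gamma> \<Longrightarrow> P) \<Longrightarrow> (\<And>z. norm z = 1 \<Longrightarrow> w = f z \<Longrightarrow> P) \<Longrightarrow> P" for w P
    using jordan(9) unfolding curve_def by fastforce
  have der: "\<exists>D. (G has_derivative D) (at w) \<and> (\<forall>h. norm h \<le> 10 ^ 27 * L * norm (D h) \<and> l * norm (D h) \<le> 10 ^ 23 * norm h)"
    if w: "w \<notin> insert 0 \<Gamma>" for w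
  proof -
    have glue: "?thesis" if ok: "side_ok f L l W H" "open W" "w \<in> W" "\<And>w. w \<in> W \<Longrightarrow> G w = H w" for W H
    proof -
      obtain D where D: "(H has_derivative D) (at w)" "\<forall>h. norm h \<le> 10 ^ 27 * L * norm (D h) \<and> l * norm (D h) \<le> 10 ^ 23 * norm h"
        using ok(1,3) unfolding side_ok_def by blast
      have "(G has_derivative D) (at w)"
        by (rule has_derivative_transform_within_open[OF D(1) ok(2,3)]) (simp add: ok(4))
      thus ?thesis using D(2) by blast
    qed
    show ?thesis
    proof (rule split[of w])
      assume "w \<in> inside \<Gamma> - {0}"
      thus ?thesis using glue[OF Gi(1) open_delete[OF jordan(1)]] Gin by blast
    next
      assume "w \<in> outside \<Gamma>"
      thus ?thesis using glue[OF Ge(1) jordan(5)] Gout by blast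
    qed (use w f_cases in auto)
  qed
  have cont: "continuous (at w) G" for w
  proof (rule split[of w])
    assume w: "w = 0"
    show ?thesis unfolding continuous_at_eps_delta w
    proof (intro allI impI)
      fix e :: real assume e: "e > 0"
      obtain d where d: "d > 0" "\<And>w. w \<in> inside \<Gamma> - {0} \<Longrightarrow> norm w < d \<Longrightarrow> norm (Gi w) < e" using Gi(4)[OF e] by blast
      obtain r where r: "r > 0" "ball 0 r \<subseteq> inside \<Gamma>" using jordan(1) zero_inside open_contains_ball by blast
      have "dist (G x) (G 0) < e" if "dist x 0 < min d r" for x
      proof (cases "x = 0")
        case False
        hence "x \<in> inside \<Gamma> - {0}" using that r(2) by (auto simp: dist_commute)
        thus ?thesis using d(2)[of x] that Gin G0 by simp
      qed (use e in simp)
      thus "\<exists>d>0. \<forall>x'. dist x' 0 < d \<longrightarrow> dist (G x') (G 0) < e" using d(1) r(1) by (intro exI[of _ "min d r"]) auto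
    qed
  next
    fix z assume z: "norm z = 1" "w = f z"
    show ?thesis unfolding continuous_at_eps_delta z(2)
    proof (intro allI impI)
      fix e :: real assume e: "e > 0"
      obtain d1 where d1: "d1 > 0" "\<And>w. w \<in> inside \<Gamma> - {0} \<Longrightarrow> norm (w - f z) < d1 \<Longrightarrow> norm (Gi w - z) < e"
        using Gi(1) z(1) e unfolding side_ok_def by blast
      obtain d2 where d2: "d2 > 0" "\<And>w. w \<in> outside \<Gamma> \<Longrightarrow> norm (w - f z) < d2 \<Longrightarrow> norm (Ge w - z) < e"
        using Ge(1) z(1) e unfolding side_ok_def by blast
      define d where "d = min (min d1 d2) (min l (l * e))"
      have d: "d > 0" "d \<le> d1" "d \<le> d2" "d \<le> l" "d \<le> l * e" using d1(1) d2(1) l_pos e by (auto simp: d_def)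
      have "dist (G x) (G (f z)) < e" if x: "dist x (f z) < d" for x
      proof (rule split[of x])
        assume "x = 0"
        thus ?thesis using x d(4) norm_on_circle[OF z(1)] by (simp add: dist_norm)
      next
        assume "x \<in> inside \<Gamma> - {0}"
        thus ?thesis using d1(2)[of x] x d Gin Gf[OF z(1)] by (simp add: dist_norm)
      next
        assume "x \<in> outside \<Gamma>"
        thus ?thesis using d2(2)[of x] x d Gout Gf[OF z(1)] by (simp add: dist_norm)
      next
        fix y assume y: "norm y = 1" "x = f y"
        have "l * norm (y - z) \<le> norm (f y - f z)" by (rule lower[OF y(1) z(1)])
        also have "\<dots> < l * e" using x d y by (simp add: dist_norm)
        finally show ?thesis using l_pos Gf y z by (simp add: dist_norm)
      qed
      thus "\<exists>d>0. \<forall>x'. dist x' (f z) < d \<longrightarrow> dist (G x') (G (f z)) < e" using d(1) by blast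
    qed
  next
    assume "w \<in> inside \<Gamma> - {0}"
    hence "w \<notin> insert 0 \<Gamma>" using inside_not_in_curve by blast
    thus ?thesis using der has_derivative_continuous by blast
  next
    assume "w \<in> outside \<Gamma>"
    hence "w \<notin> insert 0 \<Gamma>" using outside_no_overlap[of \<Gamma>] zero_inside jordan(8) by blast
    thus ?thesis using der has_derivative_continuous by blast
  qed
  hence contU: "continuous_on UNIV G" by (simp add: continuous_on_eq_continuous_at)
  have G_in: "norm (G w) < 1" "G w \<noteq> 0" if "w \<in> inside \<Gamma> - {0}" for w
    using Gi(2,3)[OF that] unfolding Gin[OF that] by auto
  have G_out: "norm (G w) > 1" if "w \<in> outside \<Gamma>" for w using Ge(2)[OF that] unfolding Gout[OF that] .
  have inj: "inj G"
  proof (rule injI)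
    fix x y assume eq: "G x = G y"
    show "x = y"
    proof (rule split[of x])
      assume x: "x = 0"
      show ?thesis by (rule split[of y]) (use x eq G0 G_in[of y] G_out[of y] Gf in auto)
    next
      assume x: "x \<in> inside \<Gamma> - {0}"
      have "inj_on Gi (inside \<Gamma> - {0})" using Gi(1) by (simp add: side_ok_def)
      hence "x = y" if "y \<in> inside \<Gamma> - {0}" using x that eq Gin by (metis inj_onD)
      thus ?thesis by - (rule split[of y]; use eq G0 G_in[OF x] G_out[of y] Gf in force)
    next
      assume x: "x \<in> outside \<Gamma>"
      have "inj_on Ge (outside \<Gamma>)" using Ge(1) by (simp add: side_ok_def)
      hence "x = y" if "y \<in> outside \<Gamma>" using x that eq Gout by (metis inj_onD)
      thus ?thesis by - (rule split[of y]; use eq G0 G_in[of y] G_out[OF x] Gf in force)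
    next
      fix z assume z: "norm z = 1" "x = f z"
      show ?thesis by (rule split[of y]) (use z eq G0 G_in[of y] G_out[of y] Gf in force)+
    qed
  qed
  have "closed (range G)"
  proof -
    have cl: "closed (range G \<inter> cball 0 B)" for B
    proof -
      obtain M where M: "\<And>w. w \<in> closure (inside \<Gamma>) \<Longrightarrow> norm w \<le> M"
        using bounded_closure[OF jordan(3)] unfolding bounded_iff by metis
      have "norm w \<le> max M (\<bar>K\<bar> * B)" if w: "norm (G w) \<le> B" for w
      proof (cases "w \<in> outside \<Gamma>")
        case True
        have "norm w \<le> K * norm (G w)" using Ge(3)[OF True] by (simp add: Gout[OF True])
        also have "\<dots> \<le> \<bar>K\<bar> * B" using w by (intro mult_mono) auto
        finally show ?thesis by simp
      next
        case False
        hence "w \<in> closure (inside \<Gamma>)" using jordan(9) unfolding closure_inside by blast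
        thus ?thesis using M by fastforce
      qed
      hence "bounded (G -` cball 0 B)" unfolding bounded_iff by (intro exI[of _ "max M (\<bar>K\<bar> * B)"]) simp
      moreover have "closed (G -` cball 0 B)" by (rule continuous_closed_vimage) (auto simp: cont)
      ultimately have "compact (G ` (G -` cball 0 B))"
        using contU by (intro compact_continuous_image) (auto simp: compact_eq_bounded_closed intro: continuous_on_subset)
      moreover have "G ` (G -` cball 0 B) = range G \<inter> cball 0 B" by auto
      ultimately show ?thesis using compact_imp_closed by metis
    qed
    have "closure (range G) \<subseteq> range G"
    proof
      fix y assume "y \<in> closure (range G)"
      hence "y \<in> closure (ball y 1 \<inter> range G)" using open_Int_closure_subset[of "ball y 1" "range G"] by auto
      also have "\<dots> \<subseteq> closure (range G \<inter> cball 0 (norm y + 1))"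
      proof (rule closure_mono, rule subsetI)
        fix x assume x: "x \<in> ball y 1 \<inter> range G"
        hence "norm (y - x) < 1" by (simp add: dist_norm)
        hence "norm x \<le> norm y + 1" using norm_triangle_sub[of x y] by (simp add: norm_minus_commute)
        thus "x \<in> range G \<inter> cball 0 (norm y + 1)" using x by simp
      qed
      finally show "y \<in> range G" using cl by simp
    qed
    thus ?thesis by (simp add: closure_subset_eq)
  qed
  moreover have "open (range G)" by (rule invariance_of_domain[OF contU open_UNIV inj])
  ultimately have "range G = UNIV" using clopen[of "range G"] by blast
  hence "bij G" using inj by (simp add: bij_def)
  moreover have "G (- w) = - G w" for w
  proof (rule split[of w])
    assume w: "w \<in> inside \<Gamma> - {0}"
    hence "Gi (- w) = - Gi w" using Gi(1) by (auto simp: side_ok_def)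
    moreover have "- w \<in> inside \<Gamma> - {0}" using w inside_symmetric by auto
    ultimately show ?thesis using w Gin by metis
  next
    assume w: "w \<in> outside \<Gamma>"
    hence "Ge (- w) = - Ge w" using Ge(1) by (auto simp: side_ok_def)
    thus ?thesis using w outside_symmetric[OF w] Gout by metis
  next
    fix z assume z: "norm z = 1" "w = f z"
    thus ?thesis using Gf[of "- z"] Gf[of z] odd by simp
  qed (simp add: G0)
  ultimately show thesis using that[of G] contU Gf G0 der by blast
qed

lemma bilipschitz_extension:
  obtains F where "bij F" "\<And>z. F (- z) = - F z" "\<And>z. norm z = 1 \<Longrightarrow> F z = f z"
    "\<And>a b. norm (F a - F b) \<le> 10 ^ 27 * L * norm (a - b)"
    "\<And>a b. norm (a - b) \<le> 10 ^ 23 / l * norm (F a - F b)"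
proof -
  obtain G where G: "continuous_on UNIV G" "bij G" "\<And>w. G (- w) = - G w" "\<And>z. norm z = 1 \<Longrightarrow> G (f z) = z" "G 0 = 0"
    and der: "\<And>w. w \<notin> insert 0 \<Gamma> \<Longrightarrow> \<exists>D. (G has_derivative D) (at w) \<and>
        (\<forall>h. norm h \<le> 10 ^ 27 * L * norm (D h) \<and> l * norm (D h) \<le> 10 ^ 23 * norm h)"
    using inverse_extension by blast
  define F where "F = inv G"
  have FG: "F (G w) = w" and GF: "G (F w) = w" for w
    using G(2) by (simp_all add: F_def bij_is_inj inv_f_f bij_is_surj surj_f_inv_f)
  have Ff: "F z = f z" if "norm z = 1" for z using FG[of "f z"] G(4)[OF that] by simp
  have F0: "F 0 = 0" using FG[of 0] G(5) by simp
  have contF: "continuous_on UNIV F"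
  proof -
    obtain g where g: "homeomorphism UNIV (range G) G g"
      using invariance_of_domain_homeomorphism[OF open_UNIV G(1) _ bij_is_inj[OF G(2)]] by blast
    hence "g = F" by (auto simp: homeomorphism_def fun_eq_iff GF) (metis GF)
    thus ?thesis using g bij_is_surj[OF G(2)] by (simp add: homeomorphism_def)
  qed
  have Glip: "norm (G x - G y) \<le> 10 ^ 23 / l * norm (x - y)" for x y
  proof (rule Lipschitz_off_closed[of "insert 0 \<Gamma>"])
    show "closed (insert 0 \<Gamma>)" using closed_curve by simp
    have base: "norm (G x - G y) \<le> 1 / l * norm (x - y)" if "x \<in> insert 0 \<Gamma>" "y \<in> insert 0 \<Gamma>" for x y
    proof -
      have "l * norm (G x - G y) \<le> norm (x - y)"
        using that lower norm_on_circle by (auto simp: curve_def G(4,5))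
      thus ?thesis using l_pos by (simp add: field_simps)
    qed
    show "norm (G x - G y) \<le> 10 ^ 23 / l * norm (x - y)" if "x \<in> insert 0 \<Gamma>" "y \<in> insert 0 \<Gamma>" for x y
      by (rule order_trans[OF base[OF that]]) (use l_pos in \<open>auto intro!: mult_right_mono divide_right_mono\<close>)
    fix x assume "x \<notin> insert 0 \<Gamma>"
    then obtain D where D: "(G has_derivative D) (at x)" "\<And>h. l * norm (D h) \<le> 10 ^ 23 * norm h" using der by blast
    have "norm (D h) \<le> 10 ^ 23 / l * norm h" for h using D(2)[of h] l_pos by (simp add: field_simps)
    thus "\<exists>D. (G has_derivative D) (at x) \<and> (\<forall>h. norm (D h) \<le> 10 ^ 23 / l * norm h)" using D(1) by blast
  qed (rule G(1))
  have Flip: "norm (F x - F y) \<le> 10 ^ 27 * L * norm (x - y)" for x y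
  proof (rule Lipschitz_off_closed[of "insert 0 (sphere 0 1)"])
    have base: "norm (F x - F y) \<le> L * norm (x - y)" if "x \<in> insert 0 (sphere 0 1)" "y \<in> insert 0 (sphere 0 1)" for x y
      using that upper norm_on_circle by (auto simp: Ff F0)
    show "norm (F x - F y) \<le> 10 ^ 27 * L * norm (x - y)" if "x \<in> insert 0 (sphere 0 1)" "y \<in> insert 0 (sphere 0 1)" for x y
      by (rule order_trans[OF base[OF that]]) (use L_pos in \<open>auto intro!: mult_right_mono\<close>)
    fix x :: complex assume x: "x \<notin> insert 0 (sphere 0 1)"
    have "F x \<notin> insert 0 \<Gamma>"
    proof
      assume "F x \<in> insert 0 \<Gamma>"
      hence "G (F x) \<in> insert 0 (sphere 0 1)" by (auto simp: curve_def G(4,5))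
      thus False using x GF by simp
    qed
    then obtain D where D: "(G has_derivative D) (at (F x))" "\<And>h. norm h \<le> 10 ^ 27 * L * norm (D h)" using der by blast
    have lin: "linear D" using D(1) has_derivative_linear by blast
    have injD: "inj D" unfolding linear_injective_0[OF lin]
    proof (intro allI impI)
      fix h assume "D h = 0" thus "h = 0" using D(2)[of h] by simp
    qed
    obtain D' where D': "linear D'" "D' \<circ> D = id" using linear_injective_left_inverse[OF lin injD] by blast
    have "(F has_derivative D') (at x)"
      by (rule has_derivative_inverse_basic[where f = G and g = F and y = x and T = UNIV, OF D(1) _ D'(2) _ open_UNIV])
         (use D'(1) contF GF in \<open>auto simp: linear_conv_bounded_linear continuous_on_eq_continuous_at\<close>)
    moreover have "norm (D' k) \<le> 10 ^ 27 * L * norm k" for k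
    proof -
      obtain h where "k = D h" using linear_injective_imp_surjective[OF lin injD] by (metis surjD)
      thus ?thesis using D(2)[of h] D'(2) by (metis comp_apply id_apply)
    qed
    ultimately show "\<exists>D. (F has_derivative D) (at x) \<and> (\<forall>k. norm (D k) \<le> 10 ^ 27 * L * norm k)" by blast
  qed (use contF in auto)
  show thesis
  proof (rule that[of F])
    show "bij F" unfolding F_def by (rule bij_imp_bij_inv[OF G(2)])
    show "F (- z) = - F z" for z using G(3)[of "F z"] FG GF by metis
    show "norm (a - b) \<le> 10 ^ 23 / l * norm (F a - F b)" for a b using Glip[of "F a" "F b"] by (simp add: GF)
  qed (fact Ff Flip)+
qed

end

theorem theorem1p2:
  fixes L l :: real and f :: "complex \<Rightarrow> complex"
  assumes "L > 0" and "l > 0"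
    and "bilipschitz_embedding_on L l (sphere 0 1) f"
    and "centrally_symmetric_on (sphere 0 1) f"
  shows "\<exists>F :: complex \<Rightarrow> complex.
           bilipschitz_automorphism (10 ^ 27 * L) (10 powi (- 23) * l) F \<and>
           centrally_symmetric_on UNIV F \<and>
           (\<forall>z\<in>sphere 0 1. F z = f z)"
proof -
  interpret odd_curve f L l
    by unfold_locales (use assms in \<open>auto simp: bilipschitz_embedding_on_def centrally_symmetric_on_def\<close>)
  obtain F where F: "bij F" "\<And>z. F (- z) = - F z" "\<And>z. norm z = 1 \<Longrightarrow> F z = f z"
    "\<And>a b. norm (F a - F b) \<le> 10 ^ 27 * L * norm (a - b)"
    "\<And>a b. norm (a - b) \<le> 10 ^ 23 / l * norm (F a - F b)"
    using bilipschitz_extension by blast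
  have "10 powi (- 23) * l * norm (a - b) \<le> norm (F a - F b)" for a b
    using F(5)[of a b] l_pos by (simp add: power_int_minus field_simps)
  thus ?thesis using F(1-4)
    by (intro exI[of _ F]) (simp add: bilipschitz_automorphism_def bilipschitz_embedding_on_def centrally_symmetric_on_def)
qed

end
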